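(* The following equality holds: $$\mathsf{PE}=\mathsf{TM}\cap\llbracket \phi(\lambda_{\mathsf{PE}})=\phi(\rho_{\mathsf{PE}})\rrbracket,$$ where $\phi$ is the continuous endomorphism of the free profinite semigroup on $\{x,y,z\}$ such that $\phi(x)=xzzx$, $\phi(y)=zxxz$ and $\phi(z)=z$.
   Context: For a semigroup $S$, $S^1=S$ if $S$ has an identity element, and otherwise $S^1=S\cup\{1\}$ with an adjoined identity. For $x,y\in S$ and $z_1,z_2,\ldots\in S^1$ put $\lambda_0=x$, $\rho_0=y$, $\lambda_{n+1}=\lambda_n z_{n+1}\rho_n$, $\rho_{n+1}=\rho_n z_{n+1}\lambda_n$, with $\lambda_n=\lambda_n(x,y,z_1,\ldots,z_n)$, $\rho_n=\rho_n(x,y,z_1,\ldots,z_n)$. $\mathsf{PE}$ is the class of finite positively Engel semigroups: finite semigroups $S$ for which there is $n\ge2$ with $\lambda_n(a,b,1,1,c,c^2,\ldots,c^{n-2})=\rho_n(a,b,1,1,c,c^2,\ldots,c^{n-2})$ for all $a,b\in S$, $c\in S^1$. $\mathsf{TM}$ is the class of finite Thue--Morse semigroups: finite semigroups $S$ for which there is $n\ge0$ with $\lambda_n(a,b,1,\ldots,1)=\rho_n(a,b,1,\ldots,1)$ for all $a,b\in S$. $(\lambda_{\mathsf{PE}},\rho_{\mathsf{PE}})$ denotes the limit, as $n\to\infty$, of the (convergent) sequence of pairs $\bigl(\lambda_{n!}(x,y,z,z^2,\ldots,z^{n!}),\rho_{n!}(x,y,z,z^2,\ldots,z^{n!})\bigr)$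 in the square of the free profinite semigroup on $\{x,y,z\}$. For elements $\pi,\rho$ of the free profinite semigroup on a finite set $A$, a finite semigroup $S$ satisfies the pseudoidentity $\pi=\rho$ if $\theta(\pi)=\theta(\rho)$ for every continuous homomorphism $\theta$ from the free profinite semigroup on $A$ to $S$ (discrete topology); $\llbracket\Sigma\rrbracket$ denotes the class of all finite semigroups satisfying all pseudoidentities in $\Sigma$. *)

theory Defs
  imports "HOL-Analysis.Analysis" "HOL-Algebra.Group"
begin

section \<open>Semigroups\<close>

text \<open>
  The record \<open>monoid\<close> of HOL-Algebra carries a unit, so semigroups get a record of their own.
  The empty semigroup is admitted; it lies in each of the classes below.
\<close>

record 'a sgrp = "'a partial_object" +
  smult :: "'a \<Rightarrow> 'a \<Rightarrow> 'a" (infixl \<open>\<cdot>\<index>\<close> 70)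

locale sgroup =
  fixes S :: "'a sgrp" (structure)
  assumes smult_closed: "\<lbrakk>x \<in> carrier S; y \<in> carrier S\<rbrakk> \<Longrightarrow> x \<cdot> y \<in> carrier S"
    and smult_assoc: "\<lbrakk>x \<in> carrier S; y \<in> carrier S; z \<in> carrier S\<rbrakk>
      \<Longrightarrow> (x \<cdot> y) \<cdot> z = x \<cdot> (y \<cdot> z)"

definition finite_sgroup :: "'a sgrp \<Rightarrow> bool" where
  "finite_sgroup S \<longleftrightarrow> sgroup S \<and> finite (carrier S)"

definition sg_hom :: "'a sgrp \<Rightarrow> 'b sgrp \<Rightarrow> ('a \<Rightarrow> 'b) set" where
  "sg_hom S T = {h. h \<in> carrier S \<rightarrow> carrier T \<and>
     (\<forall>x\<in>carrier S. \<forall>y\<in>carrier S. h (x \<cdot>\<^bsub>S\<^esub> y) = h x \<cdot>\<^bsub>T\<^esub> h y)}"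

definition is_identity :: "'a sgrp \<Rightarrow> 'a \<Rightarrow> bool" where
  "is_identity S e \<longleftrightarrow> e \<in> carrier S \<and> (\<forall>x\<in>carrier S. e \<cdot>\<^bsub>S\<^esub> x = x \<and> x \<cdot>\<^bsub>S\<^esub> e = x)"

text \<open>
  The monoid \<open>S\<^sup>1\<close>. Elements of \<open>S\<close> appear as \<open>Some s\<close>; \<open>None\<close> is the adjoined identity and
  belongs to the carrier only if \<open>S\<close> has no identity of its own.
\<close>

definition adjoin_one :: "'a sgrp \<Rightarrow> 'a option monoid" where
  "adjoin_one S =
     \<lparr>carrier = Some ` carrier S \<union> (if \<exists>e. is_identity S e then {} else {None}),
      mult = (\<lambda>u v. case u of None \<Rightarrow> v
                | Some a \<Rightarrow> (case v of None \<Rightarrow> u | Some b \<Rightarrow> Some (a \<cdot>\<^bsub>S\<^esub> b))),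
      one = (if \<exists>e. is_identity S e then Some (THE e. is_identity S e) else None)\<rparr>"

section \<open>The words of the Engel and Thue--Morse identities\<close>

text \<open>
  The products are formed in \<open>S\<^sup>1\<close>, but lie in \<open>S\<close> since they have factors from \<open>S\<close>; hence
  \<open>the\<close> is only applied to values of the form \<open>Some s\<close>. The value \<open>z 0\<close> is not used.
\<close>

fun lam :: "'a sgrp \<Rightarrow> 'a \<Rightarrow> 'a \<Rightarrow> (nat \<Rightarrow> 'a option) \<Rightarrow> nat \<Rightarrow> 'a"
  and rho :: "'a sgrp \<Rightarrow> 'a \<Rightarrow> 'a \<Rightarrow> (nat \<Rightarrow> 'a option) \<Rightarrow> nat \<Rightarrow> 'a" where
  "lam S x y z 0 = x"
| "rho S x y z 0 = y"
| "lam S x y z (Suc n) =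
     the (Some (lam S x y z n) \<otimes>\<^bsub>adjoin_one S\<^esub> z (Suc n) \<otimes>\<^bsub>adjoin_one S\<^esub> Some (rho S x y z n))"
| "rho S x y z (Suc n) =
     the (Some (rho S x y z n) \<otimes>\<^bsub>adjoin_one S\<^esub> z (Suc n) \<otimes>\<^bsub>adjoin_one S\<^esub> Some (lam S x y z n))"

text \<open>The sequence \<open>1, 1, c, c\<^sup>2, c\<^sup>3, \<dots>\<close>, indexed from 1.\<close>

definition engel_seq :: "'a sgrp \<Rightarrow> 'a option \<Rightarrow> nat \<Rightarrow> 'a option" where
  "engel_seq S c i = (if i \<le> 1 then \<one>\<^bsub>adjoin_one S\<^esub> else c [^]\<^bsub>adjoin_one S\<^esub> (i - 2))"

definition PE :: "'s sgrp set" where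
  "PE = {S. finite_sgroup S \<and>
     (\<exists>n\<ge>2. \<forall>a\<in>carrier S. \<forall>b\<in>carrier S. \<forall>c\<in>carrier (adjoin_one S).
        lam S a b (engel_seq S c) n = rho S a b (engel_seq S c) n)}"

definition TM :: "'s sgrp set" where
  "TM = {S. finite_sgroup S \<and>
     (\<exists>n. \<forall>a\<in>carrier S. \<forall>b\<in>carrier S.
        lam S a b (\<lambda>_. \<one>\<^bsub>adjoin_one S\<^esub>) n = rho S a b (\<lambda>_. \<one>\<^bsub>adjoin_one S\<^esub>) n)}"

section \<open>Free profinite semigroups\<close>

definition plus_words :: "'a set \<Rightarrow> 'a list set" where
  "plus_words A = lists A - {[]}"

definition fin_congs :: "'a set \<Rightarrow> 'a list rel set" where
  "fin_congs A = {\<theta>. equiv (plus_words A) \<theta> \<and> finite (plus_words A // \<theta>) \<and>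
     (\<forall>(u, u')\<in>\<theta>. \<forall>(v, v')\<in>\<theta>. (u @ v, u' @ v') \<in> \<theta>)}"

text \<open>
  The free profinite semigroup on a finite set \<open>A\<close>, as the projective limit of the finite
  quotients of \<open>A\<^sup>+\<close>: compatible families of classes, one for each finite-index congruence,
  with pointwise multiplication and the topology induced from the product of the discrete
  quotients.
\<close>

definition free_prof :: "'a set \<Rightarrow> ('a list rel \<Rightarrow> 'a list set) sgrp" where
  "free_prof A =
     \<lparr>carrier = {f \<in> (\<Pi>\<^sub>E \<theta>\<in>fin_congs A. plus_words A // \<theta>).
        \<forall>\<theta>\<in>fin_congs A. \<forall>\<theta>'\<in>fin_congs A. \<theta> \<subseteq> \<theta>' \<longrightarrow> f \<theta> \<subseteq> f \<theta>'},
      smult = (\<lambda>f g. \<lambda>\<theta>\<in>fin_congs A. \<theta> `` {u @ v | u v. u \<in> f \<theta> \<and> v \<in> g \<theta>})\<rparr>"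

definition free_prof_top :: "'a set \<Rightarrow> ('a list rel \<Rightarrow> 'a list set) topology" where
  "free_prof_top A =
     subtopology (product_topology (\<lambda>\<theta>. discrete_topology (plus_words A // \<theta>)) (fin_congs A))
       (carrier (free_prof A))"

definition gen :: "'a set \<Rightarrow> 'a \<Rightarrow> 'a list rel \<Rightarrow> 'a list set" where
  "gen A a = (\<lambda>\<theta>\<in>fin_congs A. \<theta> `` {[a]})"

text \<open>Pseudoidentities over \<open>A\<close> are pairs of elements of the free profinite semigroup on \<open>A\<close>.\<close>

definition satisfies ::
  "'a set \<Rightarrow> 's sgrp \<Rightarrow> ('a list rel \<Rightarrow> 'a list set) \<times> ('a list rel \<Rightarrow> 'a list set) \<Rightarrow> bool" where
  "satisfies A S p \<longleftrightarrow>
     (\<forall>h. h \<in> sg_hom (free_prof A) S \<and>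
          continuous_map (free_prof_top A) (discrete_topology (carrier S)) h
          \<longrightarrow> h (fst p) = h (snd p))"

definition models ::
  "'a set \<Rightarrow> (('a list rel \<Rightarrow> 'a list set) \<times> ('a list rel \<Rightarrow> 'a list set)) set \<Rightarrow> 's sgrp set" where
  "models A \<Sigma> = {S. finite_sgroup S \<and> (\<forall>p\<in>\<Sigma>. satisfies A S p)}"

section \<open>The pseudowords of the theorem\<close>

datatype var = VX | VY | VZ

type_synonym pseudoword = "var list rel \<Rightarrow> var list set"

abbreviation F3 :: "pseudoword sgrp" where
  "F3 \<equiv> free_prof UNIV"

abbreviation F3_top :: "pseudoword topology" where
  "F3_top \<equiv> free_prof_top UNIV"

abbreviation gx :: pseudoword where "gx \<equiv> gen UNIV VX"
abbreviation gy :: pseudoword where "gy \<equiv> gen UNIV VY"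
abbreviation gz :: pseudoword where "gz \<equiv> gen UNIV VZ"

definition lamrho_PE :: "pseudoword \<times> pseudoword" where
  "lamrho_PE = (THE p. limitin (prod_topology F3_top F3_top)
     (\<lambda>n. (lam F3 gx gy (\<lambda>i. Some gz [^]\<^bsub>adjoin_one F3\<^esub> i) (fact n),
           rho F3 gx gy (\<lambda>i. Some gz [^]\<^bsub>adjoin_one F3\<^esub> i) (fact n)))
     p sequentially)"

definition lam_PE :: pseudoword where "lam_PE = fst lamrho_PE"

definition rho_PE :: pseudoword where "rho_PE = snd lamrho_PE"

text \<open>Functions are made extensional on the carrier so that \<open>\<phi>\<close> is unique as a HOL function.\<close>

definition phi_PE :: "pseudoword \<Rightarrow> pseudoword" where
  "phi_PE = (THE \<phi>. \<phi> \<in> extensional (carrier F3) \<and> \<phi> \<in> sg_hom F3 F3 \<and>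
     continuous_map F3_top F3_top \<phi> \<and>
     \<phi> gx = gx \<cdot>\<^bsub>F3\<^esub> gz \<cdot>\<^bsub>F3\<^esub> gz \<cdot>\<^bsub>F3\<^esub> gx \<and>
     \<phi> gy = gz \<cdot>\<^bsub>F3\<^esub> gx \<cdot>\<^bsub>F3\<^esub> gx \<cdot>\<^bsub>F3\<^esub> gz \<and>
     \<phi> gz = gz)"

end

theory Submission
  imports Defs "HOL-Algebra.Weak_Morphisms"
begin

text \<open>
  The substitution \<open>\<phi>\<close> starts the iteration at \<open>\<lambda>\<^sub>2(x, z, 1, 1)\<close> and \<open>\<rho>\<^sub>2(x, z, 1, 1)\<close>, so the
  pseudoidentity says that the words \<open>\<lambda>\<^sub>n\<close> and \<open>\<rho>\<^sub>n\<close> on \<open>a, c, 1, 1, c, c\<^sup>2, \<dots>\<close> eventually agree, that is,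
  only the case \<open>b = c\<close> of the Engel condition is required. Conversely, suppose that the iteration on
  \<open>a, b, 1, 1, d, d\<^sup>2, \<dots>\<close> never merges. By finiteness it is eventually periodic, and the Thue--Morse
  condition (idempotents that are R-related or L-related are equal) confines it to idempotents \<open>e, e'\<close>
  that \<open>d\<close> fixes or exchanges. If \<open>e \<noteq> e'\<close>, the iteration on \<open>e, d\<close> does not merge either. If
  \<open>e = e'\<close>, it takes place in a maximal subgroup, and it remains to show that a finite group that satisfies
  both conditions is nilpotent, as the iteration merges step by step along a central series.

  A minimal group with trivial center is not simple: otherwise two maximal subgroups would meet
  trivially, and tracing a Thue--Morse iteration backwards from the first time when its values commute
  would place any two elements in one maximal subgroup. In a minimal abelian normal subgroup \<open>B\<close>, the Thue--Morse
  condition yields a nontrivial element fixed by some \<open>c\<^bsup>2^n\<^esup>\<close>, and then the Engel condition one that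
  is also fixed by an odd power of \<open>c\<close>, hence by \<open>c\<close>. Choosing \<open>c\<close> central modulo the centralizer
  of \<open>B\<close> forces \<open>B\<close> into the center.
\<close>

section \<open>The twisted iteration\<close>

text \<open>Exponents drive the argument. Take a run whose two words lie in one coset of an abelian
  subgroup. With all middle factors 1, the power of \<open>c\<close> between them at step n has
  exponent 2^n. With middle factors 1, 1, c, c^2, ... the words carry an exponent \<open>M n\<close>
  with \<open>M (n + 1) = 2 * M n + n\<close>, and the power between them has exponent
  \<open>M n + n = 2^(n+1) - 1\<close>. A power of two and an odd number are coprime, which is how
  the two conditions cooperate. The same parity settles the case of two idempotents: an odd power of
  \<open>d\<close> exchanges them, so the run on \<open>e, d\<close> keeps them apart.

  The obstacle is that the assumed Engel runs start at their own middle element, while the desired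
  ones start anywhere. In groups nilpotency bridges this gap, since it makes every run merge,
  whatever its middle factors.

  Passing to the limit loses nothing: merged words stay merged, and the values in a finite semigroup
  are eventually periodic, hence constant along n! from some point on.\<close>

text \<open>Unlike the arguments of \<open>lam\<close> and \<open>rho\<close>, the sequence \<open>z\<close> is indexed from 0 here.\<close>

primrec twist :: "('a \<Rightarrow> 'z \<Rightarrow> 'a \<Rightarrow> 'a) \<Rightarrow> (nat \<Rightarrow> 'z) \<Rightarrow> 'a \<times> 'a \<Rightarrow> nat \<Rightarrow> 'a \<times> 'a" where
  "twist m z p 0 = p"
| "twist m z p (Suc n) = (case twist m z p n of (l, r) \<Rightarrow> (m l (z n) r, m r (z n) l))"

definition merges :: "('a \<Rightarrow> 'z \<Rightarrow> 'a \<Rightarrow> 'a) \<Rightarrow> (nat \<Rightarrow> 'z) \<Rightarrow> 'a \<times> 'a \<Rightarrow> bool" where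
  "merges m z p \<longleftrightarrow> (\<exists>n. fst (twist m z p n) = snd (twist m z p n))"

lemma twist_add: "twist m z p (n + k) = twist m (\<lambda>i. z (n + i)) (twist m z p n) k"
  by (induction k) auto

text \<open>Swapping equal words changes nothing. Hence finitely many merging runs have a common
  index, and inspecting the indices n! is enough.\<close>

lemma twist_eq_mono:
  assumes "fst (twist m z p n) = snd (twist m z p n)" "n \<le> k"
  shows "fst (twist m z p k) = snd (twist m z p k)"
  using assms(2,1) by (induction k rule: dec_induct) (auto split: prod.splits)

lemma twist_in:
  assumes "\<And>l k r. \<lbrakk>l \<in> A; r \<in> A\<rbrakk> \<Longrightarrow> m l (z k) r \<in> A" "p \<in> A \<times> A"
  shows "twist m z p n \<in> A \<times> A"
  using assms by (induction n) (auto split: prod.splits)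

text \<open>Besides homomorphisms, \<open>f\<close> may be the identity: this compares runs whose
  products or middle factors differ but act alike on \<open>A\<close>.\<close>

lemma twist_hom:
  assumes "\<And>l k r. \<lbrakk>l \<in> A; r \<in> A\<rbrakk> \<Longrightarrow> m l (z k) r \<in> A"
    and "\<And>l k r. \<lbrakk>l \<in> A; r \<in> A\<rbrakk> \<Longrightarrow> f (m l (z k) r) = m' (f l) (z' k) (f r)"
    and "p \<in> A \<times> A"
  shows "twist m' z' (map_prod f f p) n = map_prod f f (twist m z p n)"
proof (induction n)
  case (Suc n)
  have "twist m z p n \<in> A \<times> A" using assms by (intro twist_in) auto
  with Suc assms(2) show ?case by (auto split: prod.splits)
qed simp

text \<open>Lets an argument start at any later time, in particular on the cycle that a run in a
  finite set eventually enters.\<close>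

lemma merges_shift: "merges m (\<lambda>i. z (n + i)) (twist m z p n) \<longleftrightarrow> merges m z p"
proof
  assume "merges m z p"
  then obtain k where "fst (twist m z p k) = snd (twist m z p k)" by (auto simp: merges_def)
  then have "fst (twist m z p (n + k)) = snd (twist m z p (n + k))" by (rule twist_eq_mono) simp
  then show "merges m (\<lambda>i. z (n + i)) (twist m z p n)" unfolding merges_def twist_add[symmetric] by blast
next
  assume "merges m (\<lambda>i. z (n + i)) (twist m z p n)"
  then show "merges m z p" unfolding merges_def twist_add[symmetric] by blast
qed

section \<open>The two merging conditions and their transfer between groups\<close>

definition triple :: "('a, 'b) monoid_scheme \<Rightarrow> 'a \<Rightarrow> 'a \<Rightarrow> 'a \<Rightarrow> 'a" where
  "triple G l z r = l \<otimes>\<^bsub>G\<^esub> z \<otimes>\<^bsub>G\<^esub> r"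

text \<open>Truncated subtraction makes \<open>i - 1\<close> run through 0, 0, 1, 2, ..., so the
  middle factors are 1, 1, b, b^2, .... The second word at the start is the middle element itself,
  as in the pseudoidentity.\<close>

definition thue_engel :: "('a, 'b) monoid_scheme \<Rightarrow> bool" where
  "thue_engel G \<longleftrightarrow> (\<forall>a\<in>carrier G. \<forall>b\<in>carrier G.
     merges (triple G) (\<lambda>_. \<one>\<^bsub>G\<^esub>) (a, b) \<and> merges (triple G) (\<lambda>i. b [^]\<^bsub>G\<^esub> (i - 1)) (a, b))"

lemma (in group) thue_engel_subgroup:
  assumes "thue_engel G" "subgroup H G"
  shows "thue_engel (G\<lparr>carrier := H\<rparr>)"
proof -
  have "triple (G\<lparr>carrier := H\<rparr>) = triple G" by (simp add: triple_def fun_eq_iff)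
  moreover have "H \<subseteq> carrier G" using assms by (simp add: subgroup.subset)
  ultimately show ?thesis using assms
    by (auto simp: thue_engel_def simp flip: nat_pow_consistent)
qed

lemma (in group_hom) thue_engel_image:
  assumes "thue_engel G" "carrier H = h ` carrier G"
  shows "thue_engel H"
proof -
  have img: "merges (triple H) (\<lambda>i. h (z i)) (h a, h b)"
    if "merges (triple G) z (a, b)" "\<And>i. z i \<in> carrier G" "a \<in> carrier G" "b \<in> carrier G" for z a b
  proof -
    have "twist (triple H) (\<lambda>i. h (z i)) (map_prod h h (a, b)) n = map_prod h h (twist (triple G) z (a, b) n)" for n
      by (rule twist_hom[where A = "carrier G"]) (use that in \<open>auto simp: triple_def\<close>)
    then have eq: "twist (triple H) (\<lambda>i. h (z i)) (h a, h b) n = map_prod h h (twist (triple G) z (a, b) n)" for n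
      by simp
    from that(1) obtain n where "fst (twist (triple G) z (a, b) n) = snd (twist (triple G) z (a, b) n)"
      by (auto simp: merges_def)
    then show ?thesis unfolding merges_def eq by (intro exI[of _ n]) simp
  qed
  show ?thesis unfolding thue_engel_def assms(2)
  proof safe
    fix a b assume ab: "a \<in> carrier G" "b \<in> carrier G"
    show "merges (triple H) (\<lambda>_. \<one>\<^bsub>H\<^esub>) (h a, h b)"
      using img[of "\<lambda>_. \<one>\<^bsub>G\<^esub>" a b] assms(1) ab by (simp add: thue_engel_def)
    show "merges (triple H) (\<lambda>i. h b [^]\<^bsub>H\<^esub> (i - 1)) (h a, h b)"
      using img[of "\<lambda>i. b [^]\<^bsub>G\<^esub> (i - 1)" a b] assms(1) ab
      by (simp add: thue_engel_def hom_nat_pow)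
  qed
qed

lemma (in group) commute_inv:
  assumes "a \<otimes> b = b \<otimes> a" "a \<in> carrier G" "b \<in> carrier G"
  shows "inv a \<otimes> b = b \<otimes> inv a"
proof -
  have "inv a \<otimes> b = inv a \<otimes> (b \<otimes> a) \<otimes> inv a" using assms(2,3) by (simp add: m_assoc)
  also have "\<dots> = b \<otimes> inv a" unfolding assms(1)[symmetric] using assms(2,3) by (simp flip: m_assoc)
  finally show ?thesis .
qed

lemma (in group) commute_mult:
  assumes "a \<otimes> c = c \<otimes> a" "b \<otimes> c = c \<otimes> b" "a \<in> carrier G" "b \<in> carrier G" "c \<in> carrier G"
  shows "(a \<otimes> b) \<otimes> c = c \<otimes> (a \<otimes> b)"
proof -
  have "(a \<otimes> b) \<otimes> c = a \<otimes> (c \<otimes> b)" using assms by (simp add: m_assoc)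
  also have "\<dots> = (c \<otimes> a) \<otimes> b" using assms by (simp flip: m_assoc)
  finally show ?thesis using assms by (simp add: m_assoc)
qed

text \<open>
  Representing cosets by chosen elements keeps quotients in the type of the group, so that
  inductions on the order can pass to quotients.
\<close>

lemma (in group) quotient_same_type:
  assumes "N \<lhd> G"
  obtains K :: "'a monoid" and f where "group_hom G K f" "carrier K = f ` carrier G"
    "\<And>a b. \<lbrakk>a \<in> carrier G; b \<in> carrier G\<rbrakk> \<Longrightarrow> f a = f b \<longleftrightarrow> a \<otimes> inv b \<in> N"
proof -
  interpret N: normal N G by fact
  define f where "f x = (SOME y. y \<in> N #> x)" for x
  have mem: "f x \<in> N #> x" if "x \<in> carrier G" for x
    unfolding f_def using rcos_self[OF that N.subgroup_axioms] by (rule someI)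
  have eq: "f a = f b \<longleftrightarrow> a \<otimes> inv b \<in> N" if ab: "a \<in> carrier G" "b \<in> carrier G" for a b
  proof -
    have "f a = f b \<longleftrightarrow> N #> a = N #> b"
    proof
      assume "f a = f b"
      then have "f a \<in> N #> b" using mem[OF ab(2)] by simp
      then show "N #> a = N #> b"
        using repr_independence[OF mem[OF ab(1)] ab(1) N.subgroup_axioms]
          repr_independence[OF _ ab(2) N.subgroup_axioms] by simp
    qed (simp add: f_def)
    also have "\<dots> \<longleftrightarrow> a \<in> N #> b"
      using rcos_self[OF ab(1) N.subgroup_axioms] repr_independence[OF _ ab(2) N.subgroup_axioms]
      by auto
    also have "\<dots> \<longleftrightarrow> a \<otimes> inv b \<in> N"
      by (rule N.rcos_module[OF is_group ab(2,1)])
    finally show ?thesis .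
  qed
  have "weak_group_morphism f N G" by (rule weak_group_morphismsI[OF assms eq])
  then have "group_hom G (image_group f G) f" by (rule weak_group_morphism_group_hom)
  then show ?thesis using eq by (rule that[OF _ image_group_carrier])
qed

text \<open>\<open>X\<close> is the full preimage of the center of H/N, which is nontrivial by the
  hypothesis on smaller groups. The last conclusion says that the commutators of \<open>X\<close>
  and \<open>H\<close> lie in \<open>N\<close>; in this form later arguments stay inside
  \<open>G\<close>.\<close>

lemma (in group) section_center:
  assumes fin: "finite (carrier G)" and te: "thue_engel G"
    and IH: "\<And>K :: 'a monoid. \<lbrakk>group K; finite (carrier K); thue_engel K;
        card (carrier K) < card (carrier G); carrier K \<noteq> {\<one>\<^bsub>K\<^esub>}\<rbrakk> \<Longrightarrow>
        \<exists>x\<in>carrier K. x \<noteq> \<one>\<^bsub>K\<^esub> \<and> (\<forall>y\<in>carrier K. x \<otimes>\<^bsub>K\<^esub> y = y \<otimes>\<^bsub>K\<^esub> x)"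
    and H: "subgroup H G" and N: "subgroup N G" "N \<subset> H"
    and nrm: "\<And>h n. \<lbrakk>h \<in> H; n \<in> N\<rbrakk> \<Longrightarrow> h \<otimes> n \<otimes> inv h \<in> N"
    and small: "H \<noteq> carrier G \<or> N \<noteq> {\<one>}"
  obtains X where "subgroup X G" "N \<subset> X" "X \<subseteq> H"
    "\<And>x y. \<lbrakk>x \<in> X; y \<in> H\<rbrakk> \<Longrightarrow> y \<otimes> x \<otimes> inv y \<in> X"
    "\<And>x y. \<lbrakk>x \<in> X; y \<in> H\<rbrakk> \<Longrightarrow> (x \<otimes> y) \<otimes> inv (y \<otimes> x) \<in> N"
proof -
  let ?GH = "G\<lparr>carrier := H\<rparr>"
  interpret H: group ?GH using H by (rule subgroup_imp_group)
  have Hsub: "H \<subseteq> carrier G" using H by (simp add: subgroup.subset)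
  have inv[simp]: "inv\<^bsub>?GH\<^esub> x = inv x" if "x \<in> H" for x
    using m_inv_consistent[OF H that] .
  have "subgroup N ?GH" using N H by (intro subgroup_incl) auto
  then have "N \<lhd> ?GH" using nrm N by (auto simp: H.normal_inv_iff)
  then obtain K :: "'a monoid" and f where K: "group_hom ?GH K f" "carrier K = f ` H"
    and f: "\<And>a b. \<lbrakk>a \<in> H; b \<in> H\<rbrakk> \<Longrightarrow> f a = f b \<longleftrightarrow> a \<otimes> inv b \<in> N"
    by (rule H.quotient_same_type) auto
  interpret h: group_hom ?GH K f by fact
  have finH: "finite H" using fin Hsub by (rule finite_subset[rotated])
  have one: "\<one> \<in> H" "\<one> \<in> N" using H N by (auto simp: subgroup.one_closed)
  have fN: "f a = \<one>\<^bsub>K\<^esub> \<longleftrightarrow> a \<in> N" if "a \<in> H" for a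
    using f[OF that one(1)] h.hom_one that Hsub by (auto simp: subset_iff)
  \<comment> \<open>Either \<open>H\<close> is a proper subgroup, or \<open>N\<close> is nontrivial
    and \<open>f\<close> is not injective.\<close>
  have "card (carrier K) < card (carrier G)"
  proof (cases "H = carrier G")
    case False
    then have "card H < card (carrier G)" using Hsub fin by (intro psubset_card_mono) auto
    then show ?thesis using card_image_le[OF finH, of f] by (simp add: K)
  next
    case True
    then obtain n where n: "n \<in> N" "n \<noteq> \<one>" using small one by auto
    then have nH: "n \<in> H" using N by blast
    have "f n = \<one>\<^bsub>K\<^esub>" "f \<one> = \<one>\<^bsub>K\<^esub>" using fN[OF nH] fN[OF one(1)] n one by simp_all
    then have "f n = f \<one>" by simp
    then have "\<not> inj_on f H" using inj_on_eq_iff[OF _ nH one(1), of f] n(2) by argo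
    then have "card (f ` H) \<noteq> card H" using eq_card_imp_inj_on[OF finH] by blast
    then show ?thesis using card_image_le[OF finH, of f] by (simp add: True[symmetric] K(2))
  qed
  moreover have "carrier K \<noteq> {\<one>\<^bsub>K\<^esub>}"
  proof -
    obtain a where "a \<in> H" "a \<notin> N" using N by blast
    then show ?thesis using fN K by blast
  qed
  moreover have "thue_engel K"
    using h.thue_engel_image[OF thue_engel_subgroup[OF te H]] K by simp
  ultimately obtain x0 where x0: "x0 \<in> carrier K" "x0 \<noteq> \<one>\<^bsub>K\<^esub>"
      "\<And>y. y \<in> carrier K \<Longrightarrow> x0 \<otimes>\<^bsub>K\<^esub> y = y \<otimes>\<^bsub>K\<^esub> x0"
    using IH[of K] h.H.is_group finH K by auto
  define X where "X = {x \<in> H. \<forall>y\<in>H. f x \<otimes>\<^bsub>K\<^esub> f y = f y \<otimes>\<^bsub>K\<^esub> f x}"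
  have fc: "f x \<in> carrier K" if "x \<in> H" for x using that K by simp
  have fm: "f (x \<otimes> y) = f x \<otimes>\<^bsub>K\<^esub> f y" if "x \<in> H" "y \<in> H" for x y
    using h.hom_mult that by simp
  have finv: "f (inv x) = inv\<^bsub>K\<^esub> f x" if "x \<in> H" for x
    using h.hom_inv[of x] that by simp
  have Hm: "x \<otimes> y \<in> H" "inv x \<in> H" if "x \<in> H" "y \<in> H" for x y
    using that H by (auto simp: subgroup.m_closed subgroup.m_inv_closed)
  show ?thesis
  proof (rule that[of X])
    show "subgroup X G"
    proof (rule subgroupI)
      show "X \<subseteq> carrier G" using Hsub X_def by auto
      have "\<one> \<in> X" using one fN[OF one(1)] fc by (auto simp: X_def)
      then show "X \<noteq> {}" by auto
      fix a assume a: "a \<in> X"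
      have "inv\<^bsub>K\<^esub> f a \<otimes>\<^bsub>K\<^esub> f y = f y \<otimes>\<^bsub>K\<^esub> inv\<^bsub>K\<^esub> f a" if y: "y \<in> H" for y
      proof -
        have "f a \<otimes>\<^bsub>K\<^esub> f y = f y \<otimes>\<^bsub>K\<^esub> f a" "a \<in> H" using a y by (auto simp: X_def)
        then show ?thesis using fc y by (intro h.H.commute_inv) simp_all
      qed
      moreover have "a \<in> H" using a by (simp add: X_def)
      ultimately show "inv a \<in> X" unfolding X_def mem_Collect_eq by (metis finv Hm(2))
      fix b assume b: "b \<in> X"
      have "f a \<otimes>\<^bsub>K\<^esub> f b \<otimes>\<^bsub>K\<^esub> f y = f y \<otimes>\<^bsub>K\<^esub> (f a \<otimes>\<^bsub>K\<^esub> f b)" if y: "y \<in> H" for y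
      proof -
        have "f a \<otimes>\<^bsub>K\<^esub> f y = f y \<otimes>\<^bsub>K\<^esub> f a" "f b \<otimes>\<^bsub>K\<^esub> f y = f y \<otimes>\<^bsub>K\<^esub> f b" "a \<in> H" "b \<in> H"
          using a b y by (auto simp: X_def)
        then show ?thesis using fc y by (intro h.H.commute_mult) simp_all
      qed
      moreover have "a \<in> H" "b \<in> H" using a b by (simp_all add: X_def)
      ultimately show "a \<otimes> b \<in> X" unfolding X_def mem_Collect_eq by (metis fm Hm(1))
    qed
    show "N \<subset> X"
    proof -
      have "N \<subseteq> X"
      proof
        fix x assume x: "x \<in> N"
        then have "x \<in> H" using N by blast
        then show "x \<in> X" using fN[of x] x fc by (simp add: X_def)
      qed
      moreover obtain x where "x \<in> H" "f x = x0" using x0 K by auto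
      then have "x \<in> X" "x \<notin> N" using x0 fN K by (auto simp: X_def)
      ultimately show ?thesis by blast
    qed
    show "X \<subseteq> H" by (auto simp: X_def)
    fix x y assume xy: "x \<in> X" "y \<in> H"
    then have xH: "x \<in> H" and c: "f x \<otimes>\<^bsub>K\<^esub> f y = f y \<otimes>\<^bsub>K\<^esub> f x" by (auto simp: X_def)
    have "f (y \<otimes> x \<otimes> inv y) = f x \<otimes>\<^bsub>K\<^esub> f y \<otimes>\<^bsub>K\<^esub> inv\<^bsub>K\<^esub> f y"
      using fm[OF _ Hm(2)[OF xy(2,2)]] fm[OF xy(2) xH] Hm(1)[OF xy(2) xH] finv[OF xy(2)] c by simp
    also have "\<dots> = f x" using fc[OF xH] fc[OF xy(2)]
      by (simp only: h.H.m_assoc h.H.r_inv h.H.r_one h.H.inv_closed)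
    finally have "f (y \<otimes> x \<otimes> inv y) = f x" .
    then show "y \<otimes> x \<otimes> inv y \<in> X" using xy xH by (auto simp: X_def Hm)
    have "f (x \<otimes> y) = f (y \<otimes> x)" using xH xy c by (simp add: fm)
    then show "(x \<otimes> y) \<otimes> inv (y \<otimes> x) \<in> N" using xH xy f[of "x \<otimes> y" "y \<otimes> x"] by (simp add: Hm)
  qed
qed

section \<open>Minimal counterexamples among groups\<close>

context group
begin

lemma conj_group_hom:
  assumes "g \<in> carrier G"
  shows "group_hom G G (\<lambda>x. g \<otimes> x \<otimes> inv g)"
proof (unfold_locales, rule homI)
  fix x y assume "x \<in> carrier G" "y \<in> carrier G"
  then show "g \<otimes> (x \<otimes> y) \<otimes> inv g = g \<otimes> x \<otimes> inv g \<otimes> (g \<otimes> y \<otimes> inv g)"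
    using assms by (simp add: m_assoc inv_solve_left)
qed (simp add: assms)

text \<open>Requiring both conjugates to lie in \<open>D\<close> amounts to x D x^-1 = D and makes
  closure under inverses immediate.\<close>

definition normalizer_of :: "'a set \<Rightarrow> 'a set" where
  "normalizer_of D = {x \<in> carrier G. \<forall>d\<in>D. x \<otimes> d \<otimes> inv x \<in> D \<and> inv x \<otimes> d \<otimes> x \<in> D}"

lemma subgroup_normalizer_of:
  assumes "subgroup D G"
  shows "subgroup (normalizer_of D) G"
proof (rule subgroupI)
  have sub: "D \<subseteq> carrier G" using assms by (rule subgroup.subset)
  then have "\<one> \<in> normalizer_of D" by (auto simp: normalizer_of_def)
  then show "normalizer_of D \<noteq> {}" by auto
  fix a b assume a: "a \<in> normalizer_of D" and b: "b \<in> normalizer_of D"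
  have "a \<otimes> b \<otimes> d \<otimes> inv (a \<otimes> b) = a \<otimes> (b \<otimes> d \<otimes> inv b) \<otimes> inv a"
    "inv (a \<otimes> b) \<otimes> d \<otimes> (a \<otimes> b) = inv b \<otimes> (inv a \<otimes> d \<otimes> a) \<otimes> b" if "d \<in> D" for d
    using a b that sub by (auto simp: normalizer_of_def inv_mult_group m_assoc subset_iff)
  then show "a \<otimes> b \<in> normalizer_of D" using a b by (auto simp: normalizer_of_def)
next
  show "normalizer_of D \<subseteq> carrier G" by (auto simp: normalizer_of_def)
  show "inv a \<in> normalizer_of D" if "a \<in> normalizer_of D" for a using that by (simp add: normalizer_of_def)
qed

lemma subset_normalizer_of: "subgroup D G \<Longrightarrow> D \<subseteq> normalizer_of D"
  unfolding normalizer_of_def by (blast intro: subgroup.mem_carrier subgroup.m_closed subgroup.m_inv_closed)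

definition maximal_subgroup :: "'a set \<Rightarrow> bool" where
  "maximal_subgroup M \<longleftrightarrow> subgroup M G \<and> M \<noteq> carrier G \<and>
     (\<forall>K. subgroup K G \<longrightarrow> M \<subseteq> K \<longrightarrow> K = M \<or> K = carrier G)"

lemma finite_subgroups: "finite (carrier G) \<Longrightarrow> finite {H. subgroup H G \<and> P H}"
  by (rule finite_subset[of _ "Pow (carrier G)"]) (auto dest: subgroup.subset)

lemma ex_maximal_subgroup:
  assumes "finite (carrier G)" "subgroup H G" "H \<noteq> carrier G"
  obtains M where "maximal_subgroup M" "H \<subseteq> M"
proof -
  obtain M where M: "M \<in> {K. subgroup K G \<and> (K \<noteq> carrier G \<and> H \<subseteq> K)}"
    and mx: "\<And>K. K \<in> {K. subgroup K G \<and> (K \<noteq> carrier G \<and> H \<subseteq> K)} \<Longrightarrow> M \<subseteq> K \<Longrightarrow> M = K"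
    using finite_has_maximal2[OF finite_subgroups[OF assms(1)],
        of H "\<lambda>K. K \<noteq> carrier G \<and> H \<subseteq> K"] assms(2,3) by auto
  have "maximal_subgroup M" unfolding maximal_subgroup_def using M mx by blast
  then show ?thesis using M that by auto
qed

lemma conj_conj:
  assumes "g \<in> carrier G" "x \<in> carrier G"
  shows "g \<otimes> (inv g \<otimes> x \<otimes> g) \<otimes> inv g = x" "inv g \<otimes> (g \<otimes> x \<otimes> inv g) \<otimes> g = x"
proof -
  have "g \<otimes> (inv g \<otimes> x \<otimes> g) \<otimes> inv g = (g \<otimes> inv g) \<otimes> (x \<otimes> (g \<otimes> inv g))"
    by (simp only: m_assoc m_closed inv_closed assms)
  then show "g \<otimes> (inv g \<otimes> x \<otimes> g) \<otimes> inv g = x" by (simp only: r_inv l_inv l_one r_one assms)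
  have "inv g \<otimes> (g \<otimes> x \<otimes> inv g) \<otimes> g = (inv g \<otimes> g) \<otimes> (x \<otimes> (inv g \<otimes> g))"
    by (simp only: m_assoc m_closed inv_closed assms)
  then show "inv g \<otimes> (g \<otimes> x \<otimes> inv g) \<otimes> g = x" by (simp only: r_inv l_inv l_one r_one assms)
qed

text \<open>Conjugation by \<open>inv g\<close> carries an overgroup of the conjugate back to an
  overgroup of \<open>M\<close>.\<close>

lemma maximal_subgroup_conj:
  assumes "maximal_subgroup M" "g \<in> carrier G"
  shows "maximal_subgroup ((\<lambda>x. g \<otimes> x \<otimes> inv g) ` M)"
proof -
  have M: "subgroup M G" "M \<subseteq> carrier G" "M \<noteq> carrier G"
    using assms by (auto simp: maximal_subgroup_def dest: subgroup.subset)
  have inv: "(\<lambda>x. inv g \<otimes> x \<otimes> g) ` (\<lambda>x. g \<otimes> x \<otimes> inv g) ` A = A"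
    "(\<lambda>x. g \<otimes> x \<otimes> inv g) ` (\<lambda>x. inv g \<otimes> x \<otimes> g) ` A = A" if A: "A \<subseteq> carrier G" for A
  proof -
    have "inv g \<otimes> (g \<otimes> x \<otimes> inv g) \<otimes> g = x" "g \<otimes> (inv g \<otimes> x \<otimes> g) \<otimes> inv g = x" if "x \<in> A" for x
      using conj_conj[OF assms(2)] that A by blast+
    then show "(\<lambda>x. inv g \<otimes> x \<otimes> g) ` (\<lambda>x. g \<otimes> x \<otimes> inv g) ` A = A"
      "(\<lambda>x. g \<otimes> x \<otimes> inv g) ` (\<lambda>x. inv g \<otimes> x \<otimes> g) ` A = A"
      unfolding image_image by simp_all
  qed
  interpret c: group_hom G G "\<lambda>x. g \<otimes> x \<otimes> inv g" using conj_group_hom assms(2) .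
  have c': "group_hom G G (\<lambda>x. inv g \<otimes> x \<otimes> g)" using conj_group_hom[of "inv g"] assms(2) by simp
  show ?thesis unfolding maximal_subgroup_def
  proof (intro conjI allI impI)
    show "subgroup ((\<lambda>x. g \<otimes> x \<otimes> inv g) ` M) G" using c.subgroup_img_is_subgroup[OF M(1)] .
    have whole: "(\<lambda>x. inv g \<otimes> x \<otimes> g) ` carrier G = carrier G"
    proof
      show "carrier G \<subseteq> (\<lambda>x. inv g \<otimes> x \<otimes> g) ` carrier G"
      proof
        fix x assume "x \<in> carrier G"
        then show "x \<in> (\<lambda>x. inv g \<otimes> x \<otimes> g) ` carrier G"
          using conj_conj(2)[OF assms(2)] assms(2)
          by (intro image_eqI[where x = "g \<otimes> x \<otimes> inv g"]) simp_all
      qed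
    qed (use assms(2) in auto)
    show "(\<lambda>x. g \<otimes> x \<otimes> inv g) ` M \<noteq> carrier G" using inv(1)[OF M(2)] whole M(3) by metis
    fix K assume K: "subgroup K G" "(\<lambda>x. g \<otimes> x \<otimes> inv g) ` M \<subseteq> K"
    let ?K = "(\<lambda>x. inv g \<otimes> x \<otimes> g) ` K"
    have KG: "K \<subseteq> carrier G" using K by (simp add: subgroup.subset)
    have "subgroup ?K G" using group_hom.subgroup_img_is_subgroup[OF c' K(1)] .
    moreover have "M \<subseteq> ?K" using image_mono[OF K(2), of "\<lambda>x. inv g \<otimes> x \<otimes> g"] inv(1)[OF M(2)] by simp
    ultimately have "?K = M \<or> ?K = carrier G" using assms(1) by (auto simp: maximal_subgroup_def)
    then show "K = (\<lambda>x. g \<otimes> x \<otimes> inv g) ` M \<or> K = carrier G"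
    proof
      assume "?K = carrier G"
      then show ?thesis using inv(2)[OF KG] inv(2)[of "carrier G"] whole by simp
    next
      assume "?K = M"
      then show ?thesis using inv(2)[OF KG] by (metis (no_types))
    qed
  qed
qed

definition centralizer :: "'a set \<Rightarrow> 'a set" where
  "centralizer B = {g \<in> carrier G. \<forall>b\<in>B. g \<otimes> b = b \<otimes> g}"

lemma subgroup_centralizer:
  assumes "B \<subseteq> carrier G"
  shows "subgroup (centralizer B) G"
proof (rule subgroupI)
  have "\<one> \<in> centralizer B" using assms by (auto simp: centralizer_def)
  then show "centralizer B \<noteq> {}" by auto
  show "inv a \<in> centralizer B" if "a \<in> centralizer B" for a
    using that assms commute_inv unfolding centralizer_def by blast
  show "a \<otimes> b \<in> centralizer B" if "a \<in> centralizer B" "b \<in> centralizer B" for a b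
    using that assms commute_mult unfolding centralizer_def by blast
qed (auto simp: centralizer_def)

end

text \<open>A counterexample of least order to the existence of a nontrivial center. The assumption
  \<open>sec\<close> is the induction hypothesis for every section H/N other than G/1, in the form
  of \<open>section_center\<close>.\<close>

locale minimal_group = group +
  assumes fin: "finite (carrier G)"
    and te: "thue_engel G"
    and nontriv: "carrier G \<noteq> {\<one>}"
    and trivial_center: "\<lbrakk>x \<in> carrier G; \<And>y. y \<in> carrier G \<Longrightarrow> x \<otimes> y = y \<otimes> x\<rbrakk> \<Longrightarrow> x = \<one>"
    and sec: "\<lbrakk>subgroup H G; subgroup N G; N \<subset> H;
        \<And>h n. \<lbrakk>h \<in> H; n \<in> N\<rbrakk> \<Longrightarrow> h \<otimes> n \<otimes> inv h \<in> N; H \<noteq> carrier G \<or> N \<noteq> {\<one>}\<rbrakk> \<Longrightarrow>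
        \<exists>X. subgroup X G \<and> N \<subset> X \<and> X \<subseteq> H \<and> (\<forall>x\<in>X. \<forall>y\<in>H. y \<otimes> x \<otimes> inv y \<in> X) \<and>
          (\<forall>x\<in>X. \<forall>y\<in>H. (x \<otimes> y) \<otimes> inv (y \<otimes> x) \<in> N)"
begin

text \<open>Proper subgroups have the normalizer property of nilpotent groups. Let \<open>N\<close>
  be maximal among the subgroups of \<open>D\<close> that are normal in \<open>M\<close>, and let
  X/N be central in M/N. Maximality keeps \<open>X\<close> from lying in \<open>D\<close>, and
  \<open>X\<close> normalizes \<open>D\<close> because its commutators with \<open>M\<close> lie in
  \<open>N\<close>.\<close>

lemma normalizer_grows:
  assumes M: "subgroup M G" "M \<noteq> carrier G" and D: "subgroup D G" "D \<subset> M"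
  shows "\<exists>x\<in>M - D. x \<in> normalizer_of D"
proof -
  let ?P = "\<lambda>N. N \<subseteq> D \<and> (\<forall>h\<in>M. \<forall>n\<in>N. h \<otimes> n \<otimes> inv h \<in> N)"
  have MG: "M \<subseteq> carrier G" using M by (simp add: subgroup.subset)
  have "{\<one>} \<in> {N. subgroup N G \<and> ?P N}"
    using triv_subgroup D(1) MG by (auto simp: subgroup.one_closed subset_iff)
  then obtain N where N: "subgroup N G" "?P N"
    and mx: "\<And>N'. \<lbrakk>subgroup N' G; ?P N'; N \<subseteq> N'\<rbrakk> \<Longrightarrow> N = N'"
    using finite_has_maximal2[OF finite_subgroups[OF fin, of ?P], of "{\<one>}"] by auto
  have "N \<subset> M" using N D by blast
  then obtain X where X: "subgroup X G" "N \<subset> X" "X \<subseteq> M" "\<forall>x\<in>X. \<forall>y\<in>M. y \<otimes> x \<otimes> inv y \<in> X"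
    "\<forall>x\<in>X. \<forall>y\<in>M. (x \<otimes> y) \<otimes> inv (y \<otimes> x) \<in> N"
    using sec[OF M(1) N(1)] N M by metis
  have "\<not> X \<subseteq> D" using mx[OF X(1)] X by blast
  then obtain x where x: "x \<in> X" "x \<notin> D" by auto
  have conj: "u \<otimes> d \<otimes> inv u \<in> D" if "u \<in> X" "d \<in> D" for u d
  proof -
    have c: "u \<in> carrier G" "d \<in> carrier G" using that X D MG by auto
    have "(u \<otimes> d) \<otimes> inv (d \<otimes> u) \<in> D" using X(5) that N D by blast
    then have "((u \<otimes> d) \<otimes> inv (d \<otimes> u)) \<otimes> d \<in> D" using D that by (simp add: subgroup.m_closed)
    also have "((u \<otimes> d) \<otimes> inv (d \<otimes> u)) \<otimes> d = u \<otimes> d \<otimes> inv u"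
      using c by (simp add: m_assoc inv_mult_group)
    finally show ?thesis .
  qed
  have "inv x \<in> X" using X x by (simp add: subgroup.m_inv_closed)
  then have "x \<in> normalizer_of D" using conj[OF x(1)] conj[of "inv x"] x X MG by (auto simp: normalizer_of_def subset_iff)
  then show ?thesis using x X by blast
qed

section \<open>Maximal subgroups of a simple least counterexample\<close>

definition simple :: bool where
  "simple \<longleftrightarrow> (\<forall>N. subgroup N G \<longrightarrow> (\<forall>g\<in>carrier G. \<forall>n\<in>N. g \<otimes> n \<otimes> inv g \<in> N) \<longrightarrow>
     N = {\<one>} \<or> N = carrier G)"

lemma normalizer_of_proper:
  assumes "simple" "subgroup D G" "D \<noteq> {\<one>}" "D \<noteq> carrier G"
  shows "normalizer_of D \<noteq> carrier G"
proof
  assume "normalizer_of D = carrier G"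
  then have "\<forall>g\<in>carrier G. \<forall>n\<in>D. g \<otimes> n \<otimes> inv g \<in> D" by (auto simp: normalizer_of_def)
  then show False using assms by (auto simp: simple_def)
qed

text \<open>Take \<open>D\<close> maximal among the nontrivial intersections of two maximal
  subgroups, and a maximal subgroup \<open>C\<close> above its normalizer, which is proper by
  simplicity. A maximal subgroup \<open>E\<close> properly above \<open>D\<close> contains elements
  outside \<open>D\<close> that normalize \<open>D\<close>, so the intersection of \<open>C\<close>
  and \<open>E\<close> exceeds \<open>D\<close>, and \<open>E = C\<close>. This applies to both
  subgroups that meet in \<open>D\<close>.\<close>

lemma maximal_subgroup_Int:
  assumes simple "maximal_subgroup M1" "maximal_subgroup M2" "M1 \<noteq> M2"
  shows "M1 \<inter> M2 = {\<one>}"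
proof (rule ccontr)
  assume ne: "M1 \<inter> M2 \<noteq> {\<one>}"
  let ?P = "\<lambda>D. \<exists>M1 M2. maximal_subgroup M1 \<and> maximal_subgroup M2 \<and> M1 \<noteq> M2 \<and> D = M1 \<inter> M2 \<and> D \<noteq> {\<one>}"
  have sub: "subgroup (M \<inter> M') G" if "maximal_subgroup M" "maximal_subgroup M'" for M M'
    using that by (auto simp: maximal_subgroup_def intro: subgroups_Inter_pair)
  define S where "S = {D. subgroup D G \<and> ?P D}"
  have "finite S" unfolding S_def by (rule finite_subgroups[OF fin])
  moreover have "M1 \<inter> M2 \<in> S" unfolding S_def using assms ne sub by blast
  ultimately have "\<exists>D\<in>S. M1 \<inter> M2 \<subseteq> D \<and> (\<forall>D'\<in>S. D \<subseteq> D' \<longrightarrow> D = D')"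
    by (rule finite_has_maximal2)
  then obtain D where "D \<in> S" and mx: "\<forall>D'\<in>S. D \<subseteq> D' \<longrightarrow> D = D'" by (elim bexE conjE)
  from \<open>D \<in> S\<close> have D: "subgroup D G" and "?P D" by (simp_all add: S_def)
  then obtain A B where A: "maximal_subgroup A" and B: "maximal_subgroup B" and AB: "A \<noteq> B" "D = A \<inter> B"
    and D1: "D \<noteq> {\<one>}" by (elim exE conjE)
  have "D \<noteq> carrier G" using A AB D by (auto simp: maximal_subgroup_def dest: subgroup.subset)
  then have "normalizer_of D \<noteq> carrier G" using normalizer_of_proper assms(1) D D1 by blast
  then obtain C where C: "maximal_subgroup C" "normalizer_of D \<subseteq> C" using ex_maximal_subgroup[OF fin subgroup_normalizer_of[OF D]] by blast
  have eq: "C = E" if E: "maximal_subgroup E" "D \<subset> E" for E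
  proof (rule ccontr)
    assume "C \<noteq> E"
    obtain x where x: "x \<in> E - D" "x \<in> normalizer_of D"
      using normalizer_grows[of E D] E D by (auto simp: maximal_subgroup_def)
    then have "D \<subset> C \<inter> E" using C E subset_normalizer_of[OF D] by blast
    then have "C \<inter> E \<noteq> {\<one>}" using subgroup.one_closed[OF D] D1 \<open>D \<subset> C \<inter> E\<close> by blast
    then have "?P (C \<inter> E)"
      using C(1) E(1) \<open>C \<noteq> E\<close> by blast
    then have "C \<inter> E \<in> S" unfolding S_def using sub[OF C(1) E(1)] by (intro CollectI conjI)
    then show False using mx \<open>D \<subset> C \<inter> E\<close> by (metis psubset_eq)
  qed
  have "\<not> A \<subseteq> B" "\<not> B \<subseteq> A" using A B AB(1) unfolding maximal_subgroup_def by blast+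
  then have "D \<subset> A" "D \<subset> B" using AB by auto
  then show False using eq A B AB(1) by blast
qed

text \<open>One Thue--Morse step backwards. Conjugation by \<open>r\<close> takes
  \<open>l \<otimes> r\<close> to \<open>r \<otimes> l\<close>; these are nontrivial as they differ,
  so \<open>M\<close> meets its conjugate by \<open>r\<close> nontrivially and equals it. Thus
  \<open>r\<close> normalizes \<open>M\<close>, and by simplicity \<open>M\<close> is its own
  normalizer.\<close>

lemma maximal_subgroup_roots:
  assumes simple "maximal_subgroup M" and c: "l \<in> carrier G" "r \<in> carrier G"
    and "l \<otimes> r \<in> M" "r \<otimes> l \<in> M" "l \<otimes> r \<noteq> r \<otimes> l"
  shows "l \<in> M \<and> r \<in> M"
proof -
  have M: "subgroup M G" "M \<noteq> carrier G" using assms by (auto simp: maximal_subgroup_def)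
  have MG: "M \<subseteq> carrier G" using M by (simp add: subgroup.subset)
  let ?M = "(\<lambda>x. r \<otimes> x \<otimes> inv r) ` M"
  have ne: "l \<otimes> r \<noteq> \<one>" "r \<otimes> l \<noteq> \<one>" using assms(7) c inv_comm by auto
  then have M1: "M \<noteq> {\<one>}" using assms(5) by auto
  have "r \<otimes> (l \<otimes> r) \<otimes> inv r = r \<otimes> l" using c by (simp add: m_assoc)
  then have "r \<otimes> l \<in> ?M" using assms(5) by (metis image_eqI)
  then have "M \<inter> ?M \<noteq> {\<one>}" using assms(6) ne by blast
  then have eq: "?M = M" using maximal_subgroup_Int assms(1,2) maximal_subgroup_conj[OF assms(2) c(2)] by metis
  have "r \<in> normalizer_of M"
  proof -
    have "inv r \<otimes> d \<otimes> r \<in> M" if "d \<in> M" for d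
    proof -
      have "d \<in> ?M" using that unfolding eq .
      then obtain e where "e \<in> M" "d = r \<otimes> e \<otimes> inv r" by (rule imageE)
      then show ?thesis using c MG by (simp add: conj_conj subset_iff)
    qed
    then show ?thesis using eq c by (auto simp: normalizer_of_def)
  qed
  moreover have "normalizer_of M = M \<or> normalizer_of M = carrier G"
    using assms(2) subgroup_normalizer_of[OF M(1)] subset_normalizer_of[OF M(1)] unfolding maximal_subgroup_def by simp
  then have "normalizer_of M = M" using normalizer_of_proper[OF assms(1) M(1) M1 M(2)] by simp
  ultimately have r: "r \<in> M" by simp
  have "(l \<otimes> r) \<otimes> inv r \<in> M" using r assms M by (simp add: subgroup.m_closed subgroup.m_inv_closed)
  then show ?thesis using r c by (simp add: m_assoc)
qed

lemma centralizer_proper: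
  assumes "B \<subseteq> carrier G" "b \<in> B" "b \<noteq> \<one>"
  shows "centralizer B \<noteq> carrier G"
proof
  assume eq: "centralizer B = carrier G"
  have "b \<otimes> y = y \<otimes> b" if "y \<in> carrier G" for y
    using that assms(2) unfolding eq[symmetric] by (simp add: centralizer_def)
  then show False using trivial_center assms by blast
qed

text \<open>The run starts from some \<open>a \<noteq> \<one>\<close> in a maximal subgroup
  \<open>M\<close> and some \<open>b\<close> outside it. Once both are shown to lie in a single
  maximal subgroup \<open>M'\<close>, the common element \<open>a\<close> forces
  \<open>M' = M\<close>, contradicting the choice of \<open>b\<close>.\<close>

lemma not_simple: "\<not> simple"
proof
  assume s: simple
  obtain a where a: "a \<in> carrier G" "a \<noteq> \<one>" using nontriv by blast
  \<comment> \<open>All that is wanted is a maximal subgroup through \<open>a\<close>; the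
    centralizer of \<open>a\<close> is a proper subgroup that contains it.\<close>
  obtain M where M: "maximal_subgroup M" "centralizer {a} \<subseteq> M"
    using ex_maximal_subgroup[OF fin subgroup_centralizer[of "{a}"] centralizer_proper[of "{a}" a]] a by auto
  have aM: "a \<in> M" using M a by (auto simp: centralizer_def)
  obtain b where b: "b \<in> carrier G" "b \<notin> M" using M(1) by (auto simp: maximal_subgroup_def dest: subgroup.subset)
  define w where "w = twist (triple G) (\<lambda>_. \<one>) (a, b)"
  have wc: "w n \<in> carrier G \<times> carrier G" for n
    unfolding w_def by (rule twist_in) (use a b in \<open>auto simp: triple_def\<close>)
  have step: "w (Suc n) = (fst (w n) \<otimes> snd (w n), snd (w n) \<otimes> fst (w n))" for n
    using wc[of n] by (auto simp: w_def triple_def split: prod.splits)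
  define n where "n = (LEAST n. fst (w n) = snd (w n))"
  have "\<exists>n. fst (w n) = snd (w n)" using te a b by (auto simp: thue_engel_def merges_def w_def)
  then have n: "fst (w n) = snd (w n)" unfolding n_def by (rule LeastI_ex)
  have less: "fst (w i) \<noteq> snd (w i)" if "i < n" for i using that not_less_Least n_def by auto
  have "n \<noteq> 0"
  proof
    assume "n = 0"
    then show False using n aM b by (simp add: w_def)
  qed
  then obtain k where k: "n = Suc k" using not0_implies_Suc by blast
  obtain l r where lr: "w k = (l, r)" "l \<in> carrier G" "r \<in> carrier G" using wc[of k] by auto
  have com: "l \<otimes> r = r \<otimes> l" using n step[of k] k lr by simp
  have "l \<noteq> r" using less[of k] k lr by simp
  \<comment> \<open>The last words before merging commute and differ, so one of them is not \<one>.
    Its centralizer is a proper subgroup that contains both.\<close>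
  then obtain s where s1: "s \<noteq> \<one>" "s \<in> {l, r}" by (metis insertCI)
  then obtain M' where M': "maximal_subgroup M'" "centralizer {s} \<subseteq> M'"
    using ex_maximal_subgroup[OF fin subgroup_centralizer[of "{s}"] centralizer_proper[of "{s}" s]] s1 lr by auto
  \<comment> \<open>Backward induction on time. Before the merge the two words differ, as
    \<open>maximal_subgroup_roots\<close> requires of its products; for j \<ge> k the truncated
    difference stays at 0.\<close>
  have "w (k - j) \<in> M' \<times> M'" for j
  proof (induction j)
    case 0
    have "l \<in> centralizer {s}" "r \<in> centralizer {s}" using s1 com lr by (auto simp: centralizer_def)
    then show ?case using M' lr by auto
  next
    case (Suc j)
    show ?case
    proof (cases "j < k")
      case True
      let ?i = "k - Suc j"
      have i: "k - j = Suc ?i" using True by simp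
      have "fst (w (k - j)) \<noteq> snd (w (k - j))" using k by (intro less) auto
      then show ?thesis using Suc maximal_subgroup_roots[OF s M'(1), of "fst (w ?i)" "snd (w ?i)"] wc[of ?i]
        unfolding i step by (auto simp: mem_Times_iff)
    qed (use Suc in auto)
  qed
  from this[of k] have "a \<in> M'" "b \<in> M'" by (auto simp: w_def)
  then show False using maximal_subgroup_Int[OF s M(1) M'(1)] aM a b by blast
qed

end

section \<open>Fixed points in an abelian subgroup\<close>

context group
begin

lemma conj_pow_closed:
  assumes B: "B \<subseteq> carrier G" and c: "c \<in> carrier G"
    and nrm: "\<And>b. b \<in> B \<Longrightarrow> c \<otimes> b \<otimes> inv c \<in> B" and b: "b \<in> B"
  shows "c [^] (n::nat) \<otimes> b \<otimes> inv (c [^] n) \<in> B"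
  using b
proof (induction n arbitrary: b)
  case 0
  then show ?case using B by auto
next
  case (Suc n)
  have bc: "b \<in> carrier G" using Suc B by auto
  have "c [^] Suc n \<otimes> b \<otimes> inv (c [^] Suc n) = c [^] n \<otimes> (c \<otimes> b \<otimes> inv c) \<otimes> inv (c [^] n)"
    using bc c by (simp add: inv_mult_group m_assoc)
  then show ?case using Suc.IH[OF nrm[OF Suc.prems]] by simp
qed

lemma commute_pow:
  assumes "b \<otimes> c = c \<otimes> b" "b \<in> carrier G" "c \<in> carrier G"
  shows "b \<otimes> c [^] (n::nat) = c [^] n \<otimes> b"
proof (induction n)
  case (Suc n)
  have "c [^] Suc n \<otimes> b = b \<otimes> c [^] Suc n"
    unfolding nat_pow_Suc by (rule commute_mult) (use assms Suc in simp_all)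
  then show ?case by simp
qed (use assms in simp)

text \<open>
  While the two words of the iteration lie in a coset of the abelian subgroup \<open>B\<close>, they can only
  become equal if their quotient is fixed by the power of \<open>c\<close> between them.
\<close>

lemma merges_fixed_point:
  assumes B: "subgroup B G" and ab: "\<And>x y. \<lbrakk>x \<in> B; y \<in> B\<rbrakk> \<Longrightarrow> x \<otimes> y = y \<otimes> x"
    and c: "c \<in> carrier G" and nrm: "\<And>b. b \<in> B \<Longrightarrow> c \<otimes> b \<otimes> inv c \<in> B"
    and st: "s \<in> B" "t \<in> B" "s \<noteq> t"
    and M: "\<And>n. M (Suc n) = 2 * M n + k n"
    and mg: "merges (triple G) (\<lambda>i. c [^] (k i)) (t \<otimes> c [^] M 0, s \<otimes> c [^] M (0::nat))"
  shows "\<exists>n. \<exists>b\<in>B. b \<noteq> \<one> \<and> b \<otimes> c [^] (M n + k n :: nat) = c [^] (M n + k n) \<otimes> b"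
proof -
  have BG: "x \<in> carrier G" if "x \<in> B" for x using B that by (rule subgroup.mem_carrier)
  define w where "w = twist (triple G) (\<lambda>i. c [^] (k i)) (t \<otimes> c [^] M 0, s \<otimes> c [^] M 0)"
  \<comment> \<open>Moving a power of \<open>c\<close> to the right across \<open>s\<close>
    conjugates \<open>s\<close> by it, which leaves an element of \<open>B\<close> times a power of
    \<open>c\<close>.\<close>
  have mult: "t \<otimes> c [^] i \<otimes> c [^] j \<otimes> (s \<otimes> c [^] i) =
      t \<otimes> (c [^] (i + j) \<otimes> s \<otimes> inv (c [^] (i + j))) \<otimes> c [^] (2 * i + j)"
    if ts: "t \<in> B" "s \<in> B" for t s and i j :: nat
  proof -
    have ii: "c [^] (2 * i + j) = c [^] (i + j) \<otimes> c [^] i"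
      using c by (simp add: nat_pow_mult mult_2 add.commute add.left_commute)
    have "c [^] (i + j) = c [^] i \<otimes> c [^] j" using c by (simp add: nat_pow_mult)
    then have "t \<otimes> c [^] i \<otimes> c [^] j \<otimes> (s \<otimes> c [^] i) = t \<otimes> (c [^] (i + j) \<otimes> s) \<otimes> c [^] i"
      using c BG[OF ts(1)] BG[OF ts(2)] by (simp add: m_assoc)
    also have "\<dots> = t \<otimes> (c [^] (i + j) \<otimes> s \<otimes> inv (c [^] (i + j))) \<otimes> (c [^] (i + j) \<otimes> c [^] i)"
    proof -
      have "inv (c [^] (i + j)) \<otimes> (c [^] (i + j) \<otimes> c [^] i) = c [^] i"
        using c by (simp flip: m_assoc)
      then show ?thesis using c BG[OF ts(1)] BG[OF ts(2)] by (simp add: m_assoc)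
    qed
    finally show ?thesis unfolding ii .
  qed
  have "\<exists>t s. t \<in> B \<and> s \<in> B \<and> w n = (t \<otimes> c [^] M n, s \<otimes> c [^] M n)" for n
  proof (induction n)
    case 0
    then show ?case using st by (auto simp: w_def)
  next
    case (Suc n)
    then obtain t s where ts: "t \<in> B" "s \<in> B" and w: "w n = (t \<otimes> c [^] M n, s \<otimes> c [^] M n)"
      by blast
    let ?C = "c [^] (M n + k n)"
    have "?C \<otimes> s \<otimes> inv ?C \<in> B" "?C \<otimes> t \<otimes> inv ?C \<in> B"
      using conj_pow_closed[OF _ c nrm] ts BG by blast+
    then have "t \<otimes> (?C \<otimes> s \<otimes> inv ?C) \<in> B" "s \<otimes> (?C \<otimes> t \<otimes> inv ?C) \<in> B"
      using ts B by (simp_all add: subgroup.m_closed)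
    moreover have "w (Suc n) = (t \<otimes> (?C \<otimes> s \<otimes> inv ?C) \<otimes> c [^] M (Suc n),
        s \<otimes> (?C \<otimes> t \<otimes> inv ?C) \<otimes> c [^] M (Suc n))"
      using w mult[OF ts, of "M n" "k n"] mult[OF ts(2,1), of "M n" "k n"]
      by (simp add: w_def triple_def M)
    ultimately show ?case by blast
  qed
  then obtain T S where TS: "T n \<in> B" "S n \<in> B" and w: "w n = (T n \<otimes> c [^] M n, S n \<otimes> c [^] M n)" for n
    by metis
  define n where "n = (LEAST n. fst (w n) = snd (w n))"
  have "\<exists>n. fst (w n) = snd (w n)" using mg by (auto simp: merges_def w_def)
  then have n: "fst (w n) = snd (w n)" unfolding n_def by (rule LeastI_ex)
  have "fst (w 0) \<noteq> snd (w 0)" using st BG c by (simp add: w_def)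
  then have "n \<noteq> 0" using n by metis
  then obtain j where j: "n = Suc j" using not0_implies_Suc by blast
  have "fst (w j) \<noteq> snd (w j)" using not_less_Least[of j "\<lambda>n. fst (w n) = snd (w n)"] j n_def by simp
  then have ne: "T j \<noteq> S j" using w[of j] by auto
  let ?C = "c [^] (M j + k j)"
  let ?s = "?C \<otimes> S j \<otimes> inv ?C" and ?t = "?C \<otimes> T j \<otimes> inv ?C"
  have in1: "T j \<in> carrier G" "S j \<in> carrier G" "?C \<in> carrier G" using TS BG c by auto
  have w': "w (Suc j) = (T j \<otimes> ?s \<otimes> c [^] M (Suc j), S j \<otimes> ?t \<otimes> c [^] M (Suc j))"
    using w[of j] mult[OF TS(1)[of j] TS(2)[of j], of "M j" "k j"]
      mult[OF TS(2)[of j] TS(1)[of j], of "M j" "k j"]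
    by (simp add: w_def triple_def M)
  have eq: "T j \<otimes> ?s = S j \<otimes> ?t" using n[unfolded j w'] in1 c by simp
  \<comment> \<open>The quotient of the words at the last time when they differ. Equality after the
    next step says that conjugation by \<open>?C\<close> fixes it, by commutativity of
    \<open>B\<close>.\<close>
  let ?b = "inv (S j) \<otimes> T j"
  have bB: "?b \<in> B" using TS B by (simp add: subgroup.m_closed subgroup.m_inv_closed)
  have b1: "?b \<noteq> \<one>"
  proof
    assume "?b = \<one>"
    then have "inv (S j) = inv (T j)" using inv_equality[of "inv (S j)" "T j"] in1 by simp
    then show False using ne in1 inv_inv by metis
  qed
  have "?b \<otimes> ?s = inv (S j) \<otimes> (T j \<otimes> ?s)" using in1 by (simp only: m_assoc m_closed inv_closed)
  also have "\<dots> = inv (S j) \<otimes> S j \<otimes> ?t"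
    unfolding eq using in1 by (simp only: m_assoc m_closed inv_closed)
  also have "\<dots> = ?t" using in1 by (simp only: l_inv l_one m_closed inv_closed)
  finally have e1: "?b \<otimes> ?s = ?t" .
  have c1: "?s \<otimes> ?C = ?C \<otimes> S j" "?t \<otimes> ?C = ?C \<otimes> T j"
    using in1 by (simp_all only: m_assoc m_closed inv_closed l_inv r_one)
  have "?b \<otimes> (?C \<otimes> S j) = ?b \<otimes> (?s \<otimes> ?C)" by (simp only: c1)
  also have "\<dots> = (?b \<otimes> ?s) \<otimes> ?C" using in1 by (intro m_assoc[symmetric]) simp_all
  also have "\<dots> = ?C \<otimes> T j" by (simp only: e1 c1)
  finally have e2: "?b \<otimes> (?C \<otimes> S j) = ?C \<otimes> T j" .
  have "?b \<otimes> ?C = ?b \<otimes> (?C \<otimes> S j) \<otimes> inv (S j)"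
    using in1 by (simp only: m_assoc m_closed inv_closed r_inv r_one)
  also have "\<dots> = ?C \<otimes> (T j \<otimes> inv (S j))"
    unfolding e2 using in1 by (simp only: m_assoc m_closed inv_closed)
  also have "T j \<otimes> inv (S j) = ?b" using ab TS B by (simp add: subgroup.m_inv_closed)
  finally show ?thesis using bB b1 by blast
qed

end

lemma odd_power_two_bezout:
  assumes "odd q"
  shows "\<exists>x y. q * x = 2 ^ n * y + (1::nat)"
proof -
  have "coprime q (2 ^ n)" using assms by simp
  moreover have "q \<noteq> 0" using odd_pos[OF assms] by simp
  ultimately show ?thesis using bezout_nat[of q "2 ^ n"] by auto
qed

context group
begin

text \<open>The Engel run is confined to the elements of \<open>B\<close> that already commute with
  d = c^(2^n). The fixed point \<open>b'\<close> it yields therefore commutes with \<open>d\<close>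
  as well as with an odd power of \<open>c\<close>, and Bezout's identity leaves \<open>c\<close>
  itself.\<close>

lemma thue_engel_fixed_point:
  assumes te: "thue_engel G"
    and B: "subgroup B G" "B \<noteq> {\<one>}" and ab: "\<And>x y. \<lbrakk>x \<in> B; y \<in> B\<rbrakk> \<Longrightarrow> x \<otimes> y = y \<otimes> x"
    and c: "c \<in> carrier G" and nrm: "\<And>b. b \<in> B \<Longrightarrow> c \<otimes> b \<otimes> inv c \<in> B"
  shows "\<exists>b\<in>B. b \<noteq> \<one> \<and> b \<otimes> c = c \<otimes> b"
proof -
  have BG: "x \<in> carrier G" if "x \<in> B" for x using B(1) that by (rule subgroup.mem_carrier)
  have one: "\<one> \<in> B" using B(1) by (rule subgroup.one_closed)
  obtain a where a: "a \<in> B" "a \<noteq> \<one>" using B one by blast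
  \<comment> \<open>The run from \<open>(a \<otimes> c, c)\<close>: its words have exponents 2^n,
    and all middle factors are \<one>.\<close>
  have "merges (triple G) (\<lambda>i. c [^] (0::nat)) (a \<otimes> c [^] (2 ^ 0 :: nat), \<one> \<otimes> c [^] (2 ^ 0 :: nat))"
    using te a c BG by (simp add: thue_engel_def)
  then obtain n b where b: "b \<in> B" "b \<noteq> \<one>"
    and bc: "b \<otimes> c [^] (2 ^ n + 0 :: nat) = c [^] (2 ^ n + 0 :: nat) \<otimes> b"
    using merges_fixed_point[OF B(1) ab c nrm one a(1), of "\<lambda>n. 2 ^ n" "\<lambda>_. 0"] a(2) by auto
  define d where "d = c [^] (2 ^ n :: nat)"
  \<comment> \<open>A nontrivial abelian subgroup that \<open>c\<close> normalizes, because
    \<open>c\<close> commutes with its power \<open>d\<close>.\<close>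
  define D where "D = {b \<in> B. b \<otimes> d = d \<otimes> b}"
  have d: "d \<in> carrier G" "c \<otimes> d = d \<otimes> c"
    using c commute_pow[OF refl c c] by (simp_all add: d_def)
  have D: "subgroup D G"
  proof (rule subgroupI)
    show "D \<subseteq> carrier G" using BG by (auto simp: D_def)
    show "D \<noteq> {}" using b bc by (auto simp: D_def d_def)
    show "inv x \<in> D" if "x \<in> D" for x
      using that commute_inv[of x d] d BG B(1) by (simp add: D_def subgroup.m_inv_closed)
    show "x \<otimes> y \<in> D" if "x \<in> D" "y \<in> D" for x y
      using that commute_mult[of x d y] d BG B(1) by (simp add: D_def subgroup.m_closed)
  qed
  have DG: "x \<in> carrier G" if "x \<in> D" for x using D that by (rule subgroup.mem_carrier)
  have nrmD: "c \<otimes> x \<otimes> inv c \<in> D" if "x \<in> D" for x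
  proof -
    have "c \<otimes> x \<otimes> inv c \<in> B" using nrm that by (simp add: D_def)
    moreover have "c \<otimes> x \<otimes> inv c \<otimes> d = d \<otimes> (c \<otimes> x \<otimes> inv c)"
      by (intro commute_mult commute_inv) (use that DG c d in \<open>simp_all add: D_def\<close>)
    ultimately show ?thesis by (simp add: D_def)
  qed
  have bD: "b \<in> D" using b bc by (simp add: D_def d_def)
  have nD: "c \<otimes> b \<otimes> inv c \<in> D" using nrmD bD by simp
  show ?thesis
  proof (cases "c \<otimes> b \<otimes> inv c = b")
    case True
    then have "c \<otimes> b = b \<otimes> c" using inv_solve_right'[of b "c \<otimes> b" c] b c BG by simp
    then show ?thesis using b by metis
  next
    case False
    have "merges (triple G) (\<lambda>i. c [^] (i - 1 :: nat)) (b, c)"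
      using te BG[OF b(1)] c by (simp add: thue_engel_def)
    then have "merges (triple G) (\<lambda>i. c [^] (1 + i - 1 :: nat)) (twist (triple G) (\<lambda>i. c [^] (i - 1 :: nat)) (b, c) 1)"
      by (subst merges_shift)
    moreover have "twist (triple G) (\<lambda>i. c [^] (i - 1 :: nat)) (b, c) 1 = (b \<otimes> c, c \<otimes> b \<otimes> inv c \<otimes> c)"
      using BG[OF b(1)] c by (simp add: triple_def m_assoc)
    \<comment> \<open>After one step the run from \<open>(b, c)\<close> is at
      \<open>(b \<otimes> c, c \<otimes> b)\<close>, two elements of the coset of \<open>D\<close>
      with exponent \<open>2 ^ Suc 0 - 1 - 0 = 1\<close>. Dropping that step also makes the middle
      factors c^0, c^1, c^2, ....\<close>
    ultimately have mg: "merges (triple G) (\<lambda>i. c [^] i)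
        (b \<otimes> c [^] (2 ^ Suc 0 - 1 - 0 :: nat), (c \<otimes> b \<otimes> inv c) \<otimes> c [^] (2 ^ Suc 0 - 1 - 0 :: nat))"
      using c by simp
    \<comment> \<open>The closed form of \<open>M (n + 1) = 2 * M n + n\<close> with
      \<open>M 0 = 1\<close>; the natural subtractions are exact since
      \<open>n + 1 \<le> 2 ^ Suc n\<close>.\<close>
    have rec: "2 ^ Suc (Suc n) - 1 - Suc n = 2 * (2 ^ Suc n - 1 - n) + n" for n :: nat
    proof -
      have "n + 1 \<le> 2 ^ Suc n" using less_exp[of "Suc n"] by simp
      then show ?thesis by simp
    qed
    obtain m b' where b': "b' \<in> D" "b' \<noteq> \<one>"
      and "b' \<otimes> c [^] (2 ^ Suc m - 1 - m + m :: nat) = c [^] (2 ^ Suc m - 1 - m + m :: nat) \<otimes> b'"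
      using merges_fixed_point[of D c "c \<otimes> b \<otimes> inv c" b "\<lambda>n. 2 ^ Suc n - 1 - n" "\<lambda>i. i",
          OF D _ c nrmD nD bD False rec mg] ab by (auto simp: D_def)
    moreover define q where "q = (2 ^ Suc m - 1 - m + m :: nat)"
    ultimately have bq: "b' \<otimes> c [^] q = c [^] q \<otimes> b'" by simp
    have "q = 2 ^ Suc m - 1" using less_exp[of "Suc m"] unfolding q_def by simp
    then have "odd q" by simp
    \<comment> \<open>With this choice, c^(q x) = d^y c. Since \<open>b'\<close> commutes with c^q
      and with \<open>d\<close>, the factor d^y can be cancelled.\<close>
    then obtain x y where xy: "q * x = 2 ^ n * y + 1" using odd_power_two_bezout by blast
    have b'G: "b' \<in> carrier G" and bd: "b' \<otimes> d = d \<otimes> b'" using b' DG by (auto simp: D_def)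
    let ?u = "d [^] y"
    have u: "?u \<in> carrier G" using d by simp
    have "(c [^] q) [^] x = ?u \<otimes> c" using c xy by (simp add: nat_pow_pow d_def)
    then have e1: "b' \<otimes> (?u \<otimes> c) = (?u \<otimes> c) \<otimes> b'"
      using commute_pow[OF bq b'G, of x] c by simp
    have e2: "b' \<otimes> ?u = ?u \<otimes> b'" using commute_pow[OF bd b'G d(1)] .
    have "?u \<otimes> (b' \<otimes> c) = (?u \<otimes> b') \<otimes> c" using b'G u c by (simp only: m_assoc)
    also have "\<dots> = b' \<otimes> (?u \<otimes> c)" unfolding e2[symmetric] using b'G u c by (simp only: m_assoc)
    also have "\<dots> = ?u \<otimes> (c \<otimes> b')" unfolding e1 using b'G u c by (simp only: m_assoc)
    finally have "b' \<otimes> c = c \<otimes> b'" using b'G u c by simp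
    then show ?thesis using b' by (auto simp: D_def)
  qed
qed

end

section \<open>A minimal abelian normal subgroup\<close>

context minimal_group
begin

lemma minimal_group_False: False
proof -
  obtain N where N: "subgroup N G" "\<forall>g\<in>carrier G. \<forall>n\<in>N. g \<otimes> n \<otimes> inv g \<in> N" "N \<noteq> {\<one>}" "N \<noteq> carrier G"
    using not_simple by (auto simp: simple_def)
  have NG: "N \<subseteq> carrier G" using N(1) by (rule subgroup.subset)
  have "{\<one>} \<subset> N" using N subgroup.one_closed by blast
  moreover have "h \<otimes> n \<otimes> inv h \<in> {\<one>}" if "h \<in> N" "n \<in> {\<one>}" for h n using that NG by auto
  ultimately obtain X where X: "subgroup X G" "{\<one>} \<subset> X" "X \<subseteq> N"
    and Xc: "\<forall>x\<in>X. \<forall>y\<in>N. (x \<otimes> y) \<otimes> inv (y \<otimes> x) \<in> {\<one>}"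
    using sec[OF N(1) triv_subgroup] N(4) by metis
  let ?P = "\<lambda>B. B \<noteq> {\<one>} \<and> (\<forall>g\<in>carrier G. \<forall>b\<in>B. g \<otimes> b \<otimes> inv g \<in> B) \<and>
    (\<forall>x\<in>B. \<forall>y\<in>B. x \<otimes> y = y \<otimes> x)"
  define \<B> where "\<B> = {B. subgroup B G \<and> ?P B}"
  have "finite \<B>" unfolding \<B>_def by (rule finite_subgroups[OF fin])
  \<comment> \<open>This is the center of \<open>N\<close>. It contains the subgroup
    \<open>X\<close> given by the section N/1, and it is normal in \<open>G\<close> because
    \<open>N\<close> is.\<close>
  moreover have "centralizer N \<inter> N \<in> \<B>"
  proof -
    have "subgroup (centralizer N \<inter> N) G"
      using subgroup_centralizer[OF NG] N(1) by (rule subgroups_Inter_pair)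
    moreover have "centralizer N \<inter> N \<noteq> {\<one>}"
    proof -
      obtain x where x: "x \<in> X" "x \<noteq> \<one>" using X by blast
      have "x \<otimes> y = y \<otimes> x" if y: "y \<in> N" for y
      proof -
        have xy: "x \<in> carrier G" "y \<in> carrier G" using x y X NG by blast+
        have "(x \<otimes> y) \<otimes> inv (y \<otimes> x) = \<one>" using Xc x y by blast
        then show ?thesis using xy inv_solve_right'[of \<one> "x \<otimes> y" "y \<otimes> x"] by simp
      qed
      then have "x \<in> centralizer N \<inter> N" using x X NG by (auto simp: centralizer_def)
      then show ?thesis using x by blast
    qed
    moreover have "g \<otimes> b \<otimes> inv g \<in> centralizer N \<inter> N"
      if g: "g \<in> carrier G" and b: "b \<in> centralizer N \<inter> N" for g b
    proof -
      have bG: "b \<in> carrier G" using b NG by blast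
      have "g \<otimes> b \<otimes> inv g \<otimes> x = x \<otimes> (g \<otimes> b \<otimes> inv g)" if x: "x \<in> N" for x
      proof -
        have xG: "x \<in> carrier G" using x NG by blast
        have "inv g \<otimes> x \<otimes> g \<in> N" using N(2) g x inv_closed[OF g] inv_inv[OF g] by metis
        then have "b \<otimes> (inv g \<otimes> x \<otimes> g) = (inv g \<otimes> x \<otimes> g) \<otimes> b"
          using b by (simp add: centralizer_def)
        then have "g \<otimes> (b \<otimes> (inv g \<otimes> x \<otimes> g)) \<otimes> inv g = g \<otimes> ((inv g \<otimes> x \<otimes> g) \<otimes> b) \<otimes> inv g"
          by simp
        moreover have "g \<otimes> (b \<otimes> (inv g \<otimes> x \<otimes> g)) \<otimes> inv g = g \<otimes> b \<otimes> inv g \<otimes> x"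
          using g bG xG by (simp only: m_assoc m_closed inv_closed r_inv r_one)
        moreover have "g \<otimes> ((inv g \<otimes> x \<otimes> g) \<otimes> b) \<otimes> inv g = (g \<otimes> inv g) \<otimes> x \<otimes> (g \<otimes> b \<otimes> inv g)"
          using g bG xG by (simp only: m_assoc m_closed inv_closed)
        ultimately show ?thesis using g bG xG by (simp only: r_inv l_one m_closed inv_closed)
      qed
      moreover have "g \<otimes> b \<otimes> inv g \<in> N" using N(2) g b by blast
      moreover have "g \<otimes> b \<otimes> inv g \<in> carrier G" using g bG by simp
      ultimately show ?thesis unfolding centralizer_def by blast
    qed
    moreover have "x \<otimes> y = y \<otimes> x" if "x \<in> centralizer N \<inter> N" "y \<in> centralizer N \<inter> N" for x y
      using that unfolding centralizer_def by blast
    ultimately show ?thesis unfolding \<B>_def by (intro CollectI conjI ballI)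
  qed
  ultimately obtain B where "B \<in> \<B>" and mn: "\<forall>B'\<in>\<B>. B' \<subseteq> B \<longrightarrow> B = B'"
    by (metis (no_types) empty_iff finite_has_minimal)
  from \<open>B \<in> \<B>\<close> have B: "subgroup B G" "B \<noteq> {\<one>}" and Bn: "\<And>g b. \<lbrakk>g \<in> carrier G; b \<in> B\<rbrakk> \<Longrightarrow> g \<otimes> b \<otimes> inv g \<in> B"
    and Bab: "\<And>x y. \<lbrakk>x \<in> B; y \<in> B\<rbrakk> \<Longrightarrow> x \<otimes> y = y \<otimes> x" unfolding \<B>_def by blast+
  have BG: "B \<subseteq> carrier G" using B(1) by (rule subgroup.subset)
  obtain b0 where b0: "b0 \<in> B" "b0 \<noteq> \<one>" using B subgroup.one_closed by blast
  let ?C = "centralizer B"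
  have C: "subgroup ?C G" using BG by (rule subgroup_centralizer)
  have Cn: "g \<otimes> x \<otimes> inv g \<in> ?C" if g: "g \<in> carrier G" and x: "x \<in> ?C" for g x
  proof -
    have xG: "x \<in> carrier G" using x by (simp add: centralizer_def)
    have "g \<otimes> x \<otimes> inv g \<otimes> b = b \<otimes> (g \<otimes> x \<otimes> inv g)" if b: "b \<in> B" for b
    proof -
      have bG: "b \<in> carrier G" using b BG by blast
      have "inv g \<otimes> b \<otimes> g \<in> B" using Bn[of "inv g" b] g b by simp
      then have "x \<otimes> (inv g \<otimes> b \<otimes> g) = (inv g \<otimes> b \<otimes> g) \<otimes> x"
        using x by (simp add: centralizer_def)
      then have "g \<otimes> (x \<otimes> (inv g \<otimes> b \<otimes> g)) \<otimes> inv g = g \<otimes> ((inv g \<otimes> b \<otimes> g) \<otimes> x) \<otimes> inv g"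
        by simp
      moreover have "g \<otimes> (x \<otimes> (inv g \<otimes> b \<otimes> g)) \<otimes> inv g = g \<otimes> x \<otimes> inv g \<otimes> b"
        using g xG bG by (simp only: m_assoc m_closed inv_closed r_inv r_one)
      moreover have "g \<otimes> ((inv g \<otimes> b \<otimes> g) \<otimes> x) \<otimes> inv g = (g \<otimes> inv g) \<otimes> b \<otimes> (g \<otimes> x \<otimes> inv g)"
        using g xG bG by (simp only: m_assoc m_closed inv_closed)
      ultimately show ?thesis using g xG bG by (simp only: r_inv l_one m_closed inv_closed)
    qed
    moreover have "g \<otimes> x \<otimes> inv g \<in> carrier G" using g xG by simp
    ultimately show ?thesis unfolding centralizer_def by blast
  qed
  \<comment> \<open>The centralizer contains the abelian group \<open>B\<close>, so it is
    nontrivial, and \<open>sec\<close> may be applied to the section of \<open>G\<close> by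
    it.\<close>
  have "b0 \<in> ?C" unfolding centralizer_def using b0 Bab BG by blast
  then have "?C \<noteq> {\<one>}" using b0 by blast
  moreover have "?C \<subset> carrier G"
    using centralizer_proper[OF BG b0] subgroup.subset[OF C] by blast
  ultimately obtain Y where Y: "subgroup Y G" "?C \<subset> Y" "Y \<subseteq> carrier G"
    and Yc: "\<forall>x\<in>Y. \<forall>y\<in>carrier G. (x \<otimes> y) \<otimes> inv (y \<otimes> x) \<in> ?C"
    using sec[OF subgroup_self C] Cn by auto
  \<comment> \<open>\<open>c\<close> is central modulo the centralizer of \<open>B\<close> but does
    not centralize \<open>B\<close>. Its fixed points in \<open>B\<close> form a nontrivial normal
    subgroup, so by minimality it centralizes \<open>B\<close> after all.\<close>
  obtain c where c: "c \<in> Y" "c \<notin> ?C" using Y by blast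
  have cG: "c \<in> carrier G" using c Y by blast
  define F where "F = {b \<in> B. b \<otimes> c = c \<otimes> b}"
  have FG: "x \<in> carrier G" if "x \<in> F" for x using that BG by (auto simp: F_def)
  have "subgroup F G"
  proof (rule subgroupI)
    show "F \<subseteq> carrier G" using FG by blast
    have "\<one> \<in> F" using subgroup.one_closed[OF B(1)] cG by (simp add: F_def)
    then show "F \<noteq> {}" by blast
    show "inv x \<in> F" if "x \<in> F" for x
      using that commute_inv[of x c] cG FG[OF that] B(1) by (simp add: F_def subgroup.m_inv_closed)
    show "x \<otimes> y \<in> F" if "x \<in> F" "y \<in> F" for x y
      using that commute_mult[of x c y] cG FG[OF that(1)] FG[OF that(2)] B(1)
      by (simp add: F_def subgroup.m_closed)
  qed
  moreover have "F \<noteq> {\<one>}"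
    using thue_engel_fixed_point[OF te B Bab cG Bn[OF cG]] by (auto simp: F_def)
  moreover have "g \<otimes> b \<otimes> inv g \<in> F" if g: "g \<in> carrier G" and b: "b \<in> F" for g b
  proof -
    have bG: "b \<in> carrier G" and bB: "b \<in> B" and bc: "b \<otimes> c = c \<otimes> b"
      using b BG by (auto simp: F_def)
    \<comment> \<open>A commutator of \<open>c\<close> with \<open>inv g\<close>, hence an element
      of the centralizer of \<open>B\<close>. The conjugate of \<open>c\<close> by
      \<open>inv g\<close> is \<open>inv k \<otimes> c\<close> and acts on \<open>B\<close> as
      \<open>c\<close> does; this makes \<open>F\<close> normal.\<close>
    define k where "k = (c \<otimes> inv g) \<otimes> inv (inv g \<otimes> c)"
    have k: "k \<in> ?C" "k \<in> carrier G" using Yc c g cG by (simp_all add: k_def)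
    have gc: "inv g \<otimes> c \<otimes> g = inv k \<otimes> c"
    proof -
      have "inv k = inv g \<otimes> c \<otimes> (g \<otimes> inv c)" using g cG by (simp add: k_def inv_mult_group)
      then show ?thesis using g cG by (simp only: m_assoc m_closed inv_closed l_inv r_one)
    qed
    have "k \<otimes> b = b \<otimes> k" using k bB by (simp add: centralizer_def)
    then have "(inv k \<otimes> c) \<otimes> b = b \<otimes> (inv k \<otimes> c)"
      using bc k bG cG by (intro commute_mult commute_inv) simp_all
    then have e: "(inv g \<otimes> c \<otimes> g) \<otimes> b = b \<otimes> (inv g \<otimes> c \<otimes> g)" by (simp only: gc)
    have "c \<otimes> (g \<otimes> b \<otimes> inv g) = (g \<otimes> inv g) \<otimes> c \<otimes> (g \<otimes> b \<otimes> inv g)"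
      using g cG bG by (simp only: r_inv l_one m_closed inv_closed)
    also have "\<dots> = g \<otimes> ((inv g \<otimes> c \<otimes> g) \<otimes> b) \<otimes> inv g"
      using g cG bG by (simp only: m_assoc m_closed inv_closed)
    also have "\<dots> = g \<otimes> b \<otimes> inv g \<otimes> c \<otimes> (g \<otimes> inv g)"
      unfolding e using g cG bG by (simp only: m_assoc m_closed inv_closed)
    also have "\<dots> = g \<otimes> b \<otimes> inv g \<otimes> c" using g cG bG by (simp only: r_inv r_one m_closed inv_closed)
    finally have "g \<otimes> b \<otimes> inv g \<otimes> c = c \<otimes> (g \<otimes> b \<otimes> inv g)" by (rule sym)
    then show ?thesis unfolding F_def using Bn[OF g bB] by (intro CollectI conjI)
  qed
  moreover have FB: "F \<subseteq> B" by (simp add: F_def)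
  moreover have "x \<otimes> y = y \<otimes> x" if "x \<in> F" "y \<in> F" for x y using Bab that FB by blast
  ultimately have "F \<in> \<B>" unfolding \<B>_def by (intro CollectI conjI ballI)
  then have BF: "B = F" using mn FB by (metis (no_types))
  have "c \<otimes> b = b \<otimes> c" if "b \<in> B" for b
  proof -
    have "b \<in> F" using that unfolding BF .
    then show ?thesis by (simp add: F_def)
  qed
  then have "c \<in> ?C" unfolding centralizer_def using cG by (intro CollectI conjI ballI)
  then show False using c by simp
qed

end

section \<open>Nilpotency of finite groups and merging of all their runs\<close>

lemma (in group) thue_engel_center_step:
  assumes fin: "finite (carrier G)" and te: "thue_engel G" and nt: "carrier G \<noteq> {\<one>}"
    and IH: "\<And>K :: 'a monoid. \<lbrakk>card (carrier K) < card (carrier G); group K;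
        finite (carrier K); thue_engel K; carrier K \<noteq> {\<one>\<^bsub>K\<^esub>}\<rbrakk> \<Longrightarrow>
        \<exists>x\<in>carrier K. x \<noteq> \<one>\<^bsub>K\<^esub> \<and> (\<forall>y\<in>carrier K. x \<otimes>\<^bsub>K\<^esub> y = y \<otimes>\<^bsub>K\<^esub> x)"
  shows "\<exists>x\<in>carrier G. x \<noteq> \<one> \<and> (\<forall>y\<in>carrier G. x \<otimes> y = y \<otimes> x)"
proof (rule ccontr)
  assume no: "\<not> ?thesis"
  have "minimal_group G"
  proof (unfold_locales)
    show "finite (carrier G)" "thue_engel G" "carrier G \<noteq> {\<one>}" by fact+
    show "x = \<one>" if "x \<in> carrier G" "\<And>y. y \<in> carrier G \<Longrightarrow> x \<otimes> y = y \<otimes> x" for x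
      using no that by blast
    fix H N assume HN: "subgroup H G" "subgroup N G" "N \<subset> H"
      "\<And>h n. \<lbrakk>h \<in> H; n \<in> N\<rbrakk> \<Longrightarrow> h \<otimes> n \<otimes> inv h \<in> N" "H \<noteq> carrier G \<or> N \<noteq> {\<one>}"
    show "\<exists>X. subgroup X G \<and> N \<subset> X \<and> X \<subseteq> H \<and> (\<forall>x\<in>X. \<forall>y\<in>H. y \<otimes> x \<otimes> inv y \<in> X) \<and>
        (\<forall>x\<in>X. \<forall>y\<in>H. (x \<otimes> y) \<otimes> inv (y \<otimes> x) \<in> N)"
    proof (rule section_center[OF fin te _ HN(1,2,3) _ HN(5)])
      fix K :: "'a monoid"
      assume "group K" "finite (carrier K)" "thue_engel K" "card (carrier K) < card (carrier G)"
        "carrier K \<noteq> {\<one>\<^bsub>K\<^esub>}"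
      then show "\<exists>x\<in>carrier K. x \<noteq> \<one>\<^bsub>K\<^esub> \<and> (\<forall>y\<in>carrier K. x \<otimes>\<^bsub>K\<^esub> y = y \<otimes>\<^bsub>K\<^esub> x)"
        by (intro IH)
    next
      show "h \<otimes> n \<otimes> inv h \<in> N" if "h \<in> H" "n \<in> N" for h n using HN(4) that .
    next
      fix X assume "subgroup X G" "N \<subset> X" "X \<subseteq> H"
        "\<And>x y. \<lbrakk>x \<in> X; y \<in> H\<rbrakk> \<Longrightarrow> y \<otimes> x \<otimes> inv y \<in> X"
        "\<And>x y. \<lbrakk>x \<in> X; y \<in> H\<rbrakk> \<Longrightarrow> (x \<otimes> y) \<otimes> inv (y \<otimes> x) \<in> N"
      then show ?thesis by (intro exI[of _ X] conjI ballI)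
    qed
  qed
  then show False by (rule minimal_group.minimal_group_False)
qed

text \<open>Since the hypotheses pass to quotients, dividing by centers repeatedly exhausts the
  group: this is nilpotency.\<close>

lemma thue_engel_center:
  fixes G :: "'a monoid"
  assumes "group G" "finite (carrier G)" "thue_engel G" "carrier G \<noteq> {\<one>\<^bsub>G\<^esub>}"
  shows "\<exists>x\<in>carrier G. x \<noteq> \<one>\<^bsub>G\<^esub> \<and> (\<forall>y\<in>carrier G. x \<otimes>\<^bsub>G\<^esub> y = y \<otimes>\<^bsub>G\<^esub> x)"
  using assms
proof (induction "card (carrier G)" arbitrary: G rule: less_induct)
  case less
  show ?case by (rule group.thue_engel_center_step[OF less.prems(1-4) less.hyps])
qed

text \<open>Modulo the center the words merge by induction. From then on they differ by a central
  factor, and one further step puts that factor once into each word, whatever the middle factor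
  is.\<close>

lemma (in group) thue_engel_merges_step:
  assumes fin: "finite (carrier G)" and te: "thue_engel G"
    and z: "\<And>i. z i \<in> carrier G" and ab: "a \<in> carrier G" "b \<in> carrier G"
    and IH: "\<And>(K :: 'a monoid) z a b. \<lbrakk>card (carrier K) < card (carrier G); group K;
        finite (carrier K); thue_engel K; \<And>i. z i \<in> carrier K; a \<in> carrier K; b \<in> carrier K\<rbrakk>
        \<Longrightarrow> merges (triple K) z (a, b)"
    and center: "carrier G \<noteq> {\<one>} \<Longrightarrow> \<exists>x\<in>carrier G. x \<noteq> \<one> \<and> (\<forall>y\<in>carrier G. x \<otimes> y = y \<otimes> x)"
  shows "merges (triple G) z (a, b)"
proof (cases "carrier G = {\<one>}")
  case True
  then have "a = b" using ab by auto
  then have "fst (twist (triple G) z (a, b) 0) = snd (twist (triple G) z (a, b) 0)" by simp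
  then show ?thesis unfolding merges_def by blast
next
  case False
  let ?Z = "centralizer (carrier G)"
  obtain x where x: "x \<in> ?Z" "x \<noteq> \<one>"
    using center[OF False] by (auto simp: centralizer_def)
  have Z: "subgroup ?Z G" by (rule subgroup_centralizer) simp
  have "g \<otimes> n \<otimes> inv g = n" if "g \<in> carrier G" "n \<in> ?Z" for g n
  proof -
    have "n \<otimes> g = g \<otimes> n" "n \<in> carrier G" using that by (simp_all add: centralizer_def)
    then have "g \<otimes> n \<otimes> inv g = n \<otimes> g \<otimes> inv g" by simp
    also have "\<dots> = n" using that \<open>n \<in> carrier G\<close> by (simp add: m_assoc)
    finally show ?thesis .
  qed
  then have "?Z \<lhd> G" using Z by (auto simp: normal_inv_iff)
  then obtain K :: "'a monoid" and f where K: "group_hom G K f" "carrier K = f ` carrier G"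
    and f: "\<And>a b. \<lbrakk>a \<in> carrier G; b \<in> carrier G\<rbrakk> \<Longrightarrow> f a = f b \<longleftrightarrow> a \<otimes> inv b \<in> ?Z"
    using quotient_same_type by blast
  interpret h: group_hom G K f by fact
  have xG: "x \<in> carrier G" using x by (simp add: centralizer_def)
  have "f x = f \<one>" using f[OF xG one_closed] x xG by simp
  then have "\<not> inj_on f (carrier G)" using inj_on_eq_iff[OF _ xG one_closed, of f] x by argo
  then have "card (f ` carrier G) \<noteq> card (carrier G)" using eq_card_imp_inj_on[OF fin] by blast
  then have "card (carrier K) < card (carrier G)"
    using card_image_le[OF fin, of f] by (simp add: K(2))
  moreover have "thue_engel K" using h.thue_engel_image te K by blast
  ultimately have "merges (triple K) (\<lambda>i. f (z i)) (f a, f b)"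
    using z ab fin K by (intro IH) (auto simp: h.H.is_group)
  then obtain n where n: "fst (twist (triple K) (\<lambda>i. f (z i)) (f a, f b) n) = snd (twist (triple K) (\<lambda>i. f (z i)) (f a, f b) n)"
    by (auto simp: merges_def)
  have "twist (triple K) (\<lambda>i. f (z i)) (map_prod f f (a, b)) n = map_prod f f (twist (triple G) z (a, b) n)"
    by (rule twist_hom[where A = "carrier G"]) (use z ab in \<open>auto simp: triple_def\<close>)
  moreover obtain l r where lr: "twist (triple G) z (a, b) n = (l, r)" by fastforce
  ultimately have "f l = f r" using n by simp
  moreover have lrG: "l \<in> carrier G" "r \<in> carrier G"
    using twist_in[of "carrier G" "triple G" z "(a, b)" n] z ab lr by (auto simp: triple_def)
  ultimately have k: "l \<otimes> inv r \<in> ?Z" using f by simp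
  define k where "k = l \<otimes> inv r"
  have kG: "k \<in> carrier G" and kz: "\<And>y. y \<in> carrier G \<Longrightarrow> k \<otimes> y = y \<otimes> k"
    using k by (simp_all add: k_def centralizer_def)
  have l: "l = k \<otimes> r" using lrG by (simp add: k_def m_assoc)
  have zG: "z n \<in> carrier G" using z by simp
  \<comment> \<open>With \<open>l = k \<otimes> r\<close> both new words equal
    \<open>k \<otimes> r \<otimes> z n \<otimes> r\<close>.\<close>
  have "r \<otimes> z n \<otimes> (k \<otimes> r) = (r \<otimes> z n \<otimes> k) \<otimes> r" using kG lrG zG by (simp add: m_assoc)
  also have "\<dots> = k \<otimes> r \<otimes> z n \<otimes> r"
    using kz[of "r \<otimes> z n"] kG lrG zG by (simp add: m_assoc)
  finally have "fst (twist (triple G) z (a, b) (Suc n)) = snd (twist (triple G) z (a, b) (Suc n))"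
    using lr l by (simp add: triple_def)
  then show ?thesis unfolding merges_def by blast
qed

lemma thue_engel_merges:
  fixes G :: "'a monoid"
  assumes "group G" "finite (carrier G)" "thue_engel G"
    "\<And>i. z i \<in> carrier G" "a \<in> carrier G" "b \<in> carrier G"
  shows "merges (triple G) z (a, b)"
  using assms
proof (induction "card (carrier G)" arbitrary: G z a b rule: less_induct)
  case less
  show ?case
    by (rule group.thue_engel_merges_step[OF less.prems(1-6) less.hyps thue_engel_center[OF less.prems(1-3)]])
qed

section \<open>Finite monoids\<close>

context monoid
begin

lemma idempotent_power:
  assumes fin: "finite (carrier G)" and d: "d \<in> carrier G"
  shows "\<exists>n>0. d [^] n \<otimes> d [^] n = d [^] (n :: nat)"
proof -
  have "finite (range (\<lambda>n::nat. d [^] n))" using d by (intro finite_subset[OF _ fin]) auto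
  then have "\<not> inj (\<lambda>n::nat. d [^] n)" using finite_imageD by fastforce
  then obtain i j :: nat where "d [^] i = d [^] j" "i < j" unfolding inj_on_def by (metis linorder_neqE)
  then obtain p where p: "p > 0" "d [^] i = d [^] (i + p)" by (metis less_imp_add_positive)
  have per: "d [^] (i + k * p) = d [^] i" for k
  proof (induction k)
    case (Suc k)
    have "d [^] (i + Suc k * p) = d [^] (i + k * p) \<otimes> d [^] p" using d by (simp add: nat_pow_mult add.commute add.left_commute)
    also have "\<dots> = d [^] (i + p)" unfolding Suc using d by (simp add: nat_pow_mult)
    finally show ?case using p(2) by simp
  qed simp
  \<comment> \<open>A multiple of the period \<open>p\<close> that is not below the preperiod
    \<open>i\<close>.\<close>
  define n where "n = Suc i * p"
  have "i \<le> n" using p(1) by (simp add: n_def trans_le_add2)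
  then obtain k where k: "n = i + k" by (auto simp: le_iff_add)
  have "n + n = (i + Suc i * p) + k" using k by (simp add: n_def)
  then have "d [^] n \<otimes> d [^] n = d [^] (i + Suc i * p) \<otimes> d [^] k"
    using d by (simp only: nat_pow_mult)
  also have "\<dots> = d [^] n" unfolding per using d k by (simp add: nat_pow_mult)
  finally show ?thesis using p(1) by (intro exI[of _ n]) (simp add: n_def)
qed

section \<open>The local monoid eGe and the maximal subgroup at an idempotent e\<close>

definition local_monoid :: "'a \<Rightarrow> 'a monoid" where
  "local_monoid e = \<lparr>carrier = {x \<in> carrier G. e \<otimes> x = x \<and> x \<otimes> e = x}, mult = (\<otimes>), one = e\<rparr>"

text \<open>For idempotent \<open>e\<close> this is the maximal subgroup of the monoid with identity
  \<open>e\<close>. Group results enter the monoid part through it.\<close>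

definition local_group :: "'a \<Rightarrow> 'a monoid" where
  "local_group e = units_of (local_monoid e)"

context
  fixes e assumes e: "e \<in> carrier G" "e \<otimes> e = e"
begin

lemma monoid_local_monoid: "monoid (local_monoid e)"
proof (rule monoidI; clarsimp simp: local_monoid_def e)
  fix x y assume "x \<in> carrier G" "e \<otimes> x = x" "x \<otimes> e = x" "y \<in> carrier G" "e \<otimes> y = y" "y \<otimes> e = y"
  then show "e \<otimes> (x \<otimes> y) = x \<otimes> y \<and> x \<otimes> y \<otimes> e = x \<otimes> y"
    using e by (metis m_assoc)
qed (simp add: m_assoc)

lemma group_local_group: "group (local_group e)"
  unfolding local_group_def using monoid_local_monoid by (rule monoid.units_group)

lemma local_group_simps:
  "mult (local_group e) = (\<otimes>)" "one (local_group e) = e" "triple (local_group e) = triple G"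
  by (simp_all add: local_group_def units_of_def local_monoid_def triple_def fun_eq_iff)

lemma local_groupD:
  assumes "x \<in> carrier (local_group e)"
  shows "x \<in> carrier G" "e \<otimes> x = x" "x \<otimes> e = x"
  using assms by (auto simp: local_group_def units_of_def local_monoid_def Units_def)

text \<open>One-sided inverses \<open>u\<close> and \<open>v\<close> may be taken anywhere in the
  monoid: multiplied by \<open>e\<close> on both sides they lie in eGe, where a left and a right
  inverse coincide.\<close>

lemma local_groupI:
  assumes p: "p \<in> carrier G" "e \<otimes> p = p" "p \<otimes> e = p"
    and u: "u \<in> carrier G" "e = p \<otimes> u" and v: "v \<in> carrier G" "e = v \<otimes> p"
  shows "p \<in> carrier (local_group e)"
proof -
  have inv: "p \<otimes> (e \<otimes> u \<otimes> e) = e" "e \<otimes> v \<otimes> e \<otimes> p = e"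
  proof -
    have "p \<otimes> (e \<otimes> u \<otimes> e) = (p \<otimes> e) \<otimes> u \<otimes> e" using p(1) u(1) e(1) by (simp add: m_assoc)
    then show "p \<otimes> (e \<otimes> u \<otimes> e) = e" using p(3) u(2) e(2) by simp
    have "e \<otimes> v \<otimes> e \<otimes> p = e \<otimes> (v \<otimes> (e \<otimes> p))" using p(1) v(1) e(1) by (simp add: m_assoc)
    then show "e \<otimes> v \<otimes> e \<otimes> p = e" using p(2) v(2) e(2) by simp
  qed
  have abs: "e \<otimes> (e \<otimes> x \<otimes> e) = e \<otimes> x \<otimes> e" "e \<otimes> x \<otimes> e \<otimes> e = e \<otimes> x \<otimes> e" if "x \<in> carrier G" for x
  proof -
    have "e \<otimes> (e \<otimes> x \<otimes> e) = (e \<otimes> e) \<otimes> x \<otimes> e" "e \<otimes> x \<otimes> e \<otimes> e = e \<otimes> x \<otimes> (e \<otimes> e)"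
      using that e(1) by (simp_all add: m_assoc)
    then show "e \<otimes> (e \<otimes> x \<otimes> e) = e \<otimes> x \<otimes> e" "e \<otimes> x \<otimes> e \<otimes> e = e \<otimes> x \<otimes> e" using e(2) by simp_all
  qed
  have "e \<otimes> v \<otimes> e = (e \<otimes> v \<otimes> e) \<otimes> (p \<otimes> (e \<otimes> u \<otimes> e))" using inv abs v(1) by simp
  also have "\<dots> = (e \<otimes> v \<otimes> e \<otimes> p) \<otimes> (e \<otimes> u \<otimes> e)" using p(1) u(1) v(1) e(1) by (simp add: m_assoc)
  also have "\<dots> = e \<otimes> u \<otimes> e" using inv abs u(1) by simp
  finally have "(e \<otimes> u \<otimes> e) \<otimes> p = e" using inv(2) by simp
  then show ?thesis using inv(1) abs u(1) p e(1)
    unfolding local_group_def units_of_def local_monoid_def Units_def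
    by (auto intro!: exI[of _ "e \<otimes> u \<otimes> e"])
qed

lemma local_group_pow:
  assumes "x \<in> carrier G" "e \<otimes> x = x \<otimes> e"
  shows "(e \<otimes> x) [^]\<^bsub>local_group e\<^esub> (n::nat) = e \<otimes> x [^] n"
proof (induction n)
  case 0
  then show ?case using e by (simp add: local_group_simps)
next
  case (Suc n)
  have "(e \<otimes> x) [^]\<^bsub>local_group e\<^esub> Suc n = e \<otimes> x [^] n \<otimes> (x \<otimes> e)"
    using Suc assms(2) by (simp add: local_group_simps)
  also have "\<dots> = e \<otimes> (x [^] Suc n \<otimes> e)" using assms e by (simp add: m_assoc)
  also have "x [^] Suc n \<otimes> e = e \<otimes> x [^] Suc n"
    using assms(1,2) e(1)
  proof (induction "Suc n" arbitrary: n rule: less_induct)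
    case less
    show ?case
    proof (cases n)
      case (Suc k)
      have "x [^] Suc n \<otimes> e = x [^] n \<otimes> (x \<otimes> e)" using less.prems by (simp add: m_assoc)
      also have "\<dots> = (x [^] n \<otimes> e) \<otimes> x" using less.prems by (simp add: m_assoc flip: less.prems(2))
      also have "x [^] n \<otimes> e = e \<otimes> x [^] n" using less Suc by blast
      finally show ?thesis using less.prems by (simp add: m_assoc)
    qed (use less.prems in simp)
  qed
  also have "e \<otimes> (e \<otimes> x [^] Suc n) = e \<otimes> x [^] Suc n"
    using e assms(1) by (simp flip: m_assoc)
  finally show ?case .
qed

text \<open>Words of the maximal subgroup absorb \<open>e\<close>, so a middle factor
  \<open>x\<close> outside the subgroup acts like \<open>e \<otimes> x\<close>. Exponent 0 fits too:
  the identity of the local group is \<open>e\<close>.\<close>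

lemma merges_local_group:
  assumes "x \<in> carrier G" "e \<otimes> x = x \<otimes> e" "e \<otimes> x \<in> carrier (local_group e)"
    and "a \<in> carrier (local_group e)" "b \<in> carrier (local_group e)"
  shows "merges (triple (local_group e)) (\<lambda>i. (e \<otimes> x) [^]\<^bsub>local_group e\<^esub> (k i :: nat)) (a, b)
    \<longleftrightarrow> merges (triple G) (\<lambda>i. x [^] k i) (a, b)"
proof -
  interpret L: group "local_group e" by (rule group_local_group)
  have "twist (triple G) (\<lambda>i. x [^] k i) (map_prod (\<lambda>x. x) (\<lambda>x. x) (a, b)) n =
      map_prod (\<lambda>x. x) (\<lambda>x. x) (twist (triple (local_group e)) (\<lambda>i. (e \<otimes> x) [^]\<^bsub>local_group e\<^esub> k i) (a, b) n)" for n
  proof (rule twist_hom[where A = "carrier (local_group e)"])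
    fix l r i assume lr: "l \<in> carrier (local_group e)" "r \<in> carrier (local_group e)"
    show "triple (local_group e) l ((e \<otimes> x) [^]\<^bsub>local_group e\<^esub> k i) r \<in> carrier (local_group e)"
      using lr assms(3) by (simp add: triple_def)
    have "l \<otimes> (e \<otimes> x [^] k i) = (l \<otimes> e) \<otimes> x [^] k i"
      using local_groupD(1)[OF lr(1)] e assms(1) by (intro m_assoc[symmetric]) simp_all
    then have "l \<otimes> (e \<otimes> x [^] k i) = l \<otimes> x [^] k i" using local_groupD(3)[OF lr(1)] by simp
    then show "triple (local_group e) l ((e \<otimes> x) [^]\<^bsub>local_group e\<^esub> k i) r = triple G l (x [^] k i) r"
      unfolding local_group_simps triple_def local_group_pow[OF assms(1,2)] by simp
  qed (use assms in auto)
  then show ?thesis by (simp add: merges_def)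
qed

lemma thue_engel_local_group:
  assumes "thue_engel G"
  shows "thue_engel (local_group e)"
  unfolding thue_engel_def
proof (intro ballI conjI)
  fix a b assume ab: "a \<in> carrier (local_group e)" "b \<in> carrier (local_group e)"
  interpret L: group "local_group e" by (rule group_local_group)
  have "e \<in> carrier (local_group e)" using L.one_closed by (simp add: local_group_simps)
  then have "merges (triple (local_group e)) (\<lambda>i. e [^]\<^bsub>local_group e\<^esub> (0::nat)) (a, b) \<longleftrightarrow>
      merges (triple G) (\<lambda>i. e [^] (0::nat)) (a, b)"
    using merges_local_group[of e a b "\<lambda>_. 0"] e ab by simp
  then show "merges (triple (local_group e)) (\<lambda>_. \<one>\<^bsub>local_group e\<^esub>) (a, b)"
    using assms local_groupD(1) ab by (simp add: thue_engel_def)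
  show "merges (triple (local_group e)) (\<lambda>i. b [^]\<^bsub>local_group e\<^esub> (i - 1)) (a, b)"
    using merges_local_group[of b a b "\<lambda>i. i - 1"] local_groupD[OF ab(1)] local_groupD[OF ab(2)] ab assms
    by (simp add: thue_engel_def)
qed

end

section \<open>Cycles of a run under the Thue--Morse condition\<close>

lemma thue_L_trivial:
  assumes te: "thue_engel G" and ab: "a \<in> carrier G" "b \<in> carrier G" "a \<otimes> b = a" "b \<otimes> a = b"
  shows "a = b"
proof -
  have "twist (triple G) (\<lambda>_. \<one>) (a, b) n = (a, b)" for n
    by (induction n) (use ab in \<open>simp_all add: triple_def\<close>)
  moreover obtain n where "fst (twist (triple G) (\<lambda>_. \<one>) (a, b) n) = snd (twist (triple G) (\<lambda>_. \<one>) (a, b) n)"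
    using te ab by (auto simp: thue_engel_def merges_def)
  ultimately show ?thesis by simp
qed

text \<open>The equations say that \<open>a\<close> and \<open>b\<close> are R-related idempotents;
  a step then exchanges them. In the L-related case a step fixes both. Neither run could merge
  unless \<open>a = b\<close>.\<close>

lemma thue_R_trivial:
  assumes te: "thue_engel G" and ab: "a \<in> carrier G" "b \<in> carrier G" "a \<otimes> b = b" "b \<otimes> a = a"
  shows "a = b"
proof -
  have "twist (triple G) (\<lambda>_. \<one>) (a, b) n \<in> {(a, b), (b, a)}" for n
    by (induction n) (use ab in \<open>auto simp: triple_def\<close>)
  moreover obtain n where "fst (twist (triple G) (\<lambda>_. \<one>) (a, b) n) = snd (twist (triple G) (\<lambda>_. \<one>) (a, b) n)"
    using te ab by (auto simp: thue_engel_def merges_def)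
  ultimately show ?thesis by (metis empty_iff fst_conv insert_iff snd_conv)
qed

end

text \<open>A step from (l, r) to (lzr, rzl) on a cycle. The return to \<open>l\<close> and
  \<open>r\<close> supplies the multipliers that undo the step, so \<open>lzr\<close> is R-related
  to \<open>l\<close> and L-related to \<open>r\<close>, and symmetrically for
  \<open>rzl\<close>.\<close>

locale recurrent_step = monoid +
  fixes l z r y v y' v'
  assumes te: "thue_engel G"
    and carr: "l \<in> carrier G" "z \<in> carrier G" "r \<in> carrier G" "y \<in> carrier G" "v \<in> carrier G"
      "y' \<in> carrier G" "v' \<in> carrier G"
    and l: "l = l \<otimes> z \<otimes> r \<otimes> y" and r: "r = v \<otimes> l \<otimes> z \<otimes> r"
    and r': "r = r \<otimes> z \<otimes> l \<otimes> y'" and l': "l = v' \<otimes> r \<otimes> z \<otimes> l"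
begin

lemma g: "z \<otimes> r \<otimes> y = z \<otimes> v \<otimes> l"
proof -
  have "z \<otimes> r \<otimes> y = z \<otimes> (v \<otimes> l \<otimes> z \<otimes> r) \<otimes> y" using r by simp
  also have "\<dots> = z \<otimes> v \<otimes> (l \<otimes> z \<otimes> r \<otimes> y)" using carr by (simp add: m_assoc)
  finally show ?thesis using l by simp
qed

lemma h: "r \<otimes> y \<otimes> z = v \<otimes> l \<otimes> z"
proof -
  have "r \<otimes> y \<otimes> z = (v \<otimes> l \<otimes> z \<otimes> r) \<otimes> y \<otimes> z" using r by simp
  also have "\<dots> = v \<otimes> (l \<otimes> z \<otimes> r \<otimes> y) \<otimes> z" using carr by (simp add: m_assoc)
  finally show ?thesis using l by simp
qed

lemma swap: "recurrent_step G r z l y' v' y v"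
  using te carr l r l' r' by unfold_locales auto

text \<open>\<open>z \<otimes> r \<otimes> y\<close> is a right identity of \<open>l\<close> that
  ends in \<open>l\<close>, and \<open>r \<otimes> y \<otimes> z\<close> is a left identity of
  \<open>r\<close>, which ends in \<open>l \<otimes> z\<close>. Each product therefore collapses by
  l = l z r y.\<close>

lemma idem: "(z \<otimes> r \<otimes> y) \<otimes> (z \<otimes> r \<otimes> y) = z \<otimes> r \<otimes> y" "(r \<otimes> y \<otimes> z) \<otimes> (r \<otimes> y \<otimes> z) = r \<otimes> y \<otimes> z"
proof -
  have "(z \<otimes> r \<otimes> y) \<otimes> (z \<otimes> r \<otimes> y) = (z \<otimes> v \<otimes> l) \<otimes> (z \<otimes> r \<otimes> y)" using g by simp
  also have "\<dots> = z \<otimes> v \<otimes> (l \<otimes> z \<otimes> r \<otimes> y)" using carr by (simp add: m_assoc)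
  finally show "(z \<otimes> r \<otimes> y) \<otimes> (z \<otimes> r \<otimes> y) = z \<otimes> r \<otimes> y" using l g by simp
  have "(r \<otimes> y \<otimes> z) \<otimes> (r \<otimes> y \<otimes> z) = (v \<otimes> l \<otimes> z) \<otimes> (r \<otimes> y \<otimes> z)" using h by simp
  also have "\<dots> = v \<otimes> (l \<otimes> z \<otimes> r \<otimes> y) \<otimes> z" using carr by (simp add: m_assoc)
  finally show "(r \<otimes> y \<otimes> z) \<otimes> (r \<otimes> y \<otimes> z) = r \<otimes> y \<otimes> z" using l h by simp
qed

text \<open>With g = zry and h = ryz, the idempotents zh and h are L-related, and g and gz are
  R-related. The Thue--Morse condition identifies both pairs, and zh = gz.\<close>

lemma idempotent_middle:
  assumes z: "z \<otimes> z = z"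
  shows "z \<otimes> r \<otimes> y = r \<otimes> y \<otimes> z"
proof -
  let ?g = "z \<otimes> r \<otimes> y" and ?h = "r \<otimes> y \<otimes> z"
  have gh: "?g \<in> carrier G" "?h \<in> carrier G" using carr by simp_all
  have hz: "?h \<otimes> z = ?h" using carr z by (simp add: m_assoc)
  have zg: "z \<otimes> ?g = ?g"
  proof -
    have "z \<otimes> ?g = (z \<otimes> z) \<otimes> r \<otimes> y" using carr by (simp add: m_assoc)
    then show ?thesis using z by simp
  qed
  have "z \<otimes> ?h = ?h"
  proof (rule thue_L_trivial[OF te])
    have "z \<otimes> ?h \<otimes> ?h = z \<otimes> (?h \<otimes> ?h)" using gh carr by (simp only: m_assoc)
    then show "z \<otimes> ?h \<otimes> ?h = z \<otimes> ?h" using idem by simp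
    have "?h \<otimes> (z \<otimes> ?h) = (?h \<otimes> z) \<otimes> ?h" using gh carr by (simp only: m_assoc m_closed)
    then show "?h \<otimes> (z \<otimes> ?h) = ?h" using idem hz by simp
  qed (use carr in simp_all)
  moreover have "?g = ?g \<otimes> z"
  proof (rule thue_R_trivial[OF te])
    have "?g \<otimes> (?g \<otimes> z) = (?g \<otimes> ?g) \<otimes> z" using gh carr by (simp only: m_assoc m_closed)
    then show "?g \<otimes> (?g \<otimes> z) = ?g \<otimes> z" using idem by simp
    have "?g \<otimes> z \<otimes> ?g = ?g \<otimes> (z \<otimes> ?g)" using gh carr by (simp only: m_assoc m_closed)
    then show "?g \<otimes> z \<otimes> ?g = ?g" using idem zg by simp
  qed (use carr in simp_all)
  moreover have "z \<otimes> ?h = ?g \<otimes> z" using carr by (simp add: m_assoc)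
  ultimately show ?thesis by simp
qed

end

text \<open>Two consecutive steps on a cycle with middle factors \<open>f\<close> and
  \<open>f \<otimes> d\<close>. In the application \<open>f\<close> is an idempotent power of
  \<open>d\<close>.\<close>

locale double_step = s1: recurrent_step G l f r y v y' v' +
    s2: recurrent_step G "l \<otimes> f \<otimes> r" "f \<otimes> d" "r \<otimes> f \<otimes> l" y2 v2 y2' v2'
  for G (structure) and l f r y v y' v' d y2 v2 y2' v2' +
  assumes f: "f \<otimes> f = f" and d: "d \<in> carrier G" "f \<otimes> d = d \<otimes> f"
begin

lemma swap: "double_step G r f l y' v' y v d y2' v2' y2 v2"
  using s1.swap s2.swap f d by (simp add: double_step_def double_step_axioms_def)

text \<open>The idempotent that is R-related to \<open>r\<close> and L-related to \<open>l\<close>.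
  Its mirror image \<open>e'\<close> is R-related to \<open>l\<close> and L-related to
  \<open>r\<close>.\<close>

definition "e = r \<otimes> y \<otimes> f"

lemma e_eqs: "e = r \<otimes> y \<otimes> f" "e = f \<otimes> r \<otimes> y" "e = f \<otimes> v \<otimes> l" "e = v \<otimes> l \<otimes> f"
  using s1.idempotent_middle[OF f] s1.g s1.h by (simp_all add: e_def)

lemma e_carr: "e \<in> carrier G" using s1.carr by (simp add: e_def)

lemma e_idem: "e \<otimes> e = e" using s1.idem(2) by (simp add: e_def)

lemma f_e: "f \<otimes> e = e" "e \<otimes> f = e"
proof -
  have "f \<otimes> e = (f \<otimes> f) \<otimes> r \<otimes> y" unfolding e_eqs(2) using s1.carr by (simp add: s1.m_assoc)
  then show "f \<otimes> e = e" using f e_eqs(2) by simp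
  have "e \<otimes> f = r \<otimes> y \<otimes> (f \<otimes> f)" unfolding e_def using s1.carr by (simp add: s1.m_assoc)
  then show "e \<otimes> f = e" using f e_eqs(1) by simp
qed

lemma l_e: "l \<otimes> e = l" unfolding e_eqs(2) using s1.l s1.carr by (simp add: s1.m_assoc)

lemma e_r: "e \<otimes> r = r" unfolding e_eqs(4) using s1.r by simp

end

text \<open>The exchange of \<open>l\<close> and \<open>r\<close> turns each fact about
  \<open>e\<close> into one about \<open>e'\<close>. Exchanging twice restores the
  parameters.\<close>

sublocale double_step \<subseteq> sw: double_step G r f l y' v' y v d y2' v2' y2 v2
  by (rule swap)

context double_step
begin

abbreviation "e' \<equiv> sw.e"

text \<open>The right-hand side is the idempotent \<open>z \<otimes> r \<otimes> y\<close> of the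
  second step. It is L-related to \<open>l \<otimes> f \<otimes> r\<close>, as are \<open>r\<close>
  and hence \<open>e'\<close>.\<close>

lemma e'_eq: "e' = f \<otimes> d \<otimes> (r \<otimes> f \<otimes> l) \<otimes> y2"
proof (rule s1.thue_L_trivial[OF s1.te, symmetric])
  let ?l1 = "l \<otimes> f \<otimes> r" and ?g = "f \<otimes> d \<otimes> (r \<otimes> f \<otimes> l) \<otimes> y2"
  show "?g \<in> carrier G" using s1.carr s2.carr d by simp
  show "e' \<in> carrier G" by (rule sw.e_carr)
  have "?g \<otimes> e' = f \<otimes> d \<otimes> v2 \<otimes> ?l1 \<otimes> e'" unfolding s2.g ..
  also have "\<dots> = f \<otimes> d \<otimes> v2 \<otimes> (l \<otimes> f \<otimes> (r \<otimes> e'))"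
    using s1.carr s2.carr d sw.e_carr by (simp only: s1.m_assoc s1.m_closed)
  also have "\<dots> = ?g" unfolding sw.l_e s2.g ..
  finally show "?g \<otimes> e' = ?g" .
  have e': "e' = f \<otimes> v' \<otimes> v \<otimes> ?l1"
  proof -
    have "e' = f \<otimes> v' \<otimes> (v \<otimes> l \<otimes> f \<otimes> r)" using sw.e_eqs(3) s1.r by simp
    then show ?thesis using s1.carr by (simp only: s1.m_assoc s1.m_closed)
  qed
  have "e' \<otimes> ?g = f \<otimes> v' \<otimes> v \<otimes> (?l1 \<otimes> (f \<otimes> d) \<otimes> (r \<otimes> f \<otimes> l) \<otimes> y2)"
    unfolding e' using s1.carr s2.carr d by (simp only: s1.m_assoc s1.m_closed)
  also have "\<dots> = e'" unfolding e' using s2.l by simp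
  finally show "e' \<otimes> ?g = e'" .
qed

text \<open>The right-hand side is the idempotent \<open>r \<otimes> y \<otimes> z\<close> of the
  second step. It is R-related to \<open>r \<otimes> f \<otimes> l\<close>, as are \<open>r\<close>
  and hence \<open>e\<close>.\<close>

lemma e_eq: "e = r \<otimes> f \<otimes> l \<otimes> y2 \<otimes> (f \<otimes> d)"
proof (rule s1.thue_R_trivial[OF s1.te, symmetric])
  let ?r1 = "r \<otimes> f \<otimes> l" and ?h = "r \<otimes> f \<otimes> l \<otimes> y2 \<otimes> (f \<otimes> d)"
  show "?h \<in> carrier G" using s1.carr s2.carr d by simp
  show "e \<in> carrier G" by (rule e_carr)
  have "e \<otimes> ?h = (e \<otimes> r) \<otimes> f \<otimes> l \<otimes> y2 \<otimes> (f \<otimes> d)"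
    using s1.carr s2.carr d e_carr by (simp only: s1.m_assoc s1.m_closed)
  then show "e \<otimes> ?h = ?h" using e_r by simp
  have r: "r = ?r1 \<otimes> y'" using s1.r' .
  have "?h \<otimes> r = ?h \<otimes> (?r1 \<otimes> y')" using r by simp
  also have "\<dots> = (v2 \<otimes> (l \<otimes> f \<otimes> r) \<otimes> (f \<otimes> d)) \<otimes> (?r1 \<otimes> y')" using s2.h by simp
  also have "\<dots> = (v2 \<otimes> (l \<otimes> f \<otimes> r) \<otimes> (f \<otimes> d) \<otimes> ?r1) \<otimes> y'"
    using s1.carr s2.carr d by (simp only: s1.m_assoc s1.m_closed)
  also have "\<dots> = r" using s2.r r by simp
  finally have hr: "?h \<otimes> r = r" .
  have "?h \<otimes> e = ?h \<otimes> r \<otimes> y \<otimes> f"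
    unfolding e_def using s1.carr s2.carr d by (simp only: s1.m_assoc s1.m_closed)
  then show "?h \<otimes> e = e" unfolding hr e_def .
qed

text \<open>For u = rfl y2 the two preceding lemmas read e' = (fd)u and e = u(fd), so e'(fd) =
  (fd)e. By symmetry also ed = de': multiplication by \<open>d\<close> exchanges the two
  idempotents.\<close>

lemma e'_d: "e' \<otimes> d = d \<otimes> e"
proof -
  have "e' \<otimes> d = e' \<otimes> (f \<otimes> d)"
  proof -
    have "e' \<otimes> (f \<otimes> d) = (e' \<otimes> f) \<otimes> d" using sw.e_carr s1.carr d by (simp only: s1.m_assoc)
    then show ?thesis using sw.f_e by simp
  qed
  also have "\<dots> = (f \<otimes> d) \<otimes> e"
    unfolding e_eq using e'_eq s1.carr s2.carr d by (simp only: s1.m_assoc s1.m_closed)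
  also have "\<dots> = d \<otimes> (f \<otimes> e)" using d e_carr s1.carr by (simp only: s1.m_assoc d(2))
  finally show ?thesis using f_e by simp
qed

text \<open>Multiplying \<open>e'\<close> by \<open>d\<close> on the right can be undone, so
  \<open>e' \<otimes> d\<close> stays in the R-class of \<open>e'\<close>.\<close>

lemma e'_right: "\<exists>u\<in>carrier G. e' = e' \<otimes> d \<otimes> u"
proof
  let ?u = "r \<otimes> f \<otimes> l \<otimes> y2"
  show "?u \<in> carrier G" using s1.carr s2.carr by simp
  have "?u = e \<otimes> ?u"
  proof -
    have "e \<otimes> ?u = (e \<otimes> r) \<otimes> f \<otimes> l \<otimes> y2"
      using s1.carr s2.carr e_carr by (simp only: s1.m_assoc s1.m_closed)
    then show ?thesis using e_r by simp
  qed
  then have "e' = f \<otimes> d \<otimes> (e \<otimes> ?u)"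
    using e'_eq s1.carr s2.carr d(1) by (simp add: s1.m_assoc)
  also have "\<dots> = f \<otimes> (d \<otimes> e) \<otimes> ?u" using s1.carr s2.carr d(1) e_carr by (simp only: s1.m_assoc s1.m_closed)
  also have "\<dots> = (f \<otimes> e') \<otimes> d \<otimes> ?u"
    unfolding e'_d[symmetric] using s1.carr s2.carr d(1) sw.e_carr by (simp only: s1.m_assoc s1.m_closed)
  finally show "e' = e' \<otimes> d \<otimes> ?u" unfolding sw.f_e .
qed

lemma e_left: "\<exists>u\<in>carrier G. e = u \<otimes> d"
proof
  show "r \<otimes> f \<otimes> l \<otimes> y2 \<otimes> f \<in> carrier G" using s1.carr s2.carr by simp
  show "e = r \<otimes> f \<otimes> l \<otimes> y2 \<otimes> f \<otimes> d"
    unfolding e_eq using s1.carr s2.carr d by (simp only: s1.m_assoc s1.m_closed)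
qed

end

section \<open>From cycles to merging\<close>

context monoid
begin

lemma twist_prefix:
  assumes z: "\<And>i. z i \<in> carrier G" and w: "\<And>n. w n \<in> carrier G \<times> carrier G"
    and step: "\<And>n. w (Suc n) = (triple G (fst (w n)) (z n) (snd (w n)), triple G (snd (w n)) (z n) (fst (w n)))"
  shows "\<exists>u\<in>carrier G. fst (w (m + k)) = fst (w m) \<otimes> u"
    and "\<exists>u\<in>carrier G. snd (w (m + k)) = snd (w m) \<otimes> u"
proof -
  have c: "fst (w n) \<in> carrier G" "snd (w n) \<in> carrier G" for n using w[of n] by auto
  have "(\<exists>u\<in>carrier G. fst (w (m + k)) = fst (w m) \<otimes> u) \<and> (\<exists>u\<in>carrier G. snd (w (m + k)) = snd (w m) \<otimes> u)"
  proof (induction k)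
    case 0
    then show ?case using c by (auto intro!: bexI[of _ \<one>])
  next
    case (Suc k)
    then obtain u u' where u: "u \<in> carrier G" "fst (w (m + k)) = fst (w m) \<otimes> u"
      "u' \<in> carrier G" "snd (w (m + k)) = snd (w m) \<otimes> u'" by blast
    have "fst (w (m + Suc k)) = fst (w m) \<otimes> (u \<otimes> z (m + k) \<otimes> snd (w (m + k)))"
      using u(1,2) c z by (simp add: step triple_def m_assoc)
    moreover have "snd (w (m + Suc k)) = snd (w m) \<otimes> (u' \<otimes> z (m + k) \<otimes> fst (w (m + k)))"
      using u(3,4) c z by (simp add: step triple_def m_assoc)
    moreover have "u \<otimes> z (m + k) \<otimes> snd (w (m + k)) \<in> carrier G" "u' \<otimes> z (m + k) \<otimes> fst (w (m + k)) \<in> carrier G"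
      using u c z by simp_all
    ultimately show ?case by blast
  qed
  then show "\<exists>u\<in>carrier G. fst (w (m + k)) = fst (w m) \<otimes> u"
    "\<exists>u\<in>carrier G. snd (w (m + k)) = snd (w m) \<otimes> u" by simp_all
qed

text \<open>A step makes each word end in the previous value of the other one. The words therefore
  end in each other's earlier values at odd distances, and in their own at even distances.\<close>

lemma twist_suffix:
  assumes z: "\<And>i. z i \<in> carrier G" and w: "\<And>n. w n \<in> carrier G \<times> carrier G"
    and step: "\<And>n. w (Suc n) = (triple G (fst (w n)) (z n) (snd (w n)), triple G (snd (w n)) (z n) (fst (w n)))"
  shows "\<exists>u\<in>carrier G. fst (w (m + (2 * k + 1))) = u \<otimes> snd (w m)"
    and "\<exists>u\<in>carrier G. snd (w (m + (2 * k + 1))) = u \<otimes> fst (w m)"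
proof -
  have c: "fst (w n) \<in> carrier G" "snd (w n) \<in> carrier G" for n using w[of n] by auto
  have one: "\<exists>u\<in>carrier G. fst (w (Suc n)) = u \<otimes> snd (w n)" "\<exists>u\<in>carrier G. snd (w (Suc n)) = u \<otimes> fst (w n)" for n
    using c z unfolding step triple_def fst_conv snd_conv by blast+
  have "(\<exists>u\<in>carrier G. fst (w (m + (2 * k + 1))) = u \<otimes> snd (w m)) \<and>
    (\<exists>u\<in>carrier G. snd (w (m + (2 * k + 1))) = u \<otimes> fst (w m))"
  proof (induction k)
    case 0
    then show ?case using one[of m] by simp
  next
    case (Suc k)
    let ?n = "m + (2 * k + 1)"
    have n: "m + (2 * Suc k + 1) = Suc (Suc ?n)" by simp
    obtain u u' where u: "u \<in> carrier G" "fst (w ?n) = u \<otimes> snd (w m)"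
      "u' \<in> carrier G" "snd (w ?n) = u' \<otimes> fst (w m)" using Suc by blast
    obtain a a' where a: "a \<in> carrier G" "fst (w (Suc ?n)) = a \<otimes> snd (w ?n)"
      "a' \<in> carrier G" "snd (w (Suc ?n)) = a' \<otimes> fst (w ?n)" using one[of ?n] by blast
    obtain b b' where b: "b \<in> carrier G" "fst (w (Suc (Suc ?n))) = b \<otimes> snd (w (Suc ?n))"
      "b' \<in> carrier G" "snd (w (Suc (Suc ?n))) = b' \<otimes> fst (w (Suc ?n))" using one[of "Suc ?n"] by blast
    have "fst (w (Suc (Suc ?n))) = (b \<otimes> a' \<otimes> u) \<otimes> snd (w m)"
      unfolding b a u using a b u c by (simp only: m_assoc m_closed)
    moreover have "snd (w (Suc (Suc ?n))) = (b' \<otimes> a \<otimes> u') \<otimes> fst (w m)"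
      unfolding b a u using a b u c by (simp only: m_assoc m_closed)
    moreover have "b \<otimes> a' \<otimes> u \<in> carrier G" "b' \<otimes> a \<otimes> u' \<in> carrier G" using a b u by simp_all
    ultimately show ?case unfolding n by blast
  qed
  then show "\<exists>u\<in>carrier G. fst (w (m + (2 * k + 1))) = u \<otimes> snd (w m)"
    "\<exists>u\<in>carrier G. snd (w (m + (2 * k + 1))) = u \<otimes> fst (w m)" by simp_all
qed

text \<open>Suffixes call for an odd distance from \<open>Suc n\<close>. Going around the cycle
  twice gives the distance 2p - 1, which is odd for every \<open>p\<close>; for prefixes one round
  suffices.\<close>

lemma twist_recurrent_step:
  assumes te: "thue_engel G" and z: "\<And>i. z i \<in> carrier G" and w: "\<And>n. w n \<in> carrier G \<times> carrier G"
    and step: "\<And>n. w (Suc n) = (triple G (fst (w n)) (z n) (snd (w n)), triple G (snd (w n)) (z n) (fst (w n)))"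
    and per: "w (n + p) = w n" "w (n + 2 * p) = w n" "p > 0"
  shows "\<exists>y v y' v'. recurrent_step G (fst (w n)) (z n) (snd (w n)) y v y' v'"
proof -
  have c: "fst (w n) \<in> carrier G" "snd (w n) \<in> carrier G" for n using w[of n] by auto
  obtain q where q: "p = Suc q" using per(3) gr0_implies_Suc by blast
  have p: "Suc n + q = n + p" "Suc n + (2 * q + 1) = n + 2 * p" by (simp_all add: q)
  obtain y where y: "y \<in> carrier G" "fst (w (Suc n + q)) = fst (w (Suc n)) \<otimes> y"
    using twist_prefix(1)[of z w "Suc n" q, OF z w step] by blast
  obtain y' where y': "y' \<in> carrier G" "snd (w (Suc n + q)) = snd (w (Suc n)) \<otimes> y'"
    using twist_prefix(2)[of z w "Suc n" q, OF z w step] by blast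
  obtain v where v: "v \<in> carrier G" "snd (w (Suc n + (2 * q + 1))) = v \<otimes> fst (w (Suc n))"
    using twist_suffix(2)[of z w "Suc n" q, OF z w step] by blast
  obtain v' where v': "v' \<in> carrier G" "fst (w (Suc n + (2 * q + 1))) = v' \<otimes> snd (w (Suc n))"
    using twist_suffix(1)[of z w "Suc n" q, OF z w step] by blast
  have "recurrent_step G (fst (w n)) (z n) (snd (w n)) y v y' v'"
  proof (unfold_locales)
    show "fst (w n) = fst (w n) \<otimes> z n \<otimes> snd (w n) \<otimes> y"
      using y(2) unfolding p per step by (simp add: triple_def)
    show "snd (w n) = snd (w n) \<otimes> z n \<otimes> fst (w n) \<otimes> y'"
      using y'(2) unfolding p per step by (simp add: triple_def)
    show "snd (w n) = v \<otimes> fst (w n) \<otimes> z n \<otimes> snd (w n)"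
      using v(2) c z v(1) unfolding p per step by (simp add: triple_def m_assoc)
    show "fst (w n) = v' \<otimes> snd (w n) \<otimes> z n \<otimes> fst (w n)"
      using v'(2) c z v'(1) unfolding p per step by (simp add: triple_def m_assoc)
  qed (use te c z y y' v v' in simp_all)
  then show ?thesis by blast
qed

text \<open>
  If the idempotents differ, then the values of the iteration on \<open>e', d\<close> are \<open>e' d\<^sup>M\<close> and \<open>e d\<^sup>M\<close>,
  where \<open>M\<close> satisfies \<open>M (n + 1) = 2 M n + n\<close>: each step moves an idempotent past the power
  \<open>d\<^bsup>M n + n\<^esup>\<close>, and exchanges it since \<open>M n + n = 2\<^bsup>n+1\<^esup> - 1\<close> is odd.
\<close>

lemma thue_engel_merges_powers_step:
  assumes fin: "finite (carrier G)" and te: "thue_engel G" and dd: "d \<in> carrier G"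
    and ds: "double_step G l f r y v y' v' d y2 v2 y2' v2'" and n: "f = d [^] (n :: nat)"
    and grp: "\<And>(K :: 'a monoid) z a b. \<lbrakk>group K; finite (carrier K); thue_engel K;
        \<And>i. z i \<in> carrier K; a \<in> carrier K; b \<in> carrier K\<rbrakk> \<Longrightarrow> merges (triple K) z (a, b)"
  shows "merges (triple G) (\<lambda>i. d [^] (n + i)) (l, r)"
proof -
  interpret double_step G l f r y v y' v' d y2 v2 y2' v2' by fact
  \<comment> \<open>From here on \<open>?e\<close> is the left identity of \<open>l\<close> and
    \<open>?e'\<close> that of \<open>r\<close>.\<close>
  let ?e = e' and ?e' = e
  have e: "?e \<in> carrier G" "?e \<otimes> ?e = ?e" "?e' \<in> carrier G" "?e' \<otimes> ?e' = ?e'"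
    using e_carr e_idem sw.e_carr sw.e_idem by simp_all
  have ed: "?e \<otimes> d = d \<otimes> ?e'" "?e' \<otimes> d = d \<otimes> ?e" using e'_d sw.e'_d by simp_all
  \<comment> \<open>Every factor \<open>d\<close> exchanges the idempotents, so only the parity of
    the exponent matters.\<close>
  have ed_pow: "?e \<otimes> d [^] k = d [^] k \<otimes> (if even k then ?e else ?e') \<and>
      ?e' \<otimes> d [^] k = d [^] k \<otimes> (if even k then ?e' else ?e)" for k :: nat
  proof (induction k)
    case (Suc k)
    have "x \<otimes> d [^] Suc k = d [^] Suc k \<otimes> x''"
      if "x \<otimes> d [^] k = d [^] k \<otimes> x'" "x' \<otimes> d = d \<otimes> x''" "x \<in> carrier G" "x' \<in> carrier G" "x'' \<in> carrier G" for x x' x''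
    proof -
      have "x \<otimes> d [^] Suc k = (x \<otimes> d [^] k) \<otimes> d" using that(3-5) dd by (simp add: m_assoc)
      also have "\<dots> = d [^] k \<otimes> (x' \<otimes> d)" unfolding that(1) using that(3-5) dd by (simp add: m_assoc)
      finally have "x \<otimes> d [^] Suc k = d [^] k \<otimes> (d \<otimes> x'')" unfolding that(2) .
      then show ?thesis using that(3-5) dd by (simp add: m_assoc)
    qed
    from this[OF conjunct1[OF Suc]] this[OF conjunct2[OF Suc]] show ?case using ed e by auto
  qed (use e in simp)
  show ?thesis
  proof (cases "?e = ?e'")
    case True
    then have e'e: "?e' = ?e" by simp
    \<comment> \<open>With a single idempotent, \<open>l\<close>, \<open>r\<close> and
      \<open>?e \<otimes> d\<close> all lie in its maximal subgroup, and the statement becomes one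
      about a run in a finite group.\<close>
    let ?K = "local_group ?e"
    have K: "group ?K" by (rule group_local_group[OF e(1,2)])
    have de: "?e \<otimes> d = d \<otimes> ?e" using ed(1) unfolding e'e .
    have l: "l \<in> carrier ?K"
    proof (rule local_groupI[OF e(1,2)])
      show "?e \<otimes> l = l" by (rule sw.e_r)
      show "l \<otimes> ?e = l" using l_e unfolding e'e .
      show "?e = l \<otimes> (y' \<otimes> f)" unfolding sw.e_def using s1.carr by (simp add: m_assoc)
      have "?e' = (f \<otimes> v) \<otimes> l" by (rule e_eqs(3))
      then show "?e = (f \<otimes> v) \<otimes> l" unfolding e'e .
    qed (use s1.carr in simp_all)
    have r: "r \<in> carrier ?K"
    proof (rule local_groupI[OF e(1,2)])
      show "?e \<otimes> r = r" using e_r unfolding e'e .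
      show "r \<otimes> ?e = r" by (rule sw.l_e)
      have "?e' = r \<otimes> (y \<otimes> f)" unfolding e_def using s1.carr by (simp add: m_assoc)
      then show "?e = r \<otimes> (y \<otimes> f)" unfolding e'e .
      show "?e = (f \<otimes> v') \<otimes> r" by (rule sw.e_eqs(3))
    qed (use s1.carr in simp_all)
    obtain u v0 where u: "u \<in> carrier G" "?e = ?e \<otimes> d \<otimes> u" and v0: "v0 \<in> carrier G" "?e = v0 \<otimes> d"
      using e'_right sw.e_left by blast
    have "?e \<otimes> d \<in> carrier ?K"
    proof (rule local_groupI[OF e(1,2)])
      have "?e \<otimes> (?e \<otimes> d) = (?e \<otimes> ?e) \<otimes> d" using e(1) dd by (simp only: m_assoc)
      then show eed: "?e \<otimes> (?e \<otimes> d) = ?e \<otimes> d" unfolding e(2) .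
      have "?e \<otimes> d \<otimes> ?e = ?e \<otimes> (d \<otimes> ?e)" using e(1) dd by (simp only: m_assoc)
      then show "?e \<otimes> d \<otimes> ?e = ?e \<otimes> d" unfolding de[symmetric] eed .
      have "v0 \<otimes> (?e \<otimes> d) = (v0 \<otimes> d) \<otimes> ?e" unfolding de using e(1) v0(1) dd by (simp only: m_assoc)
      then show "?e = v0 \<otimes> (?e \<otimes> d)" unfolding v0(2)[symmetric] e(2) by (rule sym)
    qed (use u v0 e dd in simp_all)
    moreover have "thue_engel ?K" by (rule thue_engel_local_group[OF e(1,2) te])
    moreover have "finite (carrier ?K)"
      by (rule finite_subset[OF _ fin]) (use local_groupD(1)[OF e(1,2)] in blast)
    ultimately have "merges (triple ?K) (\<lambda>i. (?e \<otimes> d) [^]\<^bsub>?K\<^esub> (n + i)) (l, r)"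
      using K l r by (intro grp) (simp_all add: monoid.nat_pow_closed group.is_monoid)
    then show ?thesis
      using merges_local_group[OF e(1,2) dd de \<open>?e \<otimes> d \<in> carrier ?K\<close> l r, of "\<lambda>i. n + i"] by simp
  next
    case False
    define z where "z i = d [^] (i - 1 :: nat)" for i
    \<comment> \<open>The value \<open>M 0 = 1\<close> comes from the first step, which leads from
      \<open>(?e, d)\<close> to \<open>(?e \<otimes> d, ?e' \<otimes> d)\<close>.\<close>
    define M where "M n = 2 ^ Suc n - 1 - n" for n :: nat
    have M: "M n + n = 2 ^ Suc n - 1" "M (Suc n) = 2 * M n + n" for n
    proof -
      have "n + 1 \<le> 2 ^ Suc n" using less_exp[of "Suc n"] by simp
      then show "M n + n = 2 ^ Suc n - 1" "M (Suc n) = 2 * M n + n" by (simp_all add: M_def)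
    qed
    have odd: "odd (M n + n)" for n unfolding M by simp
    have prod: "(x \<otimes> d [^] i) \<otimes> d [^] j \<otimes> (x' \<otimes> d [^] i) = x \<otimes> d [^] (2 * i + j)"
      if x: "x \<in> carrier G" "x' \<in> carrier G" "x \<otimes> x = x" "x \<otimes> d [^] (i + j) = d [^] (i + j) \<otimes> x'"
      for x x' and i j :: nat
    proof -
      have "(x \<otimes> d [^] i) \<otimes> d [^] j \<otimes> (x' \<otimes> d [^] i) = x \<otimes> (d [^] i \<otimes> d [^] j \<otimes> x') \<otimes> d [^] i"
        using x(1,2) dd by (simp add: m_assoc)
      also have "d [^] i \<otimes> d [^] j \<otimes> x' = x \<otimes> d [^] (i + j)" using x(4) dd by (simp add: nat_pow_mult)
      also have "x \<otimes> (x \<otimes> d [^] (i + j)) \<otimes> d [^] i = (x \<otimes> x) \<otimes> (d [^] (i + j) \<otimes> d [^] i)"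
        using x(1) dd by (simp add: m_assoc)
      also have "\<dots> = x \<otimes> d [^] (2 * i + j)"
        unfolding x(3) using dd by (simp add: nat_pow_mult mult_2 add.commute add.left_commute)
      finally show ?thesis .
    qed
    have w: "twist (triple G) z (?e, d) (Suc k) = (?e \<otimes> d [^] M k, ?e' \<otimes> d [^] M k)" for k
    proof (induction k)
      case 0
      then show ?case using e dd ed by (simp add: triple_def z_def M_def)
    next
      case (Suc k)
      have "?e \<otimes> d [^] (M k + k) = d [^] (M k + k) \<otimes> ?e'" "?e' \<otimes> d [^] (M k + k) = d [^] (M k + k) \<otimes> ?e"
        using ed_pow[of "M k + k"] odd[of k] by simp_all
      from prod[OF e(1,3,2) this(1)] prod[OF e(3,1,4) this(2)] Suc show ?case
        by (simp add: triple_def z_def M(2))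
    qed
    have "merges (triple G) z (?e, d)" using te e dd by (simp add: thue_engel_def z_def[abs_def])
    then have "merges (triple G) (\<lambda>i. z (1 + i)) (twist (triple G) z (?e, d) 1)" by (simp only: merges_shift)
    then obtain k where "fst (twist (triple G) z (?e, d) (1 + k)) = snd (twist (triple G) z (?e, d) (1 + k))"
      unfolding merges_def twist_add[symmetric] by blast
    then have eq: "?e \<otimes> d [^] M k = ?e' \<otimes> d [^] M k" using w by simp
    \<comment> \<open>Right multiplication by powers of \<open>d\<close> can be undone one factor at
      a time: the idempotent is moved across the earlier factors to meet the last one.\<close>
    have inv: "(\<exists>u\<in>carrier G. ?e = ?e \<otimes> d [^] j \<otimes> u) \<and> (\<exists>u\<in>carrier G. ?e' = ?e' \<otimes> d [^] j \<otimes> u)" for j :: nat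
    proof (induction j)
      case 0
      then show ?case using e by (auto intro!: bexI[of _ \<one>])
    next
      case (Suc j)
      have "\<exists>u\<in>carrier G. x = x \<otimes> d [^] Suc j \<otimes> u"
        if "x \<otimes> d [^] j = d [^] j \<otimes> x'" "x \<in> carrier G" "x' \<in> carrier G"
          and ex: "\<exists>u\<in>carrier G. x = x \<otimes> d [^] j \<otimes> u" "\<exists>u\<in>carrier G. x' = x' \<otimes> d \<otimes> u" for x x'
      proof -
        obtain u u' where u: "u \<in> carrier G" "x = x \<otimes> d [^] j \<otimes> u" "u' \<in> carrier G" "x' = x' \<otimes> d \<otimes> u'"
          using ex by blast
        have "x \<otimes> d [^] Suc j \<otimes> u' = (x \<otimes> d [^] j) \<otimes> d \<otimes> u'" using that(2,3) u(1,3) dd by (simp add: m_assoc)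
        also have "\<dots> = d [^] j \<otimes> (x' \<otimes> d \<otimes> u')" unfolding that(1) using that(2,3) u(1,3) dd by (simp add: m_assoc)
        also have "\<dots> = x \<otimes> d [^] j" unfolding u(4)[symmetric] that(1) ..
        finally have "x \<otimes> d [^] Suc j \<otimes> (u' \<otimes> u) = x \<otimes> d [^] j \<otimes> u"
          using that(2) u(1,3) dd by (simp only: m_assoc nat_pow_closed m_closed flip: m_assoc)
        then show ?thesis using u by (metis m_closed)
      qed
      from this[OF conjunct1[OF ed_pow]] this[OF conjunct2[OF ed_pow]] Suc e e'_right sw.e'_right
      show ?case by (auto split: if_splits)
    qed
    obtain u u' where u: "u \<in> carrier G" "?e = ?e \<otimes> d [^] M k \<otimes> u"
      "u' \<in> carrier G" "?e' = ?e' \<otimes> d [^] M k \<otimes> u'" using inv by blast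
    \<comment> \<open>Merging at exponent \<open>M k\<close> puts \<open>x\<close> into the right
      ideal generated by the idempotent \<open>x'\<close>, which then absorbs it. Applied both ways,
      this makes the two idempotents R-related.\<close>
    have abs: "x' \<otimes> x = x" if "x = x \<otimes> d [^] M k \<otimes> u" "x \<otimes> d [^] M k = x' \<otimes> d [^] M k" "x' \<otimes> x' = x'"
      "u \<in> carrier G" "x \<in> carrier G" "x' \<in> carrier G" for x x' u
    proof -
      have x: "x = x' \<otimes> d [^] M k \<otimes> u" using that(1,2) by simp
      have "x' \<otimes> x = (x' \<otimes> x') \<otimes> d [^] M k \<otimes> u"
        by (subst x) (use that(4-6) dd in \<open>simp add: m_assoc\<close>)
      then show ?thesis unfolding that(3) using x by simp
    qed
    have "?e' \<otimes> ?e = ?e" using abs[OF u(2) eq e(4) u(1) e(1,3)] .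
    moreover have "?e \<otimes> ?e' = ?e'" using abs[OF u(4) eq[symmetric] e(2) u(3) e(3,1)] .
    ultimately have "?e = ?e'" by (intro thue_R_trivial[OF te e(1,3)])
    then show ?thesis using False by simp
  qed
qed

end

text \<open>The full Engel condition: start and middle element are independent here. The run is
  examined on its cycle, at a time when the middle factor is an idempotent power of
  \<open>d\<close>.\<close>

lemma thue_engel_merges_powers:
  fixes G :: "'a monoid"
  assumes "monoid G" and fin: "finite (carrier G)" and te: "thue_engel G"
    and carr: "a \<in> carrier G" "b \<in> carrier G" "d \<in> carrier G"
  shows "merges (triple G) (\<lambda>i. d [^]\<^bsub>G\<^esub> (i - 1)) (a, b)"
proof -
  interpret monoid G by fact
  define z where "z i = d [^]\<^bsub>G\<^esub> (i - 1)" for i :: nat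
  define w where "w = twist (triple G) z (a, b)"
  have z: "z i \<in> carrier G" for i using carr by (simp add: z_def)
  have w: "w n \<in> carrier G \<times> carrier G" for n
    unfolding w_def by (rule twist_in) (use carr z in \<open>auto simp: triple_def\<close>)
  have step: "w (Suc n) = (triple G (fst (w n)) (z n) (snd (w n)), triple G (snd (w n)) (z n) (fst (w n)))" for n
    by (simp add: w_def split: prod.splits)
  have zS: "z (Suc (Suc n)) = z (Suc n) \<otimes>\<^bsub>G\<^esub> d" for n by (simp add: z_def)
  \<comment> \<open>The words together with the current middle factor determine their successor only
    from index 1 on: \<open>z 0\<close> and \<open>z 1\<close> are both the identity, and the
    multiplication by \<open>d\<close> begins after that.\<close>
  have "finite (range (\<lambda>n. (w (Suc n), z (Suc n))))"
    by (rule finite_subset[of _ "(carrier G \<times> carrier G) \<times> carrier G"])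
      (intro image_subsetI SigmaI w z finite_cartesian_product fin)+
  then have "\<not> inj (\<lambda>n. (w (Suc n), z (Suc n)))" using finite_imageD by fastforce
  then obtain i j where ij: "w (Suc i) = w (Suc j)" "z (Suc i) = z (Suc j)" "i < j"
    unfolding inj_on_def by (metis linorder_neqE Pair_inject)
  then obtain p where p: "p > 0" "j = i + p" by (metis less_imp_add_positive)
  have per0: "w (Suc (i + k) + p) = w (Suc (i + k)) \<and> z (Suc (i + k) + p) = z (Suc (i + k))" for k
  proof (induction k)
    case (Suc k)
    then show ?case by (simp add: step zS)
  qed (use ij p in \<open>simp add: add.commute\<close>)
  have per1: "w (n + p) = w n" if n: "n > i" for n
  proof -
    obtain k where "n = Suc (i + k)" using less_imp_Suc_add[OF n] by blast
    then show ?thesis using per0[of k] by simp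
  qed
  have per2: "w (n + 2 * p) = w n" if "n > i" for n
    using per1[OF that] per1[of "n + p"] that by (simp add: mult_2 add.assoc)
  obtain q where q: "q > 0" "d [^]\<^bsub>G\<^esub> q \<otimes>\<^bsub>G\<^esub> d [^]\<^bsub>G\<^esub> q = d [^]\<^bsub>G\<^esub> (q :: nat)"
    using idempotent_power[OF fin carr(3)] by blast
  \<comment> \<open>A multiple of the idempotent exponent \<open>q\<close> beyond the preperiod
    \<open>i\<close>. At time \<open>Suc m\<close> the run is on its cycle and its middle factor is
    the idempotent d^m.\<close>
  define m where "m = q * Suc i"
  have "1 * Suc i \<le> m" unfolding m_def by (rule mult_le_mono1) (use q(1) in simp)
  then have m: "m > i" by simp
  have idem: "d [^]\<^bsub>G\<^esub> m \<otimes>\<^bsub>G\<^esub> d [^]\<^bsub>G\<^esub> m = d [^]\<^bsub>G\<^esub> m"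
  proof -
    have "d [^]\<^bsub>G\<^esub> (q * Suc k) = d [^]\<^bsub>G\<^esub> q" for k
      by (induction k) (use q(2) carr in \<open>simp_all add: nat_pow_mult[symmetric]\<close>)
    then show ?thesis using q(2) unfolding m_def by simp
  qed
  obtain l r where lr: "w (Suc m) = (l, r)" by fastforce
  have lrG: "l \<in> carrier G" "r \<in> carrier G" using w[of "Suc m"] lr by auto
  have zm: "z (Suc m) = d [^]\<^bsub>G\<^esub> m" "z (Suc (Suc m)) = d [^]\<^bsub>G\<^esub> m \<otimes>\<^bsub>G\<^esub> d" by (simp_all add: z_def)
  have "\<exists>y v y' v'. recurrent_step G (fst (w k)) (z k) (snd (w k)) y v y' v'" if "k > i" for k
    using twist_recurrent_step[of z w k p, OF te z w step per1[OF that] per2[OF that] p(1)] .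
  note ex = this[of "Suc m"] this[of "Suc (Suc m)"]
  from ex(1) obtain y v y' v' where s1: "recurrent_step G l (d [^]\<^bsub>G\<^esub> m) r y v y' v'"
    using m lr zm(1) by auto
  from ex(2) obtain y2 v2 y2' v2' where "recurrent_step G (fst (w (Suc (Suc m)))) (z (Suc (Suc m))) (snd (w (Suc (Suc m)))) y2 v2 y2' v2'"
    using m less_SucI by blast
  then have s2: "recurrent_step G (l \<otimes>\<^bsub>G\<^esub> d [^]\<^bsub>G\<^esub> m \<otimes>\<^bsub>G\<^esub> r) (d [^]\<^bsub>G\<^esub> m \<otimes>\<^bsub>G\<^esub> d) (r \<otimes>\<^bsub>G\<^esub> d [^]\<^bsub>G\<^esub> m \<otimes>\<^bsub>G\<^esub> l) y2 v2 y2' v2'"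
    unfolding zm(2) step[of "Suc m"] by (simp add: lr zm triple_def)
  have ds: "double_step G l (d [^]\<^bsub>G\<^esub> m) r y v y' v' d y2 v2 y2' v2'"
    using s1 s2 idem carr(3) nat_pow_comm[of d m 1]
    by (simp add: double_step_def double_step_axioms_def)
  have "merges (triple G) (\<lambda>i. d [^]\<^bsub>G\<^esub> (m + i)) (l, r)"
    by (rule thue_engel_merges_powers_step[OF fin te carr(3) ds refl thue_engel_merges])
  moreover have "(\<lambda>i. d [^]\<^bsub>G\<^esub> (m + i)) = (\<lambda>i. z (Suc m + i))" by (simp add: z_def)
  ultimately have "merges (triple G) (\<lambda>i. z (Suc m + i)) (twist (triple G) z (a, b) (Suc m))"
    using lr by (simp add: w_def)
  then have "merges (triple G) z (a, b)" by (simp only: merges_shift)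
  then show ?thesis by (simp add: z_def[abs_def])
qed

section \<open>Semigroups with an adjoined identity\<close>

text \<open>
  Here the identity is adjoined even if \<open>S\<close> has one already. This does not change products that
  contain a factor from \<open>S\<close>, and it makes \<open>S \<mapsto> S\<^sup>1\<close> compatible with homomorphisms.
\<close>

definition with_one :: "'a sgrp \<Rightarrow> 'a option monoid" where
  "with_one S = \<lparr>carrier = insert None (Some ` carrier S), mult = mult (adjoin_one S), one = None\<rparr>"

lemma with_one_simps [simp]:
  "carrier (with_one S) = insert None (Some ` carrier S)"
  "\<one>\<^bsub>with_one S\<^esub> = None"
  "None \<otimes>\<^bsub>with_one S\<^esub> v = v"
  "u \<otimes>\<^bsub>with_one S\<^esub> None = u"
  "Some a \<otimes>\<^bsub>with_one S\<^esub> Some b = Some (a \<cdot>\<^bsub>S\<^esub> b)"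
  by (simp_all add: with_one_def adjoin_one_def split: option.split)

lemma mult_adjoin_one: "mult (adjoin_one S) = mult (with_one S)"
  by (simp add: with_one_def)

lemma (in sgroup) monoid_with_one: "monoid (with_one S)"
  by (rule monoidI) (auto simp: smult_closed smult_assoc)

lemma twist_with_one:
  "twist (triple (with_one S)) (\<lambda>i. z (Suc i)) (Some x, Some y) n = (Some (lam S x y z n), Some (rho S x y z n))"
  by (induction n) (auto simp: triple_def mult_adjoin_one split: option.split, (case_tac "z (Suc n)"; simp)+)

lemma lam_rho_merge:
  "lam S x y z n = rho S x y z n \<longleftrightarrow>
    fst (twist (triple (with_one S)) (\<lambda>i. z (Suc i)) (Some x, Some y) n) =
    snd (twist (triple (with_one S)) (\<lambda>i. z (Suc i)) (Some x, Some y) n)"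
  by (simp add: twist_with_one)

context sgroup
begin

lemma one_adjoin_cases:
  obtains "\<one>\<^bsub>adjoin_one S\<^esub> = None" | e where "\<one>\<^bsub>adjoin_one S\<^esub> = Some e" "is_identity S e"
proof (cases "\<exists>e. is_identity S e")
  case True
  then obtain e where e: "is_identity S e" by blast
  have "(THE e. is_identity S e) = e"
  proof (rule the_equality[of "is_identity S", OF e])
    fix e' assume "is_identity S e'"
    then show "e' = e" using e unfolding is_identity_def by metis
  qed
  then show ?thesis using that(2)[of e] e True by (simp add: adjoin_one_def)
qed (use that in \<open>simp add: adjoin_one_def\<close>)

lemma mult_one_adjoin:
  assumes "a \<in> carrier S"
  shows "Some a \<otimes>\<^bsub>with_one S\<^esub> \<one>\<^bsub>adjoin_one S\<^esub> = Some a" "\<one>\<^bsub>adjoin_one S\<^esub> \<otimes>\<^bsub>with_one S\<^esub> Some a = Some a"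
  by (cases rule: one_adjoin_cases; use assms in \<open>simp add: is_identity_def\<close>)+

lemma one_adjoin_mult_one: "\<one>\<^bsub>adjoin_one S\<^esub> \<otimes>\<^bsub>with_one S\<^esub> \<one>\<^bsub>adjoin_one S\<^esub> = \<one>\<^bsub>adjoin_one S\<^esub>"
  by (cases rule: one_adjoin_cases) (simp_all add: is_identity_def)

lemma one_adjoin_closed: "\<one>\<^bsub>adjoin_one S\<^esub> \<in> carrier (adjoin_one S)" "\<one>\<^bsub>adjoin_one S\<^esub> \<in> carrier (with_one S)"
  by (cases rule: one_adjoin_cases; auto simp: is_identity_def adjoin_one_def split: if_splits)+

lemma carrier_adjoin_one: "carrier (adjoin_one S) \<subseteq> carrier (with_one S)" "Some ` carrier S \<subseteq> carrier (adjoin_one S)"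
  by (auto simp: adjoin_one_def split: if_splits)

lemma pow_one_adjoin: "\<one>\<^bsub>adjoin_one S\<^esub> [^]\<^bsub>adjoin_one S\<^esub> (n::nat) = \<one>\<^bsub>adjoin_one S\<^esub>"
  by (induction n) (simp_all add: nat_pow_def mult_adjoin_one one_adjoin_mult_one)

text \<open>The two monoids may start their powers from different identities; a factor from
  \<open>S\<close> on the left absorbs the difference.\<close>

lemma pow_adjoin:
  assumes c: "c \<in> carrier (with_one S)" and a: "a \<in> carrier S"
  shows "c [^]\<^bsub>adjoin_one S\<^esub> (n::nat) \<in> carrier (with_one S) \<and>
    Some a \<otimes>\<^bsub>with_one S\<^esub> c [^]\<^bsub>adjoin_one S\<^esub> n = Some a \<otimes>\<^bsub>with_one S\<^esub> c [^]\<^bsub>with_one S\<^esub> n"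
proof -
  interpret W: monoid "with_one S" by (rule monoid_with_one)
  have aW: "Some a \<in> carrier (with_one S)" using a by simp
  show ?thesis
  proof (induction n)
    case 0
    then show ?case using one_adjoin_closed mult_one_adjoin[OF a] by (simp add: nat_pow_def del: with_one_simps(1))
  next
    case (Suc n)
    have e: "c [^]\<^bsub>adjoin_one S\<^esub> Suc n = c [^]\<^bsub>adjoin_one S\<^esub> n \<otimes>\<^bsub>with_one S\<^esub> c"
      by (simp add: nat_pow_def mult_adjoin_one)
    have "Some a \<otimes>\<^bsub>with_one S\<^esub> (c [^]\<^bsub>adjoin_one S\<^esub> n \<otimes>\<^bsub>with_one S\<^esub> c) =
        (Some a \<otimes>\<^bsub>with_one S\<^esub> c [^]\<^bsub>adjoin_one S\<^esub> n) \<otimes>\<^bsub>with_one S\<^esub> c"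
      using Suc aW c by (intro W.m_assoc[symmetric]) blast+
    also have "\<dots> = Some a \<otimes>\<^bsub>with_one S\<^esub> (c [^]\<^bsub>with_one S\<^esub> n \<otimes>\<^bsub>with_one S\<^esub> c)"
      unfolding conjunct2[OF Suc] using aW c by (intro W.m_assoc W.nat_pow_closed)
    finally show ?case unfolding e using Suc c W.m_closed by simp
  qed
qed

text \<open>The words stay in \<open>S\<close>, so a middle factor enters only through its products
  with elements of \<open>S\<close> on the left.\<close>

lemma twist_with_one_cong:
  assumes "\<And>i a. a \<in> carrier S \<Longrightarrow> Some a \<otimes>\<^bsub>with_one S\<^esub> z i = Some a \<otimes>\<^bsub>with_one S\<^esub> z' i"
    and z: "\<And>i. z i \<in> carrier (with_one S)" and xy: "x \<in> carrier S" "y \<in> carrier S"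
  shows "twist (triple (with_one S)) z (Some x, Some y) n = twist (triple (with_one S)) z' (Some x, Some y) n"
proof -
  interpret W: monoid "with_one S" by (rule monoid_with_one)
  have "twist (triple (with_one S)) z' (map_prod (\<lambda>x. x) (\<lambda>x. x) (Some x, Some y)) n =
      map_prod (\<lambda>x. x) (\<lambda>x. x) (twist (triple (with_one S)) z (Some x, Some y) n)"
  proof (rule twist_hom[where A = "Some ` carrier S"])
    fix l k r assume lr: "l \<in> Some ` carrier S" "r \<in> Some ` carrier S"
    then show "triple (with_one S) l (z k) r = triple (with_one S) l (z' k) r" using assms(1) by (auto simp: triple_def)
    show "triple (with_one S) l (z k) r \<in> Some ` carrier S"
      using lr z[of k] by (auto simp: triple_def smult_closed)
  qed (use xy in auto)
  then show ?thesis by (simp add: prod.map_ident)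
qed

lemma engel_eq_iff:
  assumes "a \<in> carrier S" "b \<in> carrier S" "c \<in> carrier (adjoin_one S)"
  shows "lam S a b (engel_seq S c) n = rho S a b (engel_seq S c) n \<longleftrightarrow>
    fst (twist (triple (with_one S)) (\<lambda>i. c [^]\<^bsub>with_one S\<^esub> (i - 1)) (Some a, Some b) n) =
    snd (twist (triple (with_one S)) (\<lambda>i. c [^]\<^bsub>with_one S\<^esub> (i - 1)) (Some a, Some b) n)"
proof -
  have c: "c \<in> carrier (with_one S)" using assms(3) carrier_adjoin_one by blast
  have e: "engel_seq S c (Suc i) = c [^]\<^bsub>adjoin_one S\<^esub> (i - 1 :: nat)" for i
    by (cases i) (simp_all add: engel_seq_def nat_pow_def)
  have "twist (triple (with_one S)) (\<lambda>i. engel_seq S c (Suc i)) (Some a, Some b) n =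
      twist (triple (with_one S)) (\<lambda>i. c [^]\<^bsub>with_one S\<^esub> (i - 1)) (Some a, Some b) n"
    unfolding e by (rule twist_with_one_cong) (use pow_adjoin[OF c] assms in blast)+
  then show ?thesis by (simp only: lam_rho_merge)
qed

lemma thue_eq_iff:
  assumes "a \<in> carrier S" "b \<in> carrier S"
  shows "lam S a b (\<lambda>_. \<one>\<^bsub>adjoin_one S\<^esub>) n = rho S a b (\<lambda>_. \<one>\<^bsub>adjoin_one S\<^esub>) n \<longleftrightarrow>
    fst (twist (triple (with_one S)) (\<lambda>_. \<one>\<^bsub>with_one S\<^esub>) (Some a, Some b) n) =
    snd (twist (triple (with_one S)) (\<lambda>_. \<one>\<^bsub>with_one S\<^esub>) (Some a, Some b) n)"
proof -
  have "twist (triple (with_one S)) (\<lambda>_. \<one>\<^bsub>adjoin_one S\<^esub>) (Some a, Some b) n =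
      twist (triple (with_one S)) (\<lambda>_. \<one>\<^bsub>with_one S\<^esub>) (Some a, Some b) n"
    by (rule twist_with_one_cong) (use mult_one_adjoin one_adjoin_closed assms in \<open>simp_all del: with_one_simps(1)\<close>)
  then show ?thesis by (simp only: lam_rho_merge)
qed

text \<open>Runs that start with the adjoined identity merge after one step, because the first
  middle factor is the identity as well.\<close>

lemma thue_engel_with_one:
  assumes tm: "\<And>a b. \<lbrakk>a \<in> carrier S; b \<in> carrier S\<rbrakk> \<Longrightarrow> merges (triple (with_one S)) (\<lambda>_. \<one>\<^bsub>with_one S\<^esub>) (Some a, Some b)"
    and en: "\<And>a c. \<lbrakk>a \<in> carrier S; c \<in> carrier S\<rbrakk> \<Longrightarrow>
      merges (triple (with_one S)) (\<lambda>i. Some c [^]\<^bsub>with_one S\<^esub> (i - 1)) (Some a, Some c)"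
  shows "thue_engel (with_one S)"
proof -
  interpret W: monoid "with_one S" by (rule monoid_with_one)
  have None: "merges (triple (with_one S)) z (u, v)" if "u = None \<or> v = None" "z 0 = None" for u v z
  proof -
    have "fst (twist (triple (with_one S)) z (u, v) 1) = snd (twist (triple (with_one S)) z (u, v) 1)"
      using that by (auto simp: triple_def)
    then show ?thesis unfolding merges_def by blast
  qed
  have pow: "None [^]\<^bsub>with_one S\<^esub> (n::nat) = None" for n using W.nat_pow_one[of n] by simp
  show ?thesis unfolding thue_engel_def
  proof (intro ballI conjI)
    fix u v assume uv: "u \<in> carrier (with_one S)" "v \<in> carrier (with_one S)"
    show 1: "merges (triple (with_one S)) (\<lambda>_. \<one>\<^bsub>with_one S\<^esub>) (u, v)"
      using uv tm None[of u v "\<lambda>_. None"] by auto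
    show "merges (triple (with_one S)) (\<lambda>i. v [^]\<^bsub>with_one S\<^esub> (i - 1)) (u, v)"
      using uv en None[of u v "\<lambda>i. v [^]\<^bsub>with_one S\<^esub> (i - 1)"] pow by (auto simp: nat_pow_def)
  qed
qed

end

section \<open>Reduction of PE to a single merging test\<close>

lemma uniform_index:
  fixes P :: "'i \<Rightarrow> nat \<Rightarrow> bool"
  assumes "finite I" "\<And>i. i \<in> I \<Longrightarrow> \<exists>n. P i n" "\<And>i n m. \<lbrakk>P i n; n \<le> m\<rbrakk> \<Longrightarrow> P i m"
  shows "\<exists>n\<ge>k. \<forall>i\<in>I. P i n"
proof -
  have "\<forall>\<^sub>F n in sequentially. P i n" if "i \<in> I" for i
    using assms(2)[OF that] assms(3) unfolding eventually_sequentially by blast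
  then have "\<forall>\<^sub>F n in sequentially. \<forall>i\<in>I. P i n" by (intro eventually_ball_finite assms(1) ballI)
  then show ?thesis unfolding eventually_sequentially by (metis linear order_refl)
qed

text \<open>The Engel condition for equal second and third argument. Both membership in PE and the
  pseudoidentity are compared with it.\<close>

definition engel_test :: "'a sgrp \<Rightarrow> bool" where
  "engel_test S \<longleftrightarrow> (\<forall>a\<in>carrier S. \<forall>c\<in>carrier S.
     merges (triple (with_one S)) (\<lambda>i. Some c [^]\<^bsub>with_one S\<^esub> (i - 1)) (Some a, Some c))"

text \<open>In one direction, c = 1 gives the Thue--Morse identity and b = c the test. In the other,
  every triple has its own index of merging, and a common one exists because the triples are
  finitely many.\<close>

lemma PE_iff: "S \<in> PE \<longleftrightarrow> S \<in> TM \<and> engel_test S"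
proof (cases "finite_sgroup S")
  case False
  then show ?thesis by (simp add: PE_def TM_def)
next
  case True
  then interpret sgroup S by (simp add: finite_sgroup_def)
  have fin: "finite (carrier S)" using True by (simp add: finite_sgroup_def)
  show ?thesis
  proof (intro iffI conjI)
    assume "S \<in> PE"
    then obtain n where n: "\<And>a b c. \<lbrakk>a \<in> carrier S; b \<in> carrier S; c \<in> carrier (adjoin_one S)\<rbrakk> \<Longrightarrow>
        lam S a b (engel_seq S c) n = rho S a b (engel_seq S c) n" by (auto simp: PE_def)
    have "engel_seq S \<one>\<^bsub>adjoin_one S\<^esub> = (\<lambda>_. \<one>\<^bsub>adjoin_one S\<^esub>)"
      by (simp add: engel_seq_def fun_eq_iff pow_one_adjoin)
    then show "S \<in> TM" using n[OF _ _ one_adjoin_closed(1)] True by (auto simp: TM_def)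
    show "engel_test S" unfolding engel_test_def
    proof (intro ballI)
      fix a c assume ac: "a \<in> carrier S" "c \<in> carrier S"
      then have c: "Some c \<in> carrier (adjoin_one S)" using carrier_adjoin_one by blast
      show "merges (triple (with_one S)) (\<lambda>i. Some c [^]\<^bsub>with_one S\<^esub> (i - 1)) (Some a, Some c)"
        unfolding merges_def using n[OF ac c] engel_eq_iff[OF ac c] by blast
    qed
  next
    assume S: "S \<in> TM \<and> engel_test S"
    then obtain n where n: "\<And>a b. \<lbrakk>a \<in> carrier S; b \<in> carrier S\<rbrakk> \<Longrightarrow>
        lam S a b (\<lambda>_. \<one>\<^bsub>adjoin_one S\<^esub>) n = rho S a b (\<lambda>_. \<one>\<^bsub>adjoin_one S\<^esub>) n" by (auto simp: TM_def)
    have te: "thue_engel (with_one S)"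
    proof (rule thue_engel_with_one)
      show "merges (triple (with_one S)) (\<lambda>_. \<one>\<^bsub>with_one S\<^esub>) (Some a, Some b)"
        if ab: "a \<in> carrier S" "b \<in> carrier S" for a b
        unfolding merges_def using n[OF ab] thue_eq_iff[OF ab] by blast
    qed (use S in \<open>simp add: engel_test_def\<close>)
    let ?I = "carrier S \<times> carrier S \<times> carrier (adjoin_one S)"
    let ?P = "\<lambda>(a, b, c) n. fst (twist (triple (with_one S)) (\<lambda>i. c [^]\<^bsub>with_one S\<^esub> (i - 1)) (Some a, Some b) n) =
        snd (twist (triple (with_one S)) (\<lambda>i. c [^]\<^bsub>with_one S\<^esub> (i - 1)) (Some a, Some b) n)"
    have "\<exists>n\<ge>2. \<forall>i\<in>?I. ?P i n"
    proof (rule uniform_index)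
      have finW: "finite (carrier (with_one S))" using fin by simp
      then show "finite ?I" using fin finite_subset[OF carrier_adjoin_one(1)] by simp
      fix i assume i: "i \<in> ?I"
      then obtain a b c where abc: "i = (a, b, c)" "a \<in> carrier S" "b \<in> carrier S" "c \<in> carrier (with_one S)"
        using carrier_adjoin_one(1) by blast
      then have "merges (triple (with_one S)) (\<lambda>i. c [^]\<^bsub>with_one S\<^esub> (i - 1)) (Some a, Some b)"
        by (intro thue_engel_merges_powers monoid_with_one finW te) simp_all
      then show "\<exists>n. ?P i n" by (simp add: abc(1) merges_def)
    next
      fix i n m assume "?P i n" "n \<le> m"
      then show "?P i m" by (auto split: prod.splits intro: twist_eq_mono)
    qed
    then show "S \<in> PE" using True engel_eq_iff by (auto simp: PE_def)
  qed
qed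

section \<open>Words in the free profinite semigroup\<close>

lemma fin_congs_iff:
  "\<theta> \<in> fin_congs UNIV \<longleftrightarrow> equiv (- {[]}) \<theta> \<and> finite ((- {[]}) // \<theta>) \<and>
    (\<forall>u u' v v'. (u, u') \<in> \<theta> \<longrightarrow> (v, v') \<in> \<theta> \<longrightarrow> (u @ v, u' @ v') \<in> \<theta>)"
  by (auto simp: fin_congs_def plus_words_def Compl_eq_Diff_UNIV)

lemma fin_cong_append:
  assumes "\<theta> \<in> fin_congs UNIV" "(u, u') \<in> \<theta>" "(v, v') \<in> \<theta>"
  shows "(u @ v, u' @ v') \<in> \<theta>"
  using assms by (auto simp: fin_congs_iff)

lemma fin_cong_equiv: "\<theta> \<in> fin_congs UNIV \<Longrightarrow> equiv (- {[]}) \<theta>"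
  by (simp add: fin_congs_iff)

lemma fin_cong_class_eq:
  assumes "\<theta> \<in> fin_congs UNIV" "w \<noteq> []"
  shows "\<theta> `` {w} = \<theta> `` {w'} \<longleftrightarrow> (w', w) \<in> \<theta>"
  using assms eq_equiv_class[OF _ fin_cong_equiv[OF assms(1)], of w' w]
    equiv_class_eq[OF fin_cong_equiv[OF assms(1)], of w' w] by auto

text \<open>The common source of the congruences below: evaluation in a finite semigroup, pairs of
  classes for intersections, a constant map, and substitution followed by taking classes.\<close>

lemma kernel_fin_cong:
  fixes ev :: "'a list \<Rightarrow> 'b"
  assumes fin: "finite (ev ` (- {[]}))"
    and app: "\<And>u u' v v'. \<lbrakk>u \<noteq> []; u' \<noteq> []; v \<noteq> []; v' \<noteq> []; ev u = ev u'; ev v = ev v'\<rbrakk> \<Longrightarrow> ev (u @ v) = ev (u' @ v')"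
  shows "{(u, v). u \<noteq> [] \<and> v \<noteq> [] \<and> ev u = ev v} \<in> fin_congs UNIV" (is "?\<theta> \<in> _")
proof -
  have "(- {[]}) // ?\<theta> \<subseteq> (\<lambda>s. {v. v \<noteq> [] \<and> s = ev v}) ` ev ` (- {[]})"
    by (auto simp: quotient_def image_iff)
  then have "finite ((- {[]}) // ?\<theta>)" using fin by (meson finite_imageI finite_subset)
  moreover have "equiv (- {[]}) ?\<theta>" by (auto intro!: equivI refl_onI symI transI)
  ultimately show ?thesis using app by (auto simp: fin_congs_iff)
qed

lemma fin_cong_Int:
  assumes "\<theta> \<in> fin_congs UNIV" "\<theta>' \<in> fin_congs UNIV"
  shows "\<theta> \<inter> \<theta>' \<in> fin_congs UNIV"
proof -
  have mem: "(u, v) \<in> \<theta> \<longleftrightarrow> u \<noteq> [] \<and> v \<noteq> [] \<and> \<theta> `` {u} = \<theta> `` {v}" if \<theta>: "\<theta> \<in> fin_congs UNIV"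
    for \<theta> :: "'a list rel" and u v
  proof -
    have "(u, v) \<in> \<theta> \<Longrightarrow> u \<noteq> [] \<and> v \<noteq> []" using equiv_type[OF fin_cong_equiv[OF \<theta>]] by blast
    moreover have "(u, v) \<in> \<theta> \<longleftrightarrow> (v, u) \<in> \<theta>" using fin_cong_equiv[OF \<theta>] by (meson equivE symE)
    ultimately show ?thesis using fin_cong_class_eq[OF \<theta>, of u v] by blast
  qed
  have eq: "\<theta> \<inter> \<theta>' = {(u, v). u \<noteq> [] \<and> v \<noteq> [] \<and> (\<theta> `` {u}, \<theta>' `` {u}) = (\<theta> `` {v}, \<theta>' `` {v})}" (is "_ = ?R")
    using mem[OF assms(1)] mem[OF assms(2)] by auto
  have "finite ((\<lambda>u. (\<theta> `` {u}, \<theta>' `` {u})) ` (- {[]}))"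
    by (rule finite_subset[of _ "((- {[]}) // \<theta>) \<times> ((- {[]}) // \<theta>')"])
      (use assms in \<open>auto simp: fin_congs_iff quotientI\<close>)
  then have "?R \<in> fin_congs UNIV"
  proof (rule kernel_fin_cong)
    fix u u' v v' :: "'a list"
    assume ne: "u \<noteq> []" "u' \<noteq> []" "v \<noteq> []" "v' \<noteq> []"
      and "(\<theta> `` {u}, \<theta>' `` {u}) = (\<theta> `` {u'}, \<theta>' `` {u'})" "(\<theta> `` {v}, \<theta>' `` {v}) = (\<theta> `` {v'}, \<theta>' `` {v'})"
    then have "(u', u) \<in> \<theta>" "(v', v) \<in> \<theta>" "(u', u) \<in> \<theta>'" "(v', v) \<in> \<theta>'"
      using fin_cong_class_eq assms by auto
    then show "(\<theta> `` {u @ v}, \<theta>' `` {u @ v}) = (\<theta> `` {u' @ v'}, \<theta>' `` {u' @ v'})"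
      using fin_cong_class_eq[of _ "u @ v" "u' @ v'"] fin_cong_append assms ne by auto
  qed
  then show ?thesis unfolding eq .
qed

lemma fin_cong_UNIV: "(- {[]}) \<times> (- {[]}) \<in> fin_congs UNIV"
proof -
  have eq: "(- {[]}) \<times> (- {[]}) = {(u, v). u \<noteq> [] \<and> v \<noteq> [] \<and> () = ()}" by auto
  show ?thesis unfolding eq by (rule kernel_fin_cong) auto
qed

text \<open>The canonical image of a word in the free profinite semigroup.\<close>

definition word :: "'a list \<Rightarrow> 'a list rel \<Rightarrow> 'a list set" where
  "word w = (\<lambda>\<theta>\<in>fin_congs UNIV. \<theta> `` {w})"

lemma word_apply: "\<theta> \<in> fin_congs UNIV \<Longrightarrow> word w \<theta> = \<theta> `` {w}"
  by (simp add: word_def)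

lemma gen_eq_word: "gen UNIV a = word [a]"
  by (simp add: gen_def word_def)

lemma free_prof_carrier_iff:
  "f \<in> carrier (free_prof UNIV) \<longleftrightarrow> f \<in> extensional (fin_congs UNIV) \<and>
    (\<forall>\<theta>\<in>fin_congs UNIV. \<exists>w. w \<noteq> [] \<and> f \<theta> = \<theta> `` {w}) \<and>
    (\<forall>\<theta>\<in>fin_congs UNIV. \<forall>\<theta>'\<in>fin_congs UNIV. \<theta> \<subseteq> \<theta>' \<longrightarrow> f \<theta> \<subseteq> f \<theta>')"
proof -
  have "c \<in> plus_words UNIV // \<theta> \<longleftrightarrow> (\<exists>w. w \<noteq> [] \<and> c = \<theta> `` {w})" for c and \<theta> :: "'a list rel"
    by (auto simp: quotient_def plus_words_def)
  then show ?thesis by (auto simp: free_prof_def PiE_iff)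
qed

lemma free_prof_mono:
  assumes "f \<in> carrier (free_prof UNIV)" "\<theta> \<in> fin_congs UNIV" "\<theta>' \<in> fin_congs UNIV" "\<theta> \<subseteq> \<theta>'"
  shows "f \<theta> \<subseteq> f \<theta>'"
  using assms by (simp add: free_prof_carrier_iff)

lemma word_in_carrier: "w \<noteq> [] \<Longrightarrow> word w \<in> carrier (free_prof UNIV)"
  by (auto simp: free_prof_carrier_iff word_def)

lemma free_prof_class:
  assumes "f \<in> carrier (free_prof UNIV)" "\<theta> \<in> fin_congs UNIV"
  shows "f \<theta> \<noteq> {}" and "w \<in> f \<theta> \<Longrightarrow> w \<noteq> [] \<and> f \<theta> = \<theta> `` {w}"
proof -
  have eq: "equiv (- {[]}) \<theta>" using fin_cong_equiv assms(2) .
  obtain w0 where w0: "w0 \<noteq> []" "f \<theta> = \<theta> `` {w0}" using assms by (auto simp: free_prof_carrier_iff)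
  then show "f \<theta> \<noteq> {}" using equiv_class_self[OF eq, of w0] by auto
  assume "w \<in> f \<theta>"
  then have w: "(w0, w) \<in> \<theta>" using w0 by simp
  then have "w \<noteq> []" using equiv_type[OF eq] by auto
  moreover have "\<theta> `` {w0} = \<theta> `` {w}" using equiv_class_eq[OF eq w] .
  ultimately show "w \<noteq> [] \<and> f \<theta> = \<theta> `` {w}" using w0 by simp
qed

lemma free_prof_mult_class:
  assumes f: "f \<in> carrier (free_prof UNIV)" "g \<in> carrier (free_prof UNIV)" and \<theta>: "\<theta> \<in> fin_congs UNIV"
    and uv: "u \<in> f \<theta>" "v \<in> g \<theta>"
  shows "(f \<cdot>\<^bsub>free_prof UNIV\<^esub> g) \<theta> = \<theta> `` {u @ v}"
proof -
  have ne: "u @ v \<noteq> []" and u: "f \<theta> = \<theta> `` {u}" and v: "g \<theta> = \<theta> `` {v}"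
    using free_prof_class(2)[OF f(1) \<theta> uv(1)] free_prof_class(2)[OF f(2) \<theta> uv(2)] by auto
  have "\<theta> `` {u' @ v'} = \<theta> `` {u @ v}" if "u' \<in> f \<theta>" "v' \<in> g \<theta>" for u' v'
    using fin_cong_append[OF \<theta>, of u u' v v'] that u v equiv_class_eq[OF fin_cong_equiv[OF \<theta>]] by force
  then have "\<theta> `` {u @ v | u v. u \<in> f \<theta> \<and> v \<in> g \<theta>} = \<theta> `` {u @ v}" using uv by blast
  then show ?thesis using \<theta> by (simp add: free_prof_def)
qed

lemma free_prof_ext:
  assumes "f \<in> carrier (free_prof UNIV)" "g \<in> carrier (free_prof UNIV)"
    and "\<And>\<theta>. \<theta> \<in> fin_congs UNIV \<Longrightarrow> f \<theta> = g \<theta>"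
  shows "f = g"
  using assms by (auto simp: free_prof_carrier_iff intro: extensionalityI)

lemma free_prof_mult_closed:
  assumes f: "f \<in> carrier (free_prof UNIV)" "g \<in> carrier (free_prof UNIV)"
  shows "f \<cdot>\<^bsub>free_prof UNIV\<^esub> g \<in> carrier (free_prof UNIV)"
  unfolding free_prof_carrier_iff
proof (intro conjI ballI impI)
  show "f \<cdot>\<^bsub>free_prof UNIV\<^esub> g \<in> extensional (fin_congs UNIV)" by (simp add: free_prof_def)
  fix \<theta> :: "'a list rel" assume \<theta>: "\<theta> \<in> fin_congs UNIV"
  obtain u v where uv: "u \<in> f \<theta>" "v \<in> g \<theta>"
    using free_prof_class(1)[OF f(1) \<theta>] free_prof_class(1)[OF f(2) \<theta>] by blast
  then have "u @ v \<noteq> []" using free_prof_class(2)[OF f(1) \<theta>] by simp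
  then show "\<exists>w. w \<noteq> [] \<and> (f \<cdot>\<^bsub>free_prof UNIV\<^esub> g) \<theta> = \<theta> `` {w}"
    using free_prof_mult_class[OF f \<theta> uv] by blast
  fix \<theta>' :: "'a list rel" assume \<theta>': "\<theta>' \<in> fin_congs UNIV" "\<theta> \<subseteq> \<theta>'"
  then have "u \<in> f \<theta>'" "v \<in> g \<theta>'"
    using uv free_prof_mono[OF f(1) \<theta>] free_prof_mono[OF f(2) \<theta>] by blast+
  then show "(f \<cdot>\<^bsub>free_prof UNIV\<^esub> g) \<theta> \<subseteq> (f \<cdot>\<^bsub>free_prof UNIV\<^esub> g) \<theta>'"
    using free_prof_mult_class[OF f \<theta> uv] free_prof_mult_class[OF f \<theta>'(1)] \<theta>'(2) by auto
qed

lemma word_self: "\<lbrakk>\<theta> \<in> fin_congs UNIV; w \<noteq> []\<rbrakk> \<Longrightarrow> w \<in> word w \<theta>"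
  using equiv_class_self[OF fin_cong_equiv, of \<theta> w] by (simp add: word_apply)

lemma word_append:
  assumes "u \<noteq> []" "v \<noteq> []"
  shows "word u \<cdot>\<^bsub>free_prof UNIV\<^esub> word v = word (u @ v)"
proof (rule free_prof_ext)
  fix \<theta> :: "'a list rel" assume \<theta>: "\<theta> \<in> fin_congs UNIV"
  show "(word u \<cdot>\<^bsub>free_prof UNIV\<^esub> word v) \<theta> = word (u @ v) \<theta>"
    using free_prof_mult_class[OF word_in_carrier[OF assms(1)] word_in_carrier[OF assms(2)] \<theta>
        word_self[OF \<theta> assms(1)] word_self[OF \<theta> assms(2)]] word_apply[OF \<theta>] by simp
qed (use assms in \<open>simp_all add: word_in_carrier free_prof_mult_closed\<close>)

lemma mult_class_mem:
  assumes f: "f \<in> carrier (free_prof UNIV)" "g \<in> carrier (free_prof UNIV)" and \<theta>: "\<theta> \<in> fin_congs UNIV"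
    and uv: "u \<in> f \<theta>" "v \<in> g \<theta>"
  shows "u @ v \<in> (f \<cdot>\<^bsub>free_prof UNIV\<^esub> g) \<theta>"
proof -
  have "u @ v \<noteq> []" using free_prof_class(2)[OF f(1) \<theta> uv(1)] by simp
  then show ?thesis
    using free_prof_mult_class[OF assms] equiv_class_self[OF fin_cong_equiv[OF \<theta>], of "u @ v"] by simp
qed

lemma sgroup_free_prof: "sgroup (free_prof UNIV)"
proof
  fix f g k :: "'a list rel \<Rightarrow> 'a list set"
  assume f: "f \<in> carrier (free_prof UNIV)" and g: "g \<in> carrier (free_prof UNIV)"
  show "f \<cdot>\<^bsub>free_prof UNIV\<^esub> g \<in> carrier (free_prof UNIV)" using free_prof_mult_closed f g .
  assume k: "k \<in> carrier (free_prof UNIV)"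
  show "f \<cdot>\<^bsub>free_prof UNIV\<^esub> g \<cdot>\<^bsub>free_prof UNIV\<^esub> k = f \<cdot>\<^bsub>free_prof UNIV\<^esub> (g \<cdot>\<^bsub>free_prof UNIV\<^esub> k)"
  proof (rule free_prof_ext)
    fix \<theta> :: "'a list rel" assume \<theta>: "\<theta> \<in> fin_congs UNIV"
    obtain u v w where uvw: "u \<in> f \<theta>" "v \<in> g \<theta>" "w \<in> k \<theta>"
      using free_prof_class(1)[OF f \<theta>] free_prof_class(1)[OF g \<theta>] free_prof_class(1)[OF k \<theta>] by blast
    show "(f \<cdot>\<^bsub>free_prof UNIV\<^esub> g \<cdot>\<^bsub>free_prof UNIV\<^esub> k) \<theta> = (f \<cdot>\<^bsub>free_prof UNIV\<^esub> (g \<cdot>\<^bsub>free_prof UNIV\<^esub> k)) \<theta>"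
      using free_prof_mult_class[OF free_prof_mult_closed[OF f g] k \<theta> mult_class_mem[OF f g \<theta> uvw(1,2)] uvw(3)]
        free_prof_mult_class[OF f free_prof_mult_closed[OF g k] \<theta> uvw(1) mult_class_mem[OF g k \<theta> uvw(2,3)]]
      by simp
  qed (simp_all add: free_prof_mult_closed f g k)
qed

section \<open>Density of words and continuous homomorphisms\<close>

lemma topspace_free_prof_top [simp]: "topspace (free_prof_top A) = carrier (free_prof A)"
  by (auto simp: free_prof_top_def free_prof_def)

lemma Hausdorff_free_prof_top: "Hausdorff_space (free_prof_top A)"
  by (simp add: free_prof_top_def Hausdorff_space_subtopology Hausdorff_space_product_topology)

text \<open>Finitely many congruences have a common refinement of finite index. By compatibility, a
  representative of \<open>f\<close> there represents \<open>f\<close> at each of them.\<close>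

lemma word_dense_finite:
  assumes f: "f \<in> carrier (free_prof UNIV)" and T: "finite T" "T \<subseteq> fin_congs UNIV"
  shows "\<exists>w. w \<noteq> [] \<and> (\<forall>\<theta>\<in>T. f \<theta> = word w \<theta>)"
proof -
  have "\<exists>\<theta>0\<in>fin_congs UNIV. \<forall>\<theta>\<in>T. \<theta>0 \<subseteq> \<theta>"
    using T
  proof (induction T rule: finite_induct)
    case empty
    then show ?case using fin_cong_UNIV by auto
  next
    case (insert \<theta> T)
    then obtain \<theta>0 where \<theta>0: "\<theta>0 \<in> fin_congs UNIV" "\<forall>\<theta>\<in>T. \<theta>0 \<subseteq> \<theta>" by auto
    have "\<theta>0 \<inter> \<theta> \<in> fin_congs UNIV" using fin_cong_Int \<theta>0 insert by blast
    then show ?case using \<theta>0(2) by blast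
  qed
  then obtain \<theta>0 where \<theta>0: "\<theta>0 \<in> fin_congs UNIV" "\<forall>\<theta>\<in>T. \<theta>0 \<subseteq> \<theta>" by blast
  obtain w where w: "w \<in> f \<theta>0" using free_prof_class(1)[OF f \<theta>0(1)] by blast
  have "w \<noteq> []" using free_prof_class(2)[OF f \<theta>0(1) w] by simp
  moreover have "f \<theta> = word w \<theta>" if "\<theta> \<in> T" for \<theta>
  proof -
    have \<theta>: "\<theta> \<in> fin_congs UNIV" using that T by blast
    have "w \<in> f \<theta>" using w free_prof_mono[OF f \<theta>0(1) \<theta>] \<theta>0(2) that by blast
    then show ?thesis using free_prof_class(2)[OF f \<theta>] word_apply[OF \<theta>] by blast
  qed
  ultimately show ?thesis by blast
qed

lemma word_dense:
  assumes f: "f \<in> carrier (free_prof UNIV)"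
  shows "f \<in> free_prof_top UNIV closure_of (word ` (- {[]}))"
  unfolding in_closure_of
proof (intro conjI allI impI)
  show "f \<in> topspace (free_prof_top UNIV)" using f by simp
  fix T assume T: "f \<in> T \<and> openin (free_prof_top UNIV) T"
  let ?X = "\<lambda>\<theta>. discrete_topology (plus_words UNIV // \<theta>)"
  obtain T' where T': "openin (product_topology ?X (fin_congs UNIV)) T'" "T = T' \<inter> carrier (free_prof UNIV)"
    using T by (auto simp: free_prof_top_def openin_subtopology)
  have "f \<in> T'" using T T' by blast
  with T'(1)[unfolded openin_product_topology_alt]
  have "\<exists>U. finite {\<theta> \<in> fin_congs UNIV. U \<theta> \<noteq> topspace (?X \<theta>)} \<and>
      (\<forall>\<theta>\<in>fin_congs UNIV. openin (?X \<theta>) (U \<theta>)) \<and> f \<in> Pi\<^sub>E (fin_congs UNIV) U \<and> Pi\<^sub>E (fin_congs UNIV) U \<subseteq> T'"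
    by (rule bspec)
  then obtain U where U: "finite {\<theta> \<in> fin_congs UNIV. U \<theta> \<noteq> topspace (?X \<theta>)}"
    "f \<in> Pi\<^sub>E (fin_congs UNIV) U" "Pi\<^sub>E (fin_congs UNIV) U \<subseteq> T'" by (elim exE conjE)
  have "{\<theta> \<in> fin_congs UNIV. U \<theta> \<noteq> topspace (?X \<theta>)} \<subseteq> fin_congs UNIV" by blast
  from word_dense_finite[OF f U(1) this]
  obtain w where w: "w \<noteq> []" "\<forall>\<theta>\<in>{\<theta> \<in> fin_congs UNIV. U \<theta> \<noteq> topspace (?X \<theta>)}. f \<theta> = word w \<theta>"
    by (elim exE conjE)
  have "word w \<in> Pi\<^sub>E (fin_congs UNIV) U"
  proof (rule PiE_I)
    fix \<theta> :: "'a list rel" assume \<theta>: "\<theta> \<in> fin_congs UNIV"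
    show "word w \<theta> \<in> U \<theta>"
    proof (cases "U \<theta> = topspace (?X \<theta>)")
      case True
      then show ?thesis using w(1) by (auto simp: word_apply[OF \<theta>] plus_words_def intro!: quotientI)
    next
      case False
      then have "f \<theta> = word w \<theta>" using w(2) \<theta> by blast
      then show ?thesis using PiE_mem[OF U(2) \<theta>] by simp
    qed
  qed (simp add: word_def)
  then have "word w \<in> T" using U(3) T'(2) word_in_carrier[OF w(1)] by blast
  then show "\<exists>y. y \<in> word ` (- {[]}) \<and> y \<in> T" using w(1) by blast
qed

lemma hom_word_cong:
  assumes h: "h \<in> sg_hom (free_prof UNIV) S" "h' \<in> sg_hom (free_prof UNIV) S"
    and gen: "\<And>a. h (gen UNIV a) = h' (gen UNIV a)" and w: "w \<noteq> []"
  shows "h (word w) = h' (word w)"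
  using w
proof (induction w)
  case (Cons a w)
  show ?case
  proof (cases "w = []")
    case True
    then show ?thesis using gen by (simp add: gen_eq_word)
  next
    case False
    then have "word (a # w) = word [a] \<cdot>\<^bsub>free_prof UNIV\<^esub> word w" using word_append[of "[a]" w] by simp
    moreover have "word [a] \<in> carrier (free_prof UNIV)" "word w \<in> carrier (free_prof UNIV)"
      using False word_in_carrier by auto
    ultimately show ?thesis using h gen[of a] Cons False by (simp add: sg_hom_def gen_eq_word)
  qed
qed simp

text \<open>The homomorphisms agree on words, which are dense, and continuous maps into a Hausdorff
  space that agree on a dense set are equal.\<close>

lemma hom_unique:
  assumes h: "h \<in> sg_hom (free_prof UNIV) S" "h' \<in> sg_hom (free_prof UNIV) S"
    and gen: "\<And>a. h (gen UNIV a) = h' (gen UNIV a)"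
    and c: "continuous_map (free_prof_top UNIV) Y h" "continuous_map (free_prof_top UNIV) Y h'"
    and Y: "Hausdorff_space Y" and f: "f \<in> carrier (free_prof UNIV)"
  shows "h f = h' f"
  using word_dense[OF f] Y c
proof (rule forall_in_closure_of_eq)
  fix x assume "x \<in> word ` (- {[]} :: 'a list set)"
  then show "h x = h' x" using hom_word_cong[OF h gen] by auto
qed

text \<open>The map factors through one coordinate, which takes values in a discrete space.\<close>

lemma continuous_map_of_class:
  assumes "\<theta> \<in> fin_congs UNIV" "\<And>f. f \<in> carrier (free_prof UNIV) \<Longrightarrow> h f = k (f \<theta>)"
    and "\<And>f. f \<in> carrier (free_prof UNIV) \<Longrightarrow> h f \<in> X"
  shows "continuous_map (free_prof_top UNIV) (discrete_topology X) h"
proof -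
  have "continuous_map (free_prof_top UNIV) (discrete_topology (plus_words UNIV // \<theta>)) (\<lambda>f. f \<theta>)"
    unfolding free_prof_top_def
    by (intro continuous_map_from_subtopology continuous_map_product_projection[OF assms(1)])
  then have cont: "openin (free_prof_top UNIV) {f \<in> carrier (free_prof UNIV). f \<theta> \<in> U}"
    if "U \<subseteq> plus_words UNIV // \<theta>" for U
    using that by (auto dest: openin_continuous_map_preimage)
  have mem: "f \<theta> \<in> plus_words UNIV // \<theta>" if "f \<in> carrier (free_prof UNIV)" for f
    using that assms(1) by (auto simp: free_prof_def PiE_iff)
  show ?thesis unfolding continuous_map_def
  proof (intro conjI allI impI)
    show "h \<in> topspace (free_prof_top UNIV) \<rightarrow> topspace (discrete_topology X)" using assms(3) by auto
    fix U
    have "{x \<in> topspace (free_prof_top UNIV). h x \<in> U} =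
        {f \<in> carrier (free_prof UNIV). f \<theta> \<in> {c \<in> plus_words UNIV // \<theta>. k c \<in> U}}"
      using assms(2) mem by auto
    then show "openin (free_prof_top UNIV) {x \<in> topspace (free_prof_top UNIV). h x \<in> U}"
      using cont[of "{c \<in> plus_words UNIV // \<theta>. k c \<in> U}"] by simp
  qed
qed

fun eval_word :: "'s sgrp \<Rightarrow> ('a \<Rightarrow> 's) \<Rightarrow> 'a list \<Rightarrow> 's" where
  "eval_word S g [] = undefined"
| "eval_word S g [a] = g a"
| "eval_word S g (a # b # w) = g a \<cdot>\<^bsub>S\<^esub> eval_word S g (b # w)"

context sgroup
begin

lemma eval_word_closed:
  assumes "range g \<subseteq> carrier S" "w \<noteq> []"
  shows "eval_word S g w \<in> carrier S"
  using assms(2)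
proof (induction w)
  case (Cons a w)
  then show ?case using assms(1) by (cases w) (auto intro: smult_closed)
qed simp

lemma eval_word_append:
  assumes "range g \<subseteq> carrier S" "u \<noteq> []" "v \<noteq> []"
  shows "eval_word S g (u @ v) = eval_word S g u \<cdot> eval_word S g v"
  using assms(2)
proof (induction u)
  case (Cons a u)
  have ga: "g a \<in> carrier S" using assms(1) by auto
  obtain b v' where v: "v = b # v'" using assms(3) by (cases v) auto
  show ?case
  proof (cases u)
    case Nil
    then show ?thesis by (simp add: v)
  next
    case (Cons c u')
    then show ?thesis using Cons.IH eval_word_closed[OF assms(1)] assms(3) ga
      by (simp add: smult_assoc)
  qed
qed simp

text \<open>The kernel of evaluation in the finite semigroup is one of the congruences, so
  \<open>h\<close> can evaluate any representative of that coordinate.\<close>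

lemma free_prof_hom_exists:
  fixes g :: "'b \<Rightarrow> 'a"
  assumes fin: "finite (carrier S)" and g: "range g \<subseteq> carrier S"
  shows "\<exists>h. h \<in> sg_hom (free_prof UNIV) S \<and>
    continuous_map (free_prof_top UNIV) (discrete_topology (carrier S)) h \<and> (\<forall>a. h (gen UNIV a) = g a)"
proof -
  define \<theta> where "\<theta> = {(u, v). u \<noteq> [] \<and> v \<noteq> [] \<and> eval_word S g u = eval_word S g v}"
  have \<theta>: "\<theta> \<in> fin_congs UNIV" unfolding \<theta>_def
  proof (rule kernel_fin_cong)
    show "finite (eval_word S g ` (- {[]}))"
      by (rule finite_subset[OF _ fin]) (use eval_word_closed[OF g] in auto)
  qed (simp add: eval_word_append[OF g])
  define h where "h f = eval_word S g (SOME w. w \<in> f \<theta>)" for f :: "'b list rel \<Rightarrow> 'b list set"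
  have h: "h f = eval_word S g w" if f: "f \<in> carrier (free_prof UNIV)" and w: "w \<in> f \<theta>" for f w
  proof -
    have w': "(SOME w. w \<in> f \<theta>) \<in> f \<theta>" using w by (rule someI)
    have "f \<theta> = \<theta> `` {w}" using free_prof_class(2)[OF f \<theta> w] by simp
    then have "(w, SOME w. w \<in> f \<theta>) \<in> \<theta>" using w' by blast
    then show ?thesis by (simp add: h_def \<theta>_def)
  qed
  have ne: "\<exists>w. w \<in> f \<theta> \<and> w \<noteq> []" if "f \<in> carrier (free_prof UNIV)" for f
    using free_prof_class[OF that \<theta>] by blast
  have closed: "h f \<in> carrier S" if "f \<in> carrier (free_prof UNIV)" for f
    using ne[OF that] h[OF that] eval_word_closed[OF g] by auto
  show ?thesis
  proof (intro exI[of _ h] conjI allI)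
    show "h \<in> sg_hom (free_prof UNIV) S" unfolding sg_hom_def
    proof (intro CollectI conjI ballI)
      show "h \<in> carrier (free_prof UNIV) \<rightarrow> carrier S" using closed by blast
      fix f k :: "'b list rel \<Rightarrow> 'b list set"
      assume fk: "f \<in> carrier (free_prof UNIV)" "k \<in> carrier (free_prof UNIV)"
      obtain u v where uv: "u \<in> f \<theta>" "u \<noteq> []" "v \<in> k \<theta>" "v \<noteq> []" using ne fk by blast
      then show "h (f \<cdot>\<^bsub>free_prof UNIV\<^esub> k) = h f \<cdot> h k"
        using h[OF fk(1) uv(1)] h[OF fk(2) uv(3)] eval_word_append[OF g uv(2,4)]
          h[OF free_prof_mult_closed[OF fk] mult_class_mem[OF fk \<theta> uv(1,3)]] by simp
    qed
    show "continuous_map (free_prof_top UNIV) (discrete_topology (carrier S)) h"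
      by (rule continuous_map_of_class[OF \<theta> _ closed, where k = "\<lambda>c. eval_word S g (SOME w. w \<in> c)"])
        (simp add: h_def)
    show "h (gen UNIV a) = g a" for a
      using h[of "word [a]" "[a]"] word_in_carrier[of "[a]"] word_self[OF \<theta>, of "[a]"] by (simp add: gen_eq_word)
  qed
qed

end

lemma concat_map_nonempty: "\<lbrakk>\<And>a. \<sigma> a \<noteq> []; w \<noteq> []\<rbrakk> \<Longrightarrow> concat (map \<sigma> w) \<noteq> []"
  by (cases w) auto

text \<open>The coordinate \<theta> of the image depends only on the coordinate
  \<open>pb \<theta>\<close>, where \<open>pb \<theta>\<close> is the pullback of \<theta> along the
  substitution. This gives compatibility as well as continuity.\<close>

lemma substitution_exists:
  fixes \<sigma> :: "'b \<Rightarrow> 'a list"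
  assumes ne: "\<And>a. \<sigma> a \<noteq> []"
  shows "\<exists>\<phi>. \<phi> \<in> extensional (carrier (free_prof UNIV)) \<and> \<phi> \<in> sg_hom (free_prof UNIV) (free_prof UNIV) \<and>
    continuous_map (free_prof_top UNIV) (free_prof_top UNIV) \<phi> \<and> (\<forall>a. \<phi> (gen UNIV a) = word (\<sigma> a))"
proof -
  define sub where "sub w = concat (map \<sigma> w)" for w
  have sub_ne: "sub w \<noteq> []" if "w \<noteq> []" for w using concat_map_nonempty ne that unfolding sub_def by blast
  have sub_app: "sub (u @ v) = sub u @ sub v" for u v by (simp add: sub_def)
  define pb where "pb \<theta> = {(u, v). u \<noteq> [] \<and> v \<noteq> [] \<and> \<theta> `` {sub u} = \<theta> `` {sub v}}" for \<theta> :: "'a list rel"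
  have pb: "pb \<theta> \<in> fin_congs UNIV" if \<theta>: "\<theta> \<in> fin_congs UNIV" for \<theta> unfolding pb_def
  proof (rule kernel_fin_cong)
    have "\<theta> `` {sub u} \<in> (- {[]}) // \<theta>" if "u \<in> - {[]}" for u
      by (rule quotientI) (use sub_ne[of u] that in simp)
    then have "(\<lambda>u. \<theta> `` {sub u}) ` (- {[]}) \<subseteq> (- {[]}) // \<theta>" by (rule image_subsetI)
    then show "finite ((\<lambda>u. \<theta> `` {sub u}) ` (- {[]}))"
      by (rule finite_subset) (use \<theta> in \<open>simp add: fin_congs_iff\<close>)
    fix u u' v v' :: "'b list"
    assume ne: "u \<noteq> []" "u' \<noteq> []" "v \<noteq> []" "v' \<noteq> []"
      and eq: "\<theta> `` {sub u} = \<theta> `` {sub u'}" "\<theta> `` {sub v} = \<theta> `` {sub v'}"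
    have "(sub u', sub u) \<in> \<theta>" "(sub v', sub v) \<in> \<theta>"
      using eq fin_cong_class_eq[OF \<theta>] sub_ne ne by blast+
    then have "(sub (u' @ v'), sub (u @ v)) \<in> \<theta>" unfolding sub_app by (rule fin_cong_append[OF \<theta>])
    then show "\<theta> `` {sub (u @ v)} = \<theta> `` {sub (u' @ v')}"
      using fin_cong_class_eq[OF \<theta>, of "sub (u @ v)"] sub_ne ne by simp
  qed
  define \<phi>0 where "\<phi>0 f = (\<lambda>\<theta>\<in>fin_congs UNIV. \<theta> `` {sub (SOME w. w \<in> f (pb \<theta>))})" for f
  have \<phi>0: "\<phi>0 f \<theta> = \<theta> `` {sub w}"
    if f: "f \<in> carrier (free_prof UNIV)" and \<theta>: "\<theta> \<in> fin_congs UNIV" and w: "w \<in> f (pb \<theta>)" for f \<theta> w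
  proof -
    have w': "(SOME w. w \<in> f (pb \<theta>)) \<in> f (pb \<theta>)" using w by (rule someI)
    have "f (pb \<theta>) = pb \<theta> `` {w}" using free_prof_class(2)[OF f pb[OF \<theta>] w] by simp
    then have "(w, SOME w. w \<in> f (pb \<theta>)) \<in> pb \<theta>" using w' by blast
    then show ?thesis using \<theta> by (simp add: \<phi>0_def pb_def)
  qed
  have closed: "\<phi>0 f \<in> carrier (free_prof UNIV)" if f: "f \<in> carrier (free_prof UNIV)" for f
    unfolding free_prof_carrier_iff
  proof (intro conjI ballI impI)
    show "\<phi>0 f \<in> extensional (fin_congs UNIV)" by (simp add: \<phi>0_def)
    fix \<theta> :: "'a list rel" assume \<theta>: "\<theta> \<in> fin_congs UNIV"
    obtain w where w: "w \<in> f (pb \<theta>)" using free_prof_class(1)[OF f pb[OF \<theta>]] by blast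
    then have "w \<noteq> []" using free_prof_class(2)[OF f pb[OF \<theta>]] by blast
    then show "\<exists>w. w \<noteq> [] \<and> \<phi>0 f \<theta> = \<theta> `` {w}" using \<phi>0[OF f \<theta> w] sub_ne by blast
    fix \<theta>' :: "'a list rel" assume \<theta>': "\<theta>' \<in> fin_congs UNIV" "\<theta> \<subseteq> \<theta>'"
    have "pb \<theta> \<subseteq> pb \<theta>'"
    proof clarify
      fix u v assume "(u, v) \<in> pb \<theta>"
      then have uv: "u \<noteq> []" "v \<noteq> []" "(sub v, sub u) \<in> \<theta>"
        using fin_cong_class_eq[OF \<theta>] sub_ne by (auto simp: pb_def)
      then have "(sub v, sub u) \<in> \<theta>'" using \<theta>' by blast
      then show "(u, v) \<in> pb \<theta>'"
        using uv fin_cong_class_eq[OF \<theta>'(1), of "sub u" "sub v"] sub_ne by (simp add: pb_def)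
    qed
    then have "w \<in> f (pb \<theta>')" using w free_prof_mono[OF f pb[OF \<theta>] pb[OF \<theta>'(1)]] by blast
    then show "\<phi>0 f \<theta> \<subseteq> \<phi>0 f \<theta>'" using \<phi>0[OF f \<theta> w] \<phi>0[OF f \<theta>'(1)] \<theta>'(2) by auto
  qed
  define \<phi> where "\<phi> = restrict \<phi>0 (carrier (free_prof UNIV))"
  show ?thesis
  proof (intro exI[of _ \<phi>] conjI allI)
    show "\<phi> \<in> extensional (carrier (free_prof UNIV))" by (simp add: \<phi>_def)
    show "\<phi> \<in> sg_hom (free_prof UNIV) (free_prof UNIV)" unfolding sg_hom_def
    proof (intro CollectI conjI ballI)
      show "\<phi> \<in> carrier (free_prof UNIV) \<rightarrow> carrier (free_prof UNIV)" using closed by (auto simp: \<phi>_def)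
      fix f k :: "'b list rel \<Rightarrow> 'b list set"
      assume fk: "f \<in> carrier (free_prof UNIV)" "k \<in> carrier (free_prof UNIV)"
      have "\<phi>0 (f \<cdot>\<^bsub>free_prof UNIV\<^esub> k) = \<phi>0 f \<cdot>\<^bsub>free_prof UNIV\<^esub> \<phi>0 k"
      proof (rule free_prof_ext)
        fix \<theta> :: "'a list rel" assume \<theta>: "\<theta> \<in> fin_congs UNIV"
        obtain u v where uv: "u \<in> f (pb \<theta>)" "v \<in> k (pb \<theta>)"
          using free_prof_class(1)[OF fk(1) pb[OF \<theta>]] free_prof_class(1)[OF fk(2) pb[OF \<theta>]] by blast
        then have nes: "sub u \<noteq> []" "sub v \<noteq> []"
          using free_prof_class(2)[OF fk(1) pb[OF \<theta>]] free_prof_class(2)[OF fk(2) pb[OF \<theta>]] sub_ne by blast+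
        have "sub u \<in> \<phi>0 f \<theta>" "sub v \<in> \<phi>0 k \<theta>"
          using \<phi>0[OF fk(1) \<theta> uv(1)] \<phi>0[OF fk(2) \<theta> uv(2)] nes equiv_class_self[OF fin_cong_equiv[OF \<theta>]] by auto
        then have "(\<phi>0 f \<cdot>\<^bsub>free_prof UNIV\<^esub> \<phi>0 k) \<theta> = \<theta> `` {sub u @ sub v}"
          using free_prof_mult_class[OF closed[OF fk(1)] closed[OF fk(2)] \<theta>] by blast
        also have "\<dots> = \<phi>0 (f \<cdot>\<^bsub>free_prof UNIV\<^esub> k) \<theta>"
          using \<phi>0[OF free_prof_mult_closed[OF fk] \<theta> mult_class_mem[OF fk pb[OF \<theta>] uv]] by (simp add: sub_app)
        finally show "\<phi>0 (f \<cdot>\<^bsub>free_prof UNIV\<^esub> k) \<theta> = (\<phi>0 f \<cdot>\<^bsub>free_prof UNIV\<^esub> \<phi>0 k) \<theta>" ..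
      qed (simp_all add: closed fk free_prof_mult_closed)
      then show "\<phi> (f \<cdot>\<^bsub>free_prof UNIV\<^esub> k) = \<phi> f \<cdot>\<^bsub>free_prof UNIV\<^esub> \<phi> k"
        using fk by (simp add: \<phi>_def free_prof_mult_closed)
    qed
    have "continuous_map (free_prof_top UNIV) (discrete_topology (plus_words UNIV // \<theta>)) (\<lambda>f. \<phi> f \<theta>)"
      if \<theta>: "\<theta> \<in> fin_congs UNIV" for \<theta>
    proof (rule continuous_map_of_class[OF pb[OF \<theta>], where k = "\<lambda>c. \<theta> `` {sub (SOME w. w \<in> c)}"])
      fix f :: "'b list rel \<Rightarrow> 'b list set" assume f: "f \<in> carrier (free_prof UNIV)"
      show "\<phi> f \<theta> = \<theta> `` {sub (SOME w. w \<in> f (pb \<theta>))}" using f \<theta> by (simp add: \<phi>_def \<phi>0_def)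
      show "\<phi> f \<theta> \<in> plus_words UNIV // \<theta>" using closed[OF f] f \<theta> by (auto simp: \<phi>_def free_prof_def PiE_iff)
    qed
    moreover have "\<phi> \<in> carrier (free_prof UNIV) \<rightarrow> carrier (free_prof UNIV)" using closed by (auto simp: \<phi>_def)
    moreover have "carrier (free_prof UNIV) \<subseteq> extensional (fin_congs UNIV)" by (auto simp: free_prof_carrier_iff)
    ultimately show "continuous_map (free_prof_top UNIV) (free_prof_top UNIV) \<phi>"
      unfolding free_prof_top_def[of "UNIV :: 'a set"] continuous_map_in_subtopology continuous_map_componentwise
      by auto
    show "\<phi> (gen UNIV a) = word (\<sigma> a)" for a
    proof (rule free_prof_ext)
      have wa: "word [a] \<in> carrier (free_prof UNIV)" by (rule word_in_carrier) simp
      then show "\<phi> (gen UNIV a) \<in> carrier (free_prof UNIV)" using closed by (simp add: \<phi>_def gen_eq_word)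
      show "word (\<sigma> a) \<in> carrier (free_prof UNIV)" using ne word_in_carrier by blast
      fix \<theta> :: "'a list rel" assume \<theta>: "\<theta> \<in> fin_congs UNIV"
      have "[a] \<in> word [a] (pb \<theta>)" by (rule word_self[OF pb[OF \<theta>]]) simp
      then show "\<phi> (gen UNIV a) \<theta> = word (\<sigma> a) \<theta>"
        using \<phi>0[OF wa \<theta>] wa word_apply[OF \<theta>] by (simp add: \<phi>_def gen_eq_word sub_def)
    qed
  qed
qed

section \<open>Limits of sequences of words\<close>

lemma word_limit_exists:
  assumes ne: "\<And>n. u n \<noteq> []" and ev: "\<And>\<theta>. \<theta> \<in> fin_congs UNIV \<Longrightarrow> \<exists>N. \<forall>n\<ge>N. \<theta> `` {u n} = \<theta> `` {u N}"
  shows "\<exists>f. limitin (free_prof_top UNIV) (\<lambda>n. word (u n)) f sequentially"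
proof -
  obtain N where N: "\<And>\<theta> n. \<lbrakk>\<theta> \<in> fin_congs UNIV; n \<ge> N \<theta>\<rbrakk> \<Longrightarrow> \<theta> `` {u n} = \<theta> `` {u (N \<theta>)}"
    using ev by metis
  define f where "f = (\<lambda>\<theta>\<in>fin_congs UNIV. \<theta> `` {u (N \<theta>)})"
  have f: "f \<in> carrier (free_prof UNIV)" unfolding free_prof_carrier_iff
  proof (intro conjI ballI impI)
    show "f \<in> extensional (fin_congs UNIV)" by (simp add: f_def)
    fix \<theta> :: "'a list rel" assume \<theta>: "\<theta> \<in> fin_congs UNIV"
    then show "\<exists>w. w \<noteq> [] \<and> f \<theta> = \<theta> `` {w}" using ne by (auto simp: f_def)
    fix \<theta>' :: "'a list rel" assume \<theta>': "\<theta>' \<in> fin_congs UNIV" "\<theta> \<subseteq> \<theta>'"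
    \<comment> \<open>At a common late index both classes are represented by the same word.\<close>
    have "f \<theta> = \<theta> `` {u (max (N \<theta>) (N \<theta>'))}" "f \<theta>' = \<theta>' `` {u (max (N \<theta>) (N \<theta>'))}"
      using N[OF \<theta>, of "max (N \<theta>) (N \<theta>')"] N[OF \<theta>'(1), of "max (N \<theta>) (N \<theta>')"] \<theta> \<theta>' by (simp_all add: f_def)
    then show "f \<theta> \<subseteq> f \<theta>'" using \<theta>'(2) by auto
  qed
  have "limitin (discrete_topology (plus_words UNIV // \<theta>)) (\<lambda>n. word (u n) \<theta>) (f \<theta>) sequentially"
    if \<theta>: "\<theta> \<in> fin_congs UNIV" for \<theta>
  proof -
    have "f \<theta> \<in> plus_words UNIV // \<theta>" using f \<theta> by (auto simp: free_prof_def PiE_iff)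
    moreover have ev: "\<forall>\<^sub>F n in sequentially. word (u n) \<theta> = f \<theta>"
    proof (rule eventually_sequentiallyI)
      fix n assume "N \<theta> \<le> n"
      then show "word (u n) \<theta> = f \<theta>"
        unfolding f_def word_apply[OF \<theta>] restrict_apply'[OF \<theta>] by (rule N[OF \<theta>])
    qed
    have "\<forall>\<^sub>F n in sequentially. word (u n) \<theta> \<in> U" if "f \<theta> \<in> U" for U
      using ev by (rule eventually_mono) (use that in simp)
    ultimately show ?thesis unfolding limitin_def by simp
  qed
  moreover have "word (u n) \<in> topspace (product_topology (\<lambda>\<theta>. discrete_topology (plus_words UNIV // \<theta>)) (fin_congs UNIV))" for n
    using word_in_carrier[OF ne] by (auto simp: free_prof_def)
  moreover have "f \<in> extensional (fin_congs UNIV)" by (simp add: f_def)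
  ultimately have "limitin (free_prof_top UNIV) (\<lambda>n. word (u n)) f sequentially"
    unfolding free_prof_top_def limitin_subtopology limitin_componentwise
    using f word_in_carrier[OF ne] by simp
  then show ?thesis by blast
qed

text \<open>A state determines the next one, so the sequence is eventually periodic, and n! is
  eventually a multiple of the period.\<close>

lemma deterministic_fact_constant:
  fixes st :: "nat \<Rightarrow> 'b"
  assumes fin: "finite (range st)" and det: "\<And>n m. st n = st m \<Longrightarrow> st (Suc n) = st (Suc m)"
  shows "\<exists>N. \<forall>n\<ge>N. st (fact n) = st (fact N)"
proof -
  have "\<not> inj st" using fin finite_imageD by fastforce
  then obtain i j where ij: "st i = st j" "i < j" unfolding inj_on_def by (metis linorder_neqE)
  then obtain p where p: "p > 0" "j = i + p" by (metis less_imp_add_positive)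
  have per: "st (n + p) = st n" if "i \<le> n" for n
    using that
  proof (induction n rule: dec_induct)
    case base
    then show ?case using ij(1) p(2) by simp
  next
    case (step n)
    show ?case using det[OF step.IH] by simp
  qed
  have per': "st (n + k * p) = st n" if "i \<le> n" for n k
  proof (induction k)
    case (Suc k)
    have "n + Suc k * p = n + k * p + p" by simp
    then have "st (n + Suc k * p) = st (n + k * p)" using per[of "n + k * p"] that by (simp only: trans_le_add1)
    then show ?case using Suc by simp
  qed simp
  \<comment> \<open>Large enough for \<open>p\<close> to divide N! and for N! to pass the preperiod
    \<open>i\<close>.\<close>
  define N where "N = i + p"
  have "st (fact n) = st (fact N)" if n: "n \<ge> N" for n
  proof -
    have le: "(fact N :: nat) \<le> fact n" using n by (rule fact_mono_nat)
    have "p dvd (fact N :: nat)" "p dvd (fact n :: nat)" using p(1) n by (simp_all add: N_def dvd_fact)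
    then have "p dvd (fact n - fact N :: nat)" by (rule dvd_diff_nat[rotated])
    then obtain k where "fact n - fact N = p * k" by (elim dvdE)
    then have "(fact n :: nat) = fact N + k * p" using le by (simp add: mult.commute)
    moreover have "i \<le> (fact N :: nat)" using fact_ge_self[of N] by (simp add: N_def)
    ultimately show ?thesis using per'[of "fact N" k] by simp
  qed
  then show ?thesis by blast
qed

section \<open>The pseudowords of the theorem\<close>

text \<open>The words \<lambda> and \<rho> as plain lists, with middle factors z, z^2, ...; the run
  counts from 0, hence the \<open>Suc\<close>.\<close>

definition engel_words :: "nat \<Rightarrow> var list \<times> var list" where
  "engel_words = twist (\<lambda>l z r. l @ z @ r) (\<lambda>i. replicate (Suc i) VZ) ([VX], [VY])"

lemma engel_words_Suc:
  "engel_words (Suc n) = (fst (engel_words n) @ replicate (Suc n) VZ @ snd (engel_words n),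
     snd (engel_words n) @ replicate (Suc n) VZ @ fst (engel_words n))"
  by (simp add: engel_words_def split: prod.splits)

lemma engel_words_nonempty: "fst (engel_words n) \<noteq> []" "snd (engel_words n) \<noteq> []"
  by (induction n) (simp_all add: engel_words_Suc, simp_all add: engel_words_def)

lemma hom_word_append:
  assumes "k \<in> sg_hom (free_prof UNIV) S" "u \<noteq> []" "v \<noteq> []"
  shows "k (word (u @ v)) = k (word u) \<cdot>\<^bsub>S\<^esub> k (word v)"
proof -
  have "k (word u \<cdot>\<^bsub>free_prof UNIV\<^esub> word v) = k (word u) \<cdot>\<^bsub>S\<^esub> k (word v)"
    using assms(1) word_in_carrier[OF assms(2)] word_in_carrier[OF assms(3)] unfolding sg_hom_def by blast
  then show ?thesis unfolding word_append[OF assms(2,3)] .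
qed

lemma twist_engel_words:
  assumes k: "k \<in> sg_hom F3 S" and z: "\<And>i. z i = Some (k (word (replicate (Suc i) VZ)))"
  shows "twist (triple (with_one S)) z (Some (k gx), Some (k gy)) n =
    map_prod (\<lambda>w. Some (k (word w))) (\<lambda>w. Some (k (word w))) (engel_words n)"
proof -
  have "twist (triple (with_one S)) z (map_prod (\<lambda>w. Some (k (word w))) (\<lambda>w. Some (k (word w))) ([VX], [VY])) n =
      map_prod (\<lambda>w. Some (k (word w))) (\<lambda>w. Some (k (word w))) (engel_words n)"
    unfolding engel_words_def
  proof (rule twist_hom[where A = "- {[]}"])
    fix l r :: "var list" and i :: nat
    assume lr: "l \<in> - {[]}" "r \<in> - {[]}"
    then have "k (word (l @ replicate (Suc i) VZ @ r)) =
        k (word l) \<cdot>\<^bsub>S\<^esub> k (word (replicate (Suc i) VZ)) \<cdot>\<^bsub>S\<^esub> k (word r)"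
      using hom_word_append[OF k, of "l @ replicate (Suc i) VZ" r] hom_word_append[OF k, of l "replicate (Suc i) VZ"]
      by simp
    then show "Some (k (word (l @ replicate (Suc i) VZ @ r))) =
        triple (with_one S) (Some (k (word l))) (z i) (Some (k (word r)))"
      unfolding z triple_def by (simp only: with_one_simps)
  qed auto
  then show ?thesis by (simp add: gen_eq_word)
qed

lemma hom_word_pow:
  assumes k: "k \<in> sg_hom F3 S"
  shows "Some (k gz) [^]\<^bsub>with_one S\<^esub> Suc i = Some (k (word (replicate (Suc i) VZ)))"
proof (induction i)
  case 0
  then show ?case by (simp add: nat_pow_def gen_eq_word)
next
  case (Suc i)
  have "Some (k gz) [^]\<^bsub>with_one S\<^esub> Suc (Suc i) = Some (k gz) [^]\<^bsub>with_one S\<^esub> Suc i \<otimes>\<^bsub>with_one S\<^esub> Some (k gz)"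
    by (simp add: nat_pow_def)
  also have "\<dots> = Some (k (word (replicate (Suc i) VZ)) \<cdot>\<^bsub>S\<^esub> k (word [VZ]))"
    unfolding Suc by (simp only: with_one_simps gen_eq_word)
  also have "\<dots> = Some (k (word (replicate (Suc i) VZ @ [VZ])))"
    using hom_word_append[OF k, of "replicate (Suc i) VZ" "[VZ]"] by simp
  also have "replicate (Suc i) VZ @ [VZ] = replicate (Suc (Suc i)) VZ" by (simp add: replicate_append_same)
  finally show ?case .
qed

lemma id_hom: "(\<lambda>x. x) \<in> sg_hom S S"
  by (simp add: sg_hom_def)

text \<open>Only positive exponents of z occur, so it is immaterial at which identity the powers
  start.\<close>

lemma lam_rho_F3:
  "lam F3 gx gy (\<lambda>i. Some gz [^]\<^bsub>adjoin_one F3\<^esub> i) n = word (fst (engel_words n))" (is ?lam)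
  "rho F3 gx gy (\<lambda>i. Some gz [^]\<^bsub>adjoin_one F3\<^esub> i) n = word (snd (engel_words n))" (is ?rho)
proof -
  interpret F: sgroup F3 by (rule sgroup_free_prof)
  have gz: "gz \<in> carrier F3" by (simp add: gen_eq_word word_in_carrier)
  have pow: "Some gz [^]\<^bsub>adjoin_one F3\<^esub> Suc i = Some gz [^]\<^bsub>with_one F3\<^esub> Suc i" for i
  proof (induction i)
    case 0
    have "Some gz [^]\<^bsub>adjoin_one F3\<^esub> Suc 0 = \<one>\<^bsub>adjoin_one F3\<^esub> \<otimes>\<^bsub>with_one F3\<^esub> Some gz"
      by (simp add: nat_pow_def mult_adjoin_one)
    then show ?case using F.mult_one_adjoin(2)[OF gz] by (simp add: nat_pow_def)
  next
    case (Suc i)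
    then show ?case by (simp add: nat_pow_def mult_adjoin_one)
  qed
  have "twist (triple (with_one F3)) (\<lambda>i. Some gz [^]\<^bsub>adjoin_one F3\<^esub> Suc i) (Some gx, Some gy) n =
      map_prod (\<lambda>w. Some (word w)) (\<lambda>w. Some (word w)) (engel_words n)"
    unfolding pow by (rule twist_engel_words[OF id_hom hom_word_pow[OF id_hom]])
  then have "(Some (lam F3 gx gy (\<lambda>i. Some gz [^]\<^bsub>adjoin_one F3\<^esub> i) n), Some (rho F3 gx gy (\<lambda>i. Some gz [^]\<^bsub>adjoin_one F3\<^esub> i) n)) =
      map_prod (\<lambda>w. Some (word w)) (\<lambda>w. Some (word w)) (engel_words n)"
    unfolding twist_with_one[where z = "\<lambda>i. Some gz [^]\<^bsub>adjoin_one F3\<^esub> i"] .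
  then show ?lam ?rho by (simp_all add: map_prod_def split: prod.splits)
qed

lemma engel_words_eventually:
  assumes \<theta>: "\<theta> \<in> fin_congs UNIV"
  shows "\<exists>N. \<forall>n\<ge>N. \<theta> `` {fst (engel_words (fact n))} = \<theta> `` {fst (engel_words (fact N))} \<and>
    \<theta> `` {snd (engel_words (fact n))} = \<theta> `` {snd (engel_words (fact N))}"
proof -
  \<comment> \<open>The class of the power of z belongs to the state: together with the classes of
    the two words it determines the next state.\<close>
  define st where "st n = (\<theta> `` {fst (engel_words n)}, \<theta> `` {snd (engel_words n)}, \<theta> `` {replicate (Suc n) VZ})" for n
  let ?Q = "(- {[]}) // \<theta>"
  have cong: "\<theta> `` {u @ v} = \<theta> `` {u' @ v'}"
    if "\<theta> `` {u} = \<theta> `` {u'}" "\<theta> `` {v} = \<theta> `` {v'}" "u \<noteq> []" "v \<noteq> []" for u u' v v'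
  proof -
    have "(u', u) \<in> \<theta>" "(v', v) \<in> \<theta>" using that fin_cong_class_eq[OF \<theta>] by blast+
    then have "(u' @ v', u @ v) \<in> \<theta>" by (rule fin_cong_append[OF \<theta>])
    then show ?thesis using fin_cong_class_eq[OF \<theta>, of "u @ v"] that(3) by simp
  qed
  have "st n \<in> ?Q \<times> ?Q \<times> ?Q" for n
    unfolding st_def by (intro SigmaI quotientI) (simp_all add: engel_words_nonempty)
  then have "range st \<subseteq> ?Q \<times> ?Q \<times> ?Q" by blast
  moreover have "finite ?Q" using \<theta> by (simp add: fin_congs_iff)
  ultimately have "finite (range st)" by (meson finite_SigmaI finite_subset)
  moreover have "st (Suc n) = st (Suc m)" if "st n = st m" for n m
  proof -
    have eq: "\<theta> `` {fst (engel_words n)} = \<theta> `` {fst (engel_words m)}"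
      "\<theta> `` {snd (engel_words n)} = \<theta> `` {snd (engel_words m)}"
      "\<theta> `` {replicate (Suc n) VZ} = \<theta> `` {replicate (Suc m) VZ}" using that by (simp_all only: st_def prod.inject)
    have z: "\<theta> `` {replicate (Suc (Suc n)) VZ} = \<theta> `` {replicate (Suc (Suc m)) VZ}"
      using cong[OF refl[of "\<theta> `` {[VZ]}"] eq(3)] by simp
    have "\<theta> `` {fst (engel_words (Suc n))} = \<theta> `` {fst (engel_words (Suc m))}"
      "\<theta> `` {snd (engel_words (Suc n))} = \<theta> `` {snd (engel_words (Suc m))}"
      unfolding engel_words_Suc fst_conv snd_conv
      by (intro cong eq engel_words_nonempty; simp)+
    then show ?thesis using z by (simp only: st_def)
  qed
  ultimately obtain N where "\<forall>n\<ge>N. st (fact n) = st (fact N)" using deterministic_fact_constant by blast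
  then show ?thesis unfolding st_def prod.inject by blast
qed

text \<open>This resolves the definite description: limits exist in both components, and the product
  is Hausdorff, so no other pair is a limit.\<close>

lemma lamrho_PE_limit:
  "limitin F3_top (\<lambda>n. word (fst (engel_words (fact n)))) lam_PE sequentially"
  "limitin F3_top (\<lambda>n. word (snd (engel_words (fact n)))) rho_PE sequentially"
proof -
  let ?s = "\<lambda>n. (lam F3 gx gy (\<lambda>i. Some gz [^]\<^bsub>adjoin_one F3\<^esub> i) (fact n),
    rho F3 gx gy (\<lambda>i. Some gz [^]\<^bsub>adjoin_one F3\<^esub> i) (fact n))"
  have s: "?s = (\<lambda>n. (word (fst (engel_words (fact n))), word (snd (engel_words (fact n)))))"
    by (simp only: lam_rho_F3)
  obtain f where f: "limitin F3_top (\<lambda>n. word (fst (engel_words (fact n)))) f sequentially"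
    using word_limit_exists[of "\<lambda>n. fst (engel_words (fact n))"] engel_words_nonempty engel_words_eventually by meson
  obtain g where g: "limitin F3_top (\<lambda>n. word (snd (engel_words (fact n)))) g sequentially"
    using word_limit_exists[of "\<lambda>n. snd (engel_words (fact n))"] engel_words_nonempty engel_words_eventually by meson
  have lim: "limitin (prod_topology F3_top F3_top) ?s (f, g) sequentially"
    unfolding s limitin_pairwise using f g by (simp add: o_def)
  have H: "Hausdorff_space F3_top" by (rule Hausdorff_free_prof_top)
  have eq: "lamrho_PE = (f, g)" unfolding lamrho_PE_def
  proof (rule the_equality)
    show "limitin (prod_topology F3_top F3_top) ?s (f, g) sequentially" by (rule lim)
    show "p = (f, g)" if "limitin (prod_topology F3_top F3_top) ?s p sequentially" for p
      using limitin_Hausdorff_unique[OF that lim] H by (simp add: Hausdorff_space_prod_topology)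
  qed
  have "lam_PE = f" "rho_PE = g" unfolding lam_PE_def rho_PE_def eq by simp_all
  then show "limitin F3_top (\<lambda>n. word (fst (engel_words (fact n)))) lam_PE sequentially"
    "limitin F3_top (\<lambda>n. word (snd (engel_words (fact n)))) rho_PE sequentially" using f g by simp_all
qed

fun phi_word :: "var \<Rightarrow> var list" where
  "phi_word VX = [VX, VZ, VZ, VX]"
| "phi_word VY = [VZ, VX, VX, VZ]"
| "phi_word VZ = [VZ]"

text \<open>The described endomorphism exists as a substitution of words. It is unique because its
  values on the generators determine it on the carrier and extensionality does so elsewhere.\<close>

lemma phi_PE_props:
  "phi_PE \<in> sg_hom F3 F3" "continuous_map F3_top F3_top phi_PE" "phi_PE (gen UNIV v) = word (phi_word v)"
proof -
  have ne: "phi_word a \<noteq> []" for a by (cases a) simp_all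
  obtain \<phi> where \<phi>: "\<phi> \<in> extensional (carrier F3)" "\<phi> \<in> sg_hom F3 F3" "continuous_map F3_top F3_top \<phi>"
    "\<And>a. \<phi> (gen UNIV a) = word (phi_word a)"
    using substitution_exists[of phi_word, OF ne] by blast
  have prods: "gx \<cdot>\<^bsub>F3\<^esub> gz \<cdot>\<^bsub>F3\<^esub> gz \<cdot>\<^bsub>F3\<^esub> gx = word (phi_word VX)" "gz \<cdot>\<^bsub>F3\<^esub> gx \<cdot>\<^bsub>F3\<^esub> gx \<cdot>\<^bsub>F3\<^esub> gz = word (phi_word VY)"
    "gz = word (phi_word VZ)"
    by (simp_all add: gen_eq_word word_append)
  have "phi_PE = \<phi>" unfolding phi_PE_def
  proof (rule the_equality)
    show "\<phi> \<in> extensional (carrier F3) \<and> \<phi> \<in> sg_hom F3 F3 \<and> continuous_map F3_top F3_top \<phi> \<and>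
        \<phi> gx = gx \<cdot>\<^bsub>F3\<^esub> gz \<cdot>\<^bsub>F3\<^esub> gz \<cdot>\<^bsub>F3\<^esub> gx \<and> \<phi> gy = gz \<cdot>\<^bsub>F3\<^esub> gx \<cdot>\<^bsub>F3\<^esub> gx \<cdot>\<^bsub>F3\<^esub> gz \<and> \<phi> gz = gz"
      using \<phi> prods by metis
    fix \<psi> assume "\<psi> \<in> extensional (carrier F3) \<and> \<psi> \<in> sg_hom F3 F3 \<and> continuous_map F3_top F3_top \<psi> \<and>
        \<psi> gx = gx \<cdot>\<^bsub>F3\<^esub> gz \<cdot>\<^bsub>F3\<^esub> gz \<cdot>\<^bsub>F3\<^esub> gx \<and> \<psi> gy = gz \<cdot>\<^bsub>F3\<^esub> gx \<cdot>\<^bsub>F3\<^esub> gx \<cdot>\<^bsub>F3\<^esub> gz \<and> \<psi> gz = gz"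
    then have \<psi>: "\<psi> \<in> extensional (carrier F3)" "\<psi> \<in> sg_hom F3 F3" "continuous_map F3_top F3_top \<psi>"
      and g: "\<psi> gx = word (phi_word VX)" "\<psi> gy = word (phi_word VY)" "\<psi> gz = word (phi_word VZ)"
      unfolding prods(1,2) by (simp_all add: gen_eq_word)
    have gen: "\<psi> (gen UNIV a) = \<phi> (gen UNIV a)" for a by (cases a) (simp_all only: g \<phi>(4))
    show "\<psi> = \<phi>" using \<psi>(1) \<phi>(1)
    proof (rule extensionalityI)
      fix f assume "f \<in> carrier F3"
      then show "\<psi> f = \<phi> f"
        using hom_unique[OF \<psi>(2) \<phi>(2) gen \<psi>(3) \<phi>(3) Hausdorff_free_prof_top] by blast
    qed
  qed
  then show "phi_PE \<in> sg_hom F3 F3" "continuous_map F3_top F3_top phi_PE" "phi_PE (gen UNIV v) = word (phi_word v)"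
    using \<phi> by simp_all
qed

lemma sg_hom_comp: "\<lbrakk>f \<in> sg_hom S T; g \<in> sg_hom T U\<rbrakk> \<Longrightarrow> (\<lambda>x. g (f x)) \<in> sg_hom S U"
  by (auto simp: sg_hom_def Pi_iff)

text \<open>Composing \<open>h\<close> with \<phi> starts the run with middle factors c, c^2, ... at
  (acca, caac), for a = \<open>h gx\<close> and c = \<open>h gz\<close>. This is where the run from
  (a, c) arrives after two steps with middle factor 1.\<close>

lemma limit_eq_iff_merges:
  assumes S: "sgroup S" and h: "h \<in> sg_hom F3 S" and c: "continuous_map F3_top (discrete_topology (carrier S)) h"
  shows "h (phi_PE lam_PE) = h (phi_PE rho_PE) \<longleftrightarrow>
    merges (triple (with_one S)) (\<lambda>i. Some (h gz) [^]\<^bsub>with_one S\<^esub> (i - 1)) (Some (h gx), Some (h gz))"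
proof -
  interpret sgroup S by fact
  interpret W: monoid "with_one S" by (rule monoid_with_one)
  define k where "k x = h (phi_PE x)" for x
  have k: "k \<in> sg_hom F3 S" unfolding k_def by (rule sg_hom_comp[OF phi_PE_props(1) h])
  have kc: "continuous_map F3_top (discrete_topology (carrier S)) k"
    using continuous_map_compose[OF phi_PE_props(2) c] by (simp add: o_def k_def[abs_def])
  let ?a = "h gx" and ?c = "h gz"
  have car: "?a \<in> carrier S" "?c \<in> carrier S"
    using h word_in_carrier[of "[VX]"] word_in_carrier[of "[VZ]"] by (auto simp: sg_hom_def gen_eq_word)
  have app: "h (word (u @ v)) = h (word u) \<cdot>\<^bsub>S\<^esub> h (word v)" if "u \<noteq> []" "v \<noteq> []" for u v
    using hom_word_append[OF h that] .
  have kz: "k gz = ?c" unfolding k_def phi_PE_props(3) by (simp add: gen_eq_word)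
  have kx: "k gx = ?a \<cdot>\<^bsub>S\<^esub> ?c \<cdot>\<^bsub>S\<^esub> (?c \<cdot>\<^bsub>S\<^esub> ?a)"
    using app[of "[VX, VZ]" "[VZ, VX]"] app[of "[VX]" "[VZ]"] app[of "[VZ]" "[VX]"]
    unfolding k_def phi_PE_props(3) by (simp add: gen_eq_word)
  have ky: "k gy = ?c \<cdot>\<^bsub>S\<^esub> ?a \<cdot>\<^bsub>S\<^esub> (?a \<cdot>\<^bsub>S\<^esub> ?c)"
    using app[of "[VZ, VX]" "[VX, VZ]"] app[of "[VX]" "[VZ]"] app[of "[VZ]" "[VX]"]
    unfolding k_def phi_PE_props(3) by (simp add: gen_eq_word)
  define z where "z i = Some ?c [^]\<^bsub>with_one S\<^esub> (i - 1)" for i :: nat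
  define E where "E n \<longleftrightarrow> k (word (fst (engel_words n))) = k (word (snd (engel_words n)))" for n
  have two: "twist (triple (with_one S)) z (Some ?a, Some ?c) 2 = (Some (k gx), Some (k gy))"
    using car by (simp add: numeral_2_eq_2 triple_def z_def nat_pow_def kx ky)
  have z2: "(\<lambda>i. z (2 + i)) = (\<lambda>i. Some (k gz) [^]\<^bsub>with_one S\<^esub> Suc i)" by (simp add: z_def kz)
  have words: "twist (triple (with_one S)) (\<lambda>i. z (2 + i)) (twist (triple (with_one S)) z (Some ?a, Some ?c) 2) n =
      (Some (k (word (fst (engel_words n)))), Some (k (word (snd (engel_words n)))))" for n
    unfolding two z2 using twist_engel_words[OF k hom_word_pow[OF k], of n] by (simp add: map_prod_def split: prod.splits)
  have Emono: "E m" if "E n" "n \<le> m" for n m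
    using twist_eq_mono[of "triple (with_one S)" "\<lambda>i. z (2 + i)" "twist (triple (with_one S)) z (Some ?a, Some ?c) 2" n m] that
    unfolding words E_def by simp
  have merges: "merges (triple (with_one S)) z (Some ?a, Some ?c) \<longleftrightarrow> (\<exists>n. E n)"
    using merges_shift[of "triple (with_one S)" z 2 "(Some ?a, Some ?c)"] unfolding merges_def words E_def by simp
  have ev: "\<forall>\<^sub>F n in sequentially. k (u n) = k l" if l: "limitin F3_top u l sequentially" for u l
  proof -
    have lim: "limitin (discrete_topology (carrier S)) (k \<circ> u) (k l) sequentially"
      by (rule continuous_map_limit[OF kc l])
    have "k l \<in> carrier S" using limitin_topspace[OF lim] by simp
    then have "\<forall>\<^sub>F n in sequentially. (k \<circ> u) n \<in> {k l}" by (intro limitinD[OF lim]) simp_all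
    then show ?thesis by (rule eventually_mono) simp
  qed
  \<comment> \<open>Continuity into a discrete space makes the images of both sequences eventually
    equal to those of their limits. As \<open>E\<close> persists once true, testing it at late
    factorials decides whether it ever holds.\<close>
  have "\<forall>\<^sub>F n in sequentially. E (fact n) \<longleftrightarrow> k lam_PE = k rho_PE"
    using ev[OF lamrho_PE_limit(1)] ev[OF lamrho_PE_limit(2)] by eventually_elim (simp add: E_def)
  then obtain N where N: "\<forall>n\<ge>N. E (fact n) \<longleftrightarrow> k lam_PE = k rho_PE"
    unfolding eventually_sequentially by (elim exE)
  have "k lam_PE = k rho_PE \<longleftrightarrow> (\<exists>n. E n)"
  proof
    assume "\<exists>n. E n"
    then obtain n where "E n" by blast
    moreover have "n \<le> fact (max n N)" using fact_ge_self[of "max n N"] by (meson max.cobounded1 order_trans)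
    ultimately have "E (fact (max n N))" by (rule Emono)
    then show "k lam_PE = k rho_PE" using N by simp
  next
    assume "k lam_PE = k rho_PE"
    then have "E (fact N)" using N by simp
    then show "\<exists>n. E n" by (rule exI)
  qed
  then show ?thesis using merges by (simp add: k_def z_def[abs_def])
qed

lemma models_iff: "S \<in> models UNIV {(phi_PE lam_PE, phi_PE rho_PE)} \<longleftrightarrow> finite_sgroup S \<and> engel_test S"
proof (cases "finite_sgroup S")
  case True
  then interpret sgroup S by (simp add: finite_sgroup_def)
  have fin: "finite (carrier S)" using True by (simp add: finite_sgroup_def)
  have "satisfies UNIV S (phi_PE lam_PE, phi_PE rho_PE) \<longleftrightarrow> engel_test S"
  proof
    assume s: "satisfies UNIV S (phi_PE lam_PE, phi_PE rho_PE)"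
    show "engel_test S" unfolding engel_test_def
    proof (intro ballI)
      fix a c assume ac: "a \<in> carrier S" "c \<in> carrier S"
      \<comment> \<open>Every pair \<open>(a, c)\<close> occurs as the images of x and z. The value
        at \<open>VY\<close> is just some element of \<open>S\<close>, since the images under \<phi>
        are free of y.\<close>
      define g where "g v = (if v = VX then a else c)" for v
      have "range g \<subseteq> carrier S" using ac by (auto simp: g_def)
      then obtain h where h: "h \<in> sg_hom F3 S" "continuous_map F3_top (discrete_topology (carrier S)) h"
        "\<And>v. h (gen UNIV v) = g v" using free_prof_hom_exists[OF fin] by blast
      then have "h (phi_PE lam_PE) = h (phi_PE rho_PE)" using s by (simp add: satisfies_def)
      then show "merges (triple (with_one S)) (\<lambda>i. Some c [^]\<^bsub>with_one S\<^esub> (i - 1)) (Some a, Some c)"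
        using limit_eq_iff_merges[OF sgroup_axioms h(1,2)] by (simp add: h(3) g_def)
    qed
  next
    assume e: "engel_test S"
    show "satisfies UNIV S (phi_PE lam_PE, phi_PE rho_PE)" unfolding satisfies_def
    proof (intro allI impI)
      fix h assume h: "h \<in> sg_hom F3 S \<and> continuous_map F3_top (discrete_topology (carrier S)) h"
      then have "h gx \<in> carrier S" "h gz \<in> carrier S"
        using word_in_carrier[of "[VX]"] word_in_carrier[of "[VZ]"] by (auto simp: sg_hom_def gen_eq_word)
      then show "h (fst (phi_PE lam_PE, phi_PE rho_PE)) = h (snd (phi_PE lam_PE, phi_PE rho_PE))"
        using limit_eq_iff_merges[OF sgroup_axioms conjunct1[OF h] conjunct2[OF h]] e
        by (simp add: engel_test_def)
    qed
  qed
  then show ?thesis using True by (simp add: models_def)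
qed (simp add: models_def)

theorem theorem4p3:
  shows "(PE :: 's sgrp set) = TM \<inter> models UNIV {(phi_PE lam_PE, phi_PE rho_PE)}"
proof (rule Set.set_eqI)
  fix S :: "'s sgrp"
  have "S \<in> TM \<Longrightarrow> finite_sgroup S" by (simp add: TM_def)
  then show "S \<in> PE \<longleftrightarrow> S \<in> TM \<inter> models UNIV {(phi_PE lam_PE, phi_PE rho_PE)}"
    by (auto simp: PE_iff models_iff)
qed

end
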